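(* Let $\Omega\subset\mathbb{R}^N$ be a bounded smooth domain and $p_1,p_2\in C_+(\overline{\Omega})$. Let $f\in L^{\alpha(x)}(\Omega)$ where $\alpha\in C_+(\overline{\Omega})$ satisfies $\frac{1}{\alpha(x)}+\frac{1}{p_M^*(x)}<1$ for all $x\in\overline{\Omega}$. Then the problem $$-\mathrm{div}(|\nabla u|^{p_1(x)-2}\nabla u)-\mathrm{div}(|\nabla u|^{p_2(x)-2}\nabla u)=f(x)\ \text{in }\Omega,\qquad u=0\ \text{on }\partial\Omega$$ has a unique weak solution.
   Context: $C_+(\overline{\Omega})=\{h\in C(\overline{\Omega}):h(x)>1\ \forall x\in\overline{\Omega}\}$. $p_M(x)=\max\{p_1(x),p_2(x)\}$, and for $p\in C_+(\overline\Omega)$, $p^*(x)=\frac{Np(x)}{N-p(x)}$ if $p(x)<N$ and $p^*(x)=\infty$ if $p(x)\ge N$. Variable exponent spaces: $L^{p(x)}(\Omega)$ is the space of measurable $u$ with $\int_\Omega|u|^{p(x)}dx<\infty$ with Luxemburg norm $|u|_{p(x)}=\inf\{\lambda>0:\int_\Omega|u/\lambda|^{p(x)}dx\le1\}$; $W^{1,p(x)}(\Omega)=\{u\in L^{p(x)}:|\nabla u|\in L^{p(x)}\}$ with norm $|u|_{p(x)}+|\nabla u|_{p(x)}$; $W_0^{1,p(x)}(\Omega)$ is the closure of $C_0^\infty(\Omega)$ in it. $X:=W_0^{1,p_1(x)}(\Omega)\cap W_0^{1,p_2(x)}(\Omega)$. A weak solution is $u\in X$ with $\int_\Omega|\nabla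 u|^{p_1(x)-2}\nabla u\cdot\nabla v\,dx+\int_\Omega|\nabla u|^{p_2(x)-2}\nabla u\cdot\nabla v\,dx=\int_\Omega f v\,dx$ for all $v\in X$. *)

theory Defs
  imports "HOL-Analysis.Analysis"
begin

fun Ck_on :: "nat \<Rightarrow> 'a::euclidean_space set \<Rightarrow> ('a \<Rightarrow> real) \<Rightarrow> bool" where
  "Ck_on 0 S f = continuous_on S f"
| "Ck_on (Suc k) S f =
     (\<exists>D. (\<forall>x\<in>S. (f has_derivative D x) (at x)) \<and> (\<forall>b\<in>Basis. Ck_on k S (\<lambda>x. D x b)))"

definition smooth_on :: "'a::euclidean_space set \<Rightarrow> ('a \<Rightarrow> real) \<Rightarrow> bool" where
  "smooth_on S f \<longleftrightarrow> (\<forall>k. Ck_on k S f)"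

definition smooth_bounded_domain :: "'a::euclidean_space set \<Rightarrow> bool" where
  "smooth_bounded_domain \<Omega> \<longleftrightarrow> open \<Omega> \<and> connected \<Omega> \<and> bounded \<Omega> \<and> \<Omega> \<noteq> {} \<and>
     (\<forall>x\<in>frontier \<Omega>. \<exists>r>0. \<exists>\<phi>. smooth_on UNIV \<phi> \<and>
        (\<forall>y\<in>ball x r. frechet_derivative \<phi> (at y) \<noteq> (\<lambda>_. 0)) \<and>
        \<Omega> \<inter> ball x r = {y\<in>ball x r. \<phi> y < 0})"

definition test_fun :: "'a::euclidean_space set \<Rightarrow> ('a \<Rightarrow> real) \<Rightarrow> bool" where
  "test_fun \<Omega> \<phi> \<longleftrightarrow> smooth_on UNIV \<phi> \<and> compact (closure {x. \<phi> x \<noteq> 0}) \<and>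
      closure {x. \<phi> x \<noteq> 0} \<subseteq> \<Omega>"

definition grad :: "('a::euclidean_space \<Rightarrow> real) \<Rightarrow> 'a \<Rightarrow> 'a" where
  "grad \<phi> x = (\<Sum>b\<in>Basis. frechet_derivative \<phi> (at x) b *\<^sub>R b)"

definition C_plus :: "'a::euclidean_space set \<Rightarrow> ('a \<Rightarrow> real) \<Rightarrow> bool" where
  "C_plus \<Omega> h \<longleftrightarrow> continuous_on (closure \<Omega>) h \<and> (\<forall>x\<in>closure \<Omega>. h x > 1)"

definition crit_exp :: "('a::euclidean_space \<Rightarrow> real) \<Rightarrow> 'a \<Rightarrow> ereal" where
  "crit_exp p x = (if p x < real DIM('a)
      then ereal (real DIM('a) * p x / (real DIM('a) - p x)) else \<infinity>)"

definition modular :: "'a::euclidean_space set \<Rightarrow> ('a \<Rightarrow> real) \<Rightarrow> ('a \<Rightarrow> real) \<Rightarrow> ennreal" where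
  "modular \<Omega> p u = (\<integral>\<^sup>+ x. ennreal (\<bar>u x\<bar> powr p x) \<partial>lebesgue_on \<Omega>)"

definition Lp_var :: "'a::euclidean_space set \<Rightarrow> ('a \<Rightarrow> real) \<Rightarrow> ('a \<Rightarrow> real) set" where
  "Lp_var \<Omega> p = {u. u \<in> borel_measurable (lebesgue_on \<Omega>) \<and> modular \<Omega> p u < \<infinity>}"

definition lux_norm :: "'a::euclidean_space set \<Rightarrow> ('a \<Rightarrow> real) \<Rightarrow> ('a \<Rightarrow> real) \<Rightarrow> real" where
  "lux_norm \<Omega> p u = Inf {t::real. t > 0 \<and> modular \<Omega> p (\<lambda>x. u x / t) \<le> 1}"

definition weak_grad :: "'a::euclidean_space set \<Rightarrow> ('a \<Rightarrow> real) \<Rightarrow> ('a \<Rightarrow> 'a) \<Rightarrow> bool" where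
  "weak_grad \<Omega> u g \<longleftrightarrow> u \<in> borel_measurable (lebesgue_on \<Omega>) \<and>
     g \<in> borel_measurable (lebesgue_on \<Omega>) \<and>
     (\<forall>\<phi> i. test_fun \<Omega> \<phi> \<and> i \<in> Basis \<longrightarrow>
        integrable (lebesgue_on \<Omega>) (\<lambda>x. u x * frechet_derivative \<phi> (at x) i) \<and>
        integrable (lebesgue_on \<Omega>) (\<lambda>x. (g x \<bullet> i) * \<phi> x) \<and>
        (\<integral>x. u x * frechet_derivative \<phi> (at x) i \<partial>lebesgue_on \<Omega>) =
          - (\<integral>x. (g x \<bullet> i) * \<phi> x \<partial>lebesgue_on \<Omega>))"

definition W0_grad :: "'a::euclidean_space set \<Rightarrow> ('a \<Rightarrow> real) \<Rightarrow> ('a \<Rightarrow> real) \<Rightarrow> ('a \<Rightarrow> 'a) \<Rightarrow> bool" where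
  "W0_grad \<Omega> p u g \<longleftrightarrow> weak_grad \<Omega> u g \<and> u \<in> Lp_var \<Omega> p \<and> (\<lambda>x. norm (g x)) \<in> Lp_var \<Omega> p \<and>
     (\<exists>\<phi>::nat \<Rightarrow> 'a \<Rightarrow> real. (\<forall>k. test_fun \<Omega> (\<phi> k)) \<and>
        (\<lambda>k. lux_norm \<Omega> p (\<lambda>x. \<phi> k x - u x) + lux_norm \<Omega> p (\<lambda>x. norm (grad (\<phi> k) x - g x)))
          \<longlonglongrightarrow> 0)"

definition W0 :: "'a::euclidean_space set \<Rightarrow> ('a \<Rightarrow> real) \<Rightarrow> ('a \<Rightarrow> real) set" where
  "W0 \<Omega> p = {u. \<exists>g. W0_grad \<Omega> p u g}"

text \<open>X = W_0^{1,p1} \<inter> W_0^{1,p2}; weak solution of the (p1,p2)-Laplacian problem.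
  Weak gradients are a.e. unique, so quantifying over all weak gradients of the test
  function v is harmless.\<close>
definition weak_solution ::
  "'a::euclidean_space set \<Rightarrow> ('a \<Rightarrow> real) \<Rightarrow> ('a \<Rightarrow> real) \<Rightarrow> ('a \<Rightarrow> real) \<Rightarrow> ('a \<Rightarrow> real) \<Rightarrow> bool" where
  "weak_solution \<Omega> p1 p2 f u \<longleftrightarrow> u \<in> W0 \<Omega> p1 \<and> u \<in> W0 \<Omega> p2 \<and>
     (\<exists>g. weak_grad \<Omega> u g \<and>
       (\<forall>v h. v \<in> W0 \<Omega> p1 \<and> v \<in> W0 \<Omega> p2 \<and> weak_grad \<Omega> v h \<longrightarrow>
          (\<integral>x. norm (g x) powr (p1 x - 2) * (g x \<bullet> h x) \<partial>lebesgue_on \<Omega>) +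
          (\<integral>x. norm (g x) powr (p2 x - 2) * (g x \<bullet> h x) \<partial>lebesgue_on \<Omega>) =
          (\<integral>x. f x * v x \<partial>lebesgue_on \<Omega>)))"

end

theory Submission
  imports Defs
begin

text \<open>
  The solution minimizes \<open>\<Sum>i. \<integral>|\<nabla>u|^p\<^sub>i / p\<^sub>i - \<integral>f u\<close>. Test functions satisfy
  \<open>|\<phi>(x)| \<le> C \<integral>|\<nabla>\<phi>(y)| |x - y|^(1-N) dy\<close>, and this bound passes to \<open>W\<^sub>0\<close>. Together with a
  trilinear Young inequality for \<open>\<integral>\<integral>h(x) g(y) |x - y|^(1-N)\<close>, in which the exponents may vary
  because only nearly constant values matter near the diagonal, it yields both the Poincare
  inequality and the boundedness of \<open>u \<mapsto> \<integral>f u\<close>, with neither cut-offs nor Sobolev embeddings.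
  Uniform convexity makes minimizing sequences Cauchy, so no weak compactness is needed. The strict
  tangent inequality \<open>|\<xi>|^p + p |\<xi>|^(p-2) \<xi>\<cdot>(\<eta> - \<xi>) < |\<eta>|^p\<close> for \<open>\<xi> \<noteq> \<eta>\<close> is the source of the
  uniform convexity, of the Euler--Lagrange equation and of uniqueness.
\<close>

section \<open>Smooth functions\<close>

lemma Ck_on_Suc_imp_Ck_on: "Ck_on (Suc k) S f \<Longrightarrow> Ck_on k S f"
proof (induction k arbitrary: f)
  case 0
  then have "f differentiable at x" if "x \<in> S" for x
    using that by (auto simp: differentiable_def)
  then show ?case
    by (simp add: continuous_at_imp_continuous_on differentiable_imp_continuous_within)
next
  case (Suc k)
  from Suc.prems obtain D where "\<forall>x\<in>S. (f has_derivative D x) (at x)"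
    and "\<forall>b\<in>Basis. Ck_on (Suc k) S (\<lambda>x. D x b)"
    by (subst (asm) Ck_on.simps(2)) blast
  with Suc.IH show ?case by auto
qed

lemma Ck_on_const: "Ck_on k S (\<lambda>_. c)"
proof (induction k arbitrary: c)
  case (Suc k)
  then show ?case by (auto intro!: exI[where x="\<lambda>_ _. 0"])
qed simp

lemma Ck_on_add: "Ck_on k S f \<Longrightarrow> Ck_on k S g \<Longrightarrow> Ck_on k S (\<lambda>x. f x + g x)"
proof (induction k arbitrary: f g)
  case (Suc k)
  then obtain D E
    where "\<forall>x\<in>S. (f has_derivative D x) (at x)" "\<forall>b\<in>Basis. Ck_on k S (\<lambda>x. D x b)"
      and "\<forall>x\<in>S. (g has_derivative E x) (at x)" "\<forall>b\<in>Basis. Ck_on k S (\<lambda>x. E x b)"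
    by auto
  then show ?case
    by (auto intro!: exI[where x="\<lambda>x h. D x h + E x h"] Suc.IH has_derivative_add)
qed (auto intro: continuous_intros)

lemma Ck_on_mult: "Ck_on k S f \<Longrightarrow> Ck_on k S g \<Longrightarrow> Ck_on k S (\<lambda>x. f x * g x)"
proof (induction k arbitrary: f g)
  case (Suc k)
  from Suc.prems obtain D E
    where f: "\<forall>x\<in>S. (f has_derivative D x) (at x)" "\<forall>b\<in>Basis. Ck_on k S (\<lambda>x. D x b)"
      and g: "\<forall>x\<in>S. (g has_derivative E x) (at x)" "\<forall>b\<in>Basis. Ck_on k S (\<lambda>x. E x b)"
    by auto
  have "\<forall>x\<in>S. ((\<lambda>x. f x * g x) has_derivative (\<lambda>h. f x * E x h + D x h * g x)) (at x)"
    using f g by (auto intro!: has_derivative_mult)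
  moreover have "\<forall>b\<in>Basis. Ck_on k S (\<lambda>x. f x * E x b + D x b * g x)"
    using f g Suc.prems[THEN Ck_on_Suc_imp_Ck_on] by (auto intro!: Ck_on_add Suc.IH)
  ultimately show ?case by auto
qed (auto intro: continuous_intros)

lemma Ck_on_prod: "(\<And>i. i \<in> I \<Longrightarrow> Ck_on k S (f i)) \<Longrightarrow> Ck_on k S (\<lambda>x. \<Prod>i\<in>I. f i x)"
  by (induction I rule: infinite_finite_induct) (auto intro: Ck_on_const Ck_on_mult)

lemma smooth_on_const: "smooth_on S (\<lambda>_. c)"
  by (simp add: smooth_on_def Ck_on_const)

lemma smooth_on_mult: "smooth_on S f \<Longrightarrow> smooth_on S g \<Longrightarrow> smooth_on S (\<lambda>x. f x * g x)"
  by (simp add: smooth_on_def Ck_on_mult)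

lemma smooth_on_lincomb:
  "smooth_on S f \<Longrightarrow> smooth_on S g \<Longrightarrow> smooth_on S (\<lambda>x. c * f x + d * g x)"
  by (simp add: smooth_on_def Ck_on_add Ck_on_mult Ck_on_const)

lemma smooth_on_imp_continuous_on: "smooth_on S f \<Longrightarrow> continuous_on S f"
  unfolding smooth_on_def by (metis Ck_on.simps(1))

lemma smooth_on_has_frechet_derivative:
  assumes "smooth_on S f" "x \<in> S"
  shows "(f has_derivative frechet_derivative f (at x)) (at x)"
proof -
  have "Ck_on (Suc 0) S f" using assms unfolding smooth_on_def by blast
  then show ?thesis
    using \<open>x \<in> S\<close> by (auto simp: differentiable_def simp flip: frechet_derivative_works)
qed

lemma smooth_on_imp_continuous_on_partial_derivative:
  assumes "smooth_on S f" "b \<in> Basis"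
  shows "continuous_on S (\<lambda>x. frechet_derivative f (at x) b)"
proof -
  have "Ck_on (Suc 0) S f" using assms unfolding smooth_on_def by blast
  then obtain D
    where D: "\<And>x. x \<in> S \<Longrightarrow> (f has_derivative D x) (at x)" "continuous_on S (\<lambda>x. D x b)"
    using assms(2) by auto
  have "D x b = frechet_derivative f (at x) b" if "x \<in> S" for x
    using frechet_derivative_at[OF D(1)[OF that]] by simp
  with D(2) show ?thesis by (simp cong: continuous_on_cong)
qed

section \<open>Smooth bump functions\<close>

text \<open>The derivatives of \<open>exp (- 1 / t)\<close>, extended by zero, are linear combinations of these.\<close>

definition flat :: "nat \<Rightarrow> real \<Rightarrow> real" where
  "flat n t = (if t > 0 then (1 / t) ^ n * exp (- (1 / t)) else 0)"

lemma flat_tendsto_0: "(flat n \<longlongrightarrow> 0) (at_right 0)"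
proof -
  have "((\<lambda>t. (inverse t) ^ n / exp (inverse t)) \<longlongrightarrow> (0::real)) (at_right 0)"
    using tendsto_power_div_exp_0[of n] filterlim_inverse_at_top_right
    by (rule filterlim_compose)
  then show ?thesis
    by (rule Lim_transform_eventually)
      (auto simp: flat_def eventually_at_filter exp_minus divide_inverse)
qed

lemma flat_has_real_derivative_0: "(flat n has_real_derivative 0) (at 0)"
proof -
  have "((\<lambda>h. (flat n (0 + h) - flat n 0) / h) \<longlongrightarrow> 0) (at 0)"
  proof (rule filterlim_split_at)
    have "\<forall>\<^sub>F h in at_left 0. 0 = (flat n (0 + h) - flat n 0) / h"
      by (auto simp: flat_def eventually_at_filter)
    then show "((\<lambda>h. (flat n (0 + h) - flat n 0) / h) \<longlongrightarrow> 0) (at_left 0)"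
      by (rule Lim_transform_eventually[OF tendsto_const])
    show "((\<lambda>h. (flat n (0 + h) - flat n 0) / h) \<longlongrightarrow> 0) (at_right 0)"
      by (rule Lim_transform_eventually[OF flat_tendsto_0[of "Suc n"]])
        (auto simp: flat_def eventually_at_filter)
  qed
  then show ?thesis by (simp add: DERIV_def)
qed

lemma flat_has_real_derivative:
  "(flat n has_real_derivative - real n * flat (Suc n) t + flat (n + 2) t) (at t)"
proof -
  consider (negative) "t < 0" | (positive) "t > 0" | (zero) "t = 0" by linarith
  then show ?thesis
  proof cases
    case negative
    have "(flat n has_real_derivative 0) (at t)"
      by (rule has_field_derivative_transform_within_open[where S="{..<0}" and f="\<lambda>_. 0"])
        (use negative in \<open>auto simp: flat_def\<close>)
    with negative show ?thesis by (simp add: flat_def)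
  next
    case positive
    have "((\<lambda>t. (inverse t) ^ n * exp (- inverse t)) has_real_derivative
        real n * (inverse t ^ (n - 1) * - (inverse t * inverse t)) * exp (- inverse t)
        + (inverse t) ^ n * (exp (- inverse t) * (inverse t * inverse t))) (at t)"
      using positive by (auto intro!: derivative_eq_intros simp: algebra_simps)
    also have "real n * (inverse t ^ (n - 1) * - (inverse t * inverse t))
        = - real n * inverse t ^ Suc n"
      by (cases n) (auto simp: algebra_simps)
    finally have "((\<lambda>t. (1/t) ^ n * exp (- (1/t))) has_real_derivative
        - real n * flat (Suc n) t + flat (n + 2) t) (at t)"
      using positive by (simp add: flat_def algebra_simps inverse_eq_divide)
    then show ?thesis
      by (rule has_field_derivative_transform_within_open[where S="{0<..}"])
        (use positive in \<open>auto simp: flat_def\<close>)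
  next
    case zero
    with flat_has_real_derivative_0[of n] show ?thesis by (simp add: flat_def)
  qed
qed

lemma Ck_on_flat_affine: "Ck_on k S (\<lambda>x::'a::euclidean_space. flat n (c * (x \<bullet> i) + d))"
proof (induction k arbitrary: n)
  case 0
  have "continuous_on UNIV (flat n)"
    by (meson DERIV_continuous continuous_at_imp_continuous_on flat_has_real_derivative)
  then show ?case
    by (auto intro!: continuous_on_compose2[where f="\<lambda>x. c * (x \<bullet> i) + d" and g="flat n"]
        continuous_intros)
next
  case (Suc k)
  let ?f = "\<lambda>x. - real n * flat (Suc n) (c * (x \<bullet> i) + d) + flat (n + 2) (c * (x \<bullet> i) + d)"
  have "((\<lambda>x. flat n (c * (x \<bullet> i) + d)) has_derivative (\<lambda>h. c * (h \<bullet> i) * ?f x)) (at x)" for x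
    by (rule has_derivative_eq_rhs, rule DERIV_compose_FDERIV[OF flat_has_real_derivative])
      (auto intro!: derivative_eq_intros)
  moreover have "Ck_on k S (\<lambda>x. c * (b \<bullet> i) * ?f x)" for b
    by (intro Ck_on_mult Ck_on_const Ck_on_add Suc.IH)
  ultimately show ?case
    by (auto intro!: exI[where x="\<lambda>x h. c * (h \<bullet> i) * ?f x"])
qed

lemma flat_0_bounds: "0 \<le> flat 0 t" "flat 0 t \<le> 1"
  by (auto simp: flat_def)

lemma flat_0_scale_tendsto_1:
  assumes "t > 0"
  shows "(\<lambda>n. flat 0 (real (Suc n) * t)) \<longlonglongrightarrow> 1"
proof -
  have "(\<lambda>n. exp (- ((1/t) * inverse (real (Suc n))))) \<longlonglongrightarrow> exp (- ((1/t) * 0))"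
    by (intro tendsto_intros LIMSEQ_inverse_real_of_nat)
  with assms show ?thesis by (simp add: flat_def field_simps del: of_nat_Suc)
qed

definition box_bump :: "real \<Rightarrow> 'a::euclidean_space \<Rightarrow> 'a \<Rightarrow> 'a \<Rightarrow> real" where
  "box_bump c a b x = (\<Prod>i\<in>Basis. flat 0 (c * (x \<bullet> i - a \<bullet> i)) * flat 0 (c * (b \<bullet> i - x \<bullet> i)))"

lemma smooth_on_box_bump: "smooth_on S (box_bump c a b)"
proof -
  have "Ck_on k S (\<lambda>x. flat 0 (c * (x \<bullet> i) + (- c * (a \<bullet> i)))
      * flat 0 ((- c) * (x \<bullet> i) + c * (b \<bullet> i)))" for k i
    by (intro Ck_on_mult Ck_on_flat_affine)
  then show ?thesis unfolding smooth_on_def box_bump_def[abs_def]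
    by (auto intro!: Ck_on_prod simp: algebra_simps)
qed

lemma box_bump_bounds: "0 \<le> box_bump c a b x" "box_bump c a b x \<le> 1"
  unfolding box_bump_def
  by (auto intro!: prod_nonneg prod_le_1 mult_nonneg_nonneg mult_le_one simp: flat_0_bounds)

lemma box_bump_eq_0: "c > 0 \<Longrightarrow> x \<notin> box a b \<Longrightarrow> box_bump c a b x = 0"
  by (auto simp: box_bump_def mem_box flat_def not_less zero_less_mult_iff intro!: bexI)

lemma box_bump_pos: "c > 0 \<Longrightarrow> x \<in> box a b \<Longrightarrow> box_bump c a b x > 0"
  by (auto simp: box_bump_def mem_box flat_def intro!: prod_pos)

lemma box_bump_tendsto_indicator:
  "(\<lambda>n. box_bump (real (Suc n)) a b x) \<longlonglongrightarrow> indicator (box a b) x"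
proof (cases "x \<in> box a b")
  case True
  then have "(\<lambda>n. box_bump (real (Suc n)) a b x) \<longlonglongrightarrow> (\<Prod>i\<in>(Basis::'a set). 1 * 1)"
    unfolding box_bump_def by (intro tendsto_intros flat_0_scale_tendsto_1) (auto simp: mem_box)
  with True show ?thesis by simp
next
  case False
  then have "box_bump (real (Suc n)) a b x = 0" for n
    by (intro box_bump_eq_0) auto
  with False show ?thesis by simp
qed

lemma integral_box_bump_mult_tendsto:
  fixes v :: "'a::euclidean_space \<Rightarrow> real"
  assumes v: "integrable lebesgue v"
  shows "(\<lambda>n. \<integral>x. box_bump (real (Suc n)) a b x * v x \<partial>lebesgue)
    \<longlonglongrightarrow> (\<integral>x. indicator (box a b) x * v x \<partial>lebesgue)"
proof (rule integral_dominated_convergence[where w="\<lambda>x. norm (v x)"])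
  note v_measurable = borel_measurable_integrable[OF v]
  show "(\<lambda>x. indicator (box a b) x * v x) \<in> borel_measurable lebesgue"
    by (intro borel_measurable_times borel_measurable_indicator v_measurable) auto
  fix n
  have "box_bump (real (Suc n)) a b \<in> borel_measurable lebesgue"
    by (intro measurable_completion)
      (simp add: borel_measurable_continuous_onI smooth_on_imp_continuous_on smooth_on_box_bump)
  then show "(\<lambda>x. box_bump (real (Suc n)) a b x * v x) \<in> borel_measurable lebesgue"
    using v_measurable by (rule borel_measurable_times)
  show "AE x in lebesgue. norm (box_bump (real (Suc n)) a b x * v x) \<le> norm (v x)"
    using box_bump_bounds[of "real (Suc n)" a b]
    by (intro AE_I2) (auto simp: abs_mult intro!: mult_left_le_one_le)
next
  show "AE x in lebesgue. (\<lambda>n. box_bump (real (Suc n)) a b x * v x)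
      \<longlonglongrightarrow> indicator (box a b) x * v x"
    by (intro AE_I2 tendsto_intros box_bump_tendsto_indicator)
qed (use v in auto)

section \<open>The fundamental lemma of the calculus of variations\<close>

lemma test_fun_box_bump_mult:
  assumes "smooth_on UNIV \<phi>" "c > 0" "cbox a b \<subseteq> \<Omega>"
  shows "test_fun \<Omega> (\<lambda>x. box_bump c a b x * \<phi> x)"
proof -
  have "{x. box_bump c a b x * \<phi> x \<noteq> 0} \<subseteq> cbox a b"
    using box_bump_eq_0[OF assms(2)] box_subset_cbox by fastforce
  then have "closure {x. box_bump c a b x * \<phi> x \<noteq> 0} \<subseteq> cbox a b"
    by (intro closure_minimal closed_cbox)
  moreover have "smooth_on UNIV (\<lambda>x. box_bump c a b x * \<phi> x)"
    using smooth_on_box_bump assms(1) by (rule smooth_on_mult)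
  ultimately show ?thesis
    using assms(3) unfolding test_fun_def
    by (meson bounded_cbox bounded_subset closed_closure compact_eq_bounded_closed subset_trans)
qed

lemma AE_eq_0_if_box_integrals_eq_0:
  fixes w :: "'a::euclidean_space \<Rightarrow> real"
  assumes w: "integrable lebesgue w"
    and zero: "\<And>c d. (\<integral>x. indicator (box c d) x * w x \<partial>lebesgue) = 0"
  shows "AE x in lebesgue. w x = 0"
proof -
  have w_on: "w absolutely_integrable_on S" if "S \<in> sets lebesgue" for S
    using integrable_mult_indicator[OF that w] by (simp add: set_integrable_def)
  have cbox_integral: "integral (cbox c d) w = 0" for c d
  proof -
    have "integral (cbox c d) w = integral (box c d) w"
      by (metis integral_open_interval)
    also have "\<dots> = (\<integral>x. indicator (box c d) x * w x \<partial>lebesgue)"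
      using set_lebesgue_integral_eq_integral(2)[OF w_on[of "box c d"]]
      by (simp add: set_lebesgue_integral_def)
    finally show ?thesis using zero by simp
  qed
  obtain N where "negligible N"
    and average: "\<And>x e. \<lbrakk>x \<notin> N; 0 < e\<rbrakk> \<Longrightarrow> \<exists>d>0. \<forall>h. 0 < h \<and> h < d \<longrightarrow>
      norm (integral (cbox x (x + h *\<^sub>R One)) w /\<^sub>R h ^ DIM('a) - w x) < e"
    by (rule integrable_ccontinuous_explicit[of w])
      (use w_on in \<open>auto simp: set_lebesgue_integral_eq_integral(1)\<close>)
  have "w x = 0" if "x \<notin> N" for x
  proof (rule ccontr)
    assume "w x \<noteq> 0"
    then have "norm (w x) > 0" by simp
    from average[OF that this] obtain d where "d > 0"
      and d: "\<And>h. 0 < h \<and> h < d \<Longrightarrow>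
        norm (integral (cbox x (x + h *\<^sub>R One)) w /\<^sub>R h ^ DIM('a) - w x) < norm (w x)"
      by blast
    from d[of "d / 2"] \<open>d > 0\<close> show False by (simp add: cbox_integral)
  qed
  then have "{x. w x \<noteq> 0} \<subseteq> N" by blast
  with \<open>negligible N\<close> show ?thesis
    by (intro AE_I'[of N]) (auto simp: negligible_iff_null_sets)
qed

lemma AE_eq_0_on_cbox_if_test_integrals_eq_0:
  fixes w :: "'a::euclidean_space \<Rightarrow> real"
  assumes \<Omega>: "\<Omega> \<in> sets lebesgue"
    and w: "\<And>\<phi>. test_fun \<Omega> \<phi> \<Longrightarrow> integrable (lebesgue_on \<Omega>) (\<lambda>x. w x * \<phi> x)"
    and zero: "\<And>\<phi>. test_fun \<Omega> \<phi> \<Longrightarrow> (\<integral>x. w x * \<phi> x \<partial>lebesgue_on \<Omega>) = 0"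
    and cbox: "cbox a b \<subseteq> \<Omega>"
  shows "AE x in lebesgue. x \<in> cbox a b \<longrightarrow> w x = 0"
proof -
  define v where "v x = indicator \<Omega> x * (w x * box_bump 1 a b x)" for x
  have bump: "test_fun \<Omega> (\<lambda>x. box_bump 1 a b x * \<phi> x)" if "smooth_on UNIV \<phi>" for \<phi>
    using test_fun_box_bump_mult[OF that _ cbox, of 1] by simp
  have v: "integrable lebesgue v"
    using w[OF bump[OF smooth_on_const[of UNIV 1]]] \<Omega>
    by (simp add: integrable_restrict_space v_def[abs_def] mult.assoc)
  have "AE x in lebesgue. v x = 0"
  proof (rule AE_eq_0_if_box_integrals_eq_0[OF v])
    fix c d :: 'a
    have "(\<integral>x. box_bump (real (Suc n)) c d x * v x \<partial>lebesgue) = 0" for n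
      using zero[OF bump[OF smooth_on_box_bump], of "real (Suc n)" c d] \<Omega>
      by (simp add: integral_restrict_space v_def mult_ac del: of_nat_Suc)
    with integral_box_bump_mult_tendsto[OF v, of c d]
    show "(\<integral>x. indicator (box c d) x * v x \<partial>lebesgue) = 0"
      by (simp add: LIMSEQ_const_iff)
  qed
  moreover have "AE x in lebesgue. x \<notin> cbox a b - box a b"
    using negligible_frontier_interval[of a b]
    by (intro AE_not_in) (simp add: negligible_iff_null_sets)
  ultimately show ?thesis
  proof eventually_elim
    case (elim x)
    show ?case
    proof
      assume "x \<in> cbox a b"
      with elim have "x \<in> box a b" "x \<in> \<Omega>" using cbox by auto
      with elim box_bump_pos[of 1 x a b] show "w x = 0" by (simp add: v_def)
    qed
  qed
qed

lemma fundamental_lemma_calculus_of_variations: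
  fixes w :: "'a::euclidean_space \<Rightarrow> real"
  assumes "open \<Omega>"
    and w: "\<And>\<phi>. test_fun \<Omega> \<phi> \<Longrightarrow> integrable (lebesgue_on \<Omega>) (\<lambda>x. w x * \<phi> x)"
    and zero: "\<And>\<phi>. test_fun \<Omega> \<phi> \<Longrightarrow> (\<integral>x. w x * \<phi> x \<partial>lebesgue_on \<Omega>) = 0"
  shows "AE x in lebesgue_on \<Omega>. w x = 0"
proof -
  have \<Omega>: "\<Omega> \<in> sets lebesgue" using \<open>open \<Omega>\<close> by auto
  obtain \<D> where "countable \<D>" and \<D>: "\<And>X. X \<in> \<D> \<Longrightarrow> \<exists>a b. X = cbox a b"
    and Union: "\<Union>\<D> = \<Omega>"
    using open_countable_Union_open_cbox[OF \<open>open \<Omega>\<close>] by metis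
  have "AE x in lebesgue. \<forall>X\<in>\<D>. x \<in> X \<longrightarrow> w x = 0"
  proof (subst AE_ball_countable[OF \<open>countable \<D>\<close>], intro ballI)
    fix X assume "X \<in> \<D>"
    with \<D> Union obtain a b where "X = cbox a b" "cbox a b \<subseteq> \<Omega>" by blast
    then show "AE x in lebesgue. x \<in> X \<longrightarrow> w x = 0"
      using AE_eq_0_on_cbox_if_test_integrals_eq_0[OF \<Omega> w zero] by simp
  qed
  then have "AE x in lebesgue. x \<in> \<Omega> \<longrightarrow> w x = 0"
    by eventually_elim (use Union in blast)
  then show ?thesis using \<Omega> by (simp add: AE_restrict_space_iff)
qed

section \<open>Test functions\<close>

lemma inner_grad_Basis:
  "i \<in> Basis \<Longrightarrow> grad \<phi> x \<bullet> i = frechet_derivative \<phi> (at x) i"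
  by (simp add: grad_def inner_sum_left inner_Basis if_distrib cong: if_cong)

lemma frechet_derivative_eq_inner_grad:
  assumes "(\<phi> has_derivative frechet_derivative \<phi> (at x)) (at x)"
  shows "frechet_derivative \<phi> (at x) h = grad \<phi> x \<bullet> h"
proof -
  interpret D: bounded_linear "frechet_derivative \<phi> (at x)"
    using assms by (rule has_derivative_bounded_linear)
  have "frechet_derivative \<phi> (at x) h
      = frechet_derivative \<phi> (at x) (\<Sum>b\<in>Basis. (h \<bullet> b) *\<^sub>R b)"
    by (simp add: euclidean_representation)
  also have "\<dots> = (\<Sum>b\<in>Basis. (h \<bullet> b) * frechet_derivative \<phi> (at x) b)"
    by (simp add: D.sum D.scaleR)
  also have "\<dots> = grad \<phi> x \<bullet> h"
    by (simp add: grad_def inner_sum_left inner_commute[of h] mult.commute)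
  finally show ?thesis .
qed

lemma grad_lincomb:
  assumes "(\<phi> has_derivative frechet_derivative \<phi> (at x)) (at x)"
    and "(\<psi> has_derivative frechet_derivative \<psi> (at x)) (at x)"
  shows "grad (\<lambda>x. c * \<phi> x + d * \<psi> x) x = c *\<^sub>R grad \<phi> x + d *\<^sub>R grad \<psi> x"
proof -
  have "((\<lambda>x. c * \<phi> x + d * \<psi> x) has_derivative
      (\<lambda>h. c * frechet_derivative \<phi> (at x) h + d * frechet_derivative \<psi> (at x) h)) (at x)"
    by (intro derivative_intros assms)
  then have "frechet_derivative (\<lambda>x. c * \<phi> x + d * \<psi> x) (at x) =
      (\<lambda>h. c * frechet_derivative \<phi> (at x) h + d * frechet_derivative \<psi> (at x) h)"
    by (metis frechet_derivative_at)
  then show ?thesis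
    by (simp add: grad_def scaleR_add_left sum.distrib scaleR_sum_right)
qed

lemma smooth_on_imp_continuous_on_grad: "smooth_on S \<phi> \<Longrightarrow> continuous_on S (grad \<phi>)"
  unfolding grad_def[abs_def]
  by (intro continuous_intros smooth_on_imp_continuous_on_partial_derivative)

lemma test_fun_imp_smooth_on: "test_fun \<Omega> \<phi> \<Longrightarrow> smooth_on UNIV \<phi>"
  by (simp add: test_fun_def)

lemma test_fun_has_frechet_derivative:
  "test_fun \<Omega> \<phi> \<Longrightarrow> (\<phi> has_derivative frechet_derivative \<phi> (at x)) (at x)"
  by (rule smooth_on_has_frechet_derivative[OF test_fun_imp_smooth_on]) auto

lemma test_fun_eq_0: "test_fun \<Omega> \<phi> \<Longrightarrow> x \<notin> \<Omega> \<Longrightarrow> \<phi> x = 0"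
  using closure_subset[of "{x. \<phi> x \<noteq> 0}"] unfolding test_fun_def by blast

lemma grad_eq_0_outside_support:
  assumes "x \<notin> closure {x. \<phi> x \<noteq> 0}"
  shows "grad \<phi> x = 0"
proof -
  have "(\<phi> has_derivative (\<lambda>_. 0)) (at x)"
    by (rule has_derivative_transform_within_open[where s="- closure {x. \<phi> x \<noteq> 0}"
          and f="\<lambda>_. 0"])
      (use assms closure_subset[of "{x. \<phi> x \<noteq> 0}"] in auto)
  then have "frechet_derivative \<phi> (at x) = (\<lambda>_. 0)"
    by (metis frechet_derivative_at)
  then show ?thesis by (simp add: grad_def)
qed

lemma test_fun_grad_eq_0: "test_fun \<Omega> \<phi> \<Longrightarrow> x \<notin> \<Omega> \<Longrightarrow> grad \<phi> x = 0"
  by (rule grad_eq_0_outside_support) (auto simp: test_fun_def)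

lemma continuous_compact_support_imp_bounded:
  fixes f :: "'a::topological_space \<Rightarrow> 'b::real_normed_vector"
  assumes "continuous_on UNIV f" "compact K" and zero: "\<And>x. x \<notin> K \<Longrightarrow> f x = 0"
  obtains B where "\<And>x. norm (f x) \<le> B"
proof -
  have "bounded (f ` K)"
    using assms by (meson compact_continuous_image compact_imp_bounded continuous_on_subset
        subset_UNIV)
  then obtain B where "B > 0" and B: "\<And>x. x \<in> K \<Longrightarrow> norm (f x) \<le> B"
    by (auto simp: bounded_pos)
  have "norm (f x) \<le> B" for x
    using B zero \<open>B > 0\<close> by (cases "x \<in> K") auto
  then show ?thesis by (rule that)
qed

lemma test_fun_bounded:
  assumes "test_fun \<Omega> \<phi>"
  obtains B where "\<And>x. norm (\<phi> x) \<le> B"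
  by (rule continuous_compact_support_imp_bounded[of \<phi> "closure {x. \<phi> x \<noteq> 0}"])
    (use assms closure_subset[of "{x. \<phi> x \<noteq> 0}"] in
      \<open>auto simp: test_fun_def smooth_on_imp_continuous_on\<close>)

lemma grad_test_fun_bounded:
  assumes "test_fun \<Omega> \<phi>"
  obtains B where "\<And>x. norm (grad \<phi> x) \<le> B"
  by (rule continuous_compact_support_imp_bounded[of "grad \<phi>" "closure {x. \<phi> x \<noteq> 0}"])
    (use assms in \<open>auto simp: test_fun_def smooth_on_imp_continuous_on_grad
      grad_eq_0_outside_support\<close>)

lemma test_fun_0: "test_fun \<Omega> (\<lambda>_. 0)"
  by (simp add: test_fun_def smooth_on_const)

lemma test_fun_lincomb:
  assumes "test_fun \<Omega> \<phi>" "test_fun \<Omega> \<psi>"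
  shows "test_fun \<Omega> (\<lambda>x. c * \<phi> x + d * \<psi> x)"
proof -
  let ?K = "closure {x. \<phi> x \<noteq> 0} \<union> closure {x. \<psi> x \<noteq> 0}"
  have K: "compact ?K" "?K \<subseteq> \<Omega>" using assms by (auto simp: test_fun_def)
  have "{x. c * \<phi> x + d * \<psi> x \<noteq> 0} \<subseteq> ?K"
    using closure_subset[of "{x. \<phi> x \<noteq> 0}"] closure_subset[of "{x. \<psi> x \<noteq> 0}"] by force
  then have "closure {x. c * \<phi> x + d * \<psi> x \<noteq> 0} \<subseteq> ?K"
    by (intro closure_minimal) auto
  moreover have "smooth_on UNIV (\<lambda>x. c * \<phi> x + d * \<psi> x)"
    using assms by (intro smooth_on_lincomb test_fun_imp_smooth_on)
  ultimately show ?thesis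
    using K unfolding test_fun_def
    by (meson bounded_subset closed_closure compact_eq_bounded_closed subset_trans)
qed

lemma continuous_on_UNIV_imp_measurable_lebesgue_on:
  "continuous_on UNIV f \<Longrightarrow> f \<in> borel_measurable (lebesgue_on S)"
  by (intro measurable_restrict_space1 measurable_completion)
    (simp add: borel_measurable_continuous_onI)

lemma test_fun_measurable:
  assumes "test_fun \<Omega> \<phi>"
  shows "\<phi> \<in> borel_measurable (lebesgue_on S)" "grad \<phi> \<in> borel_measurable (lebesgue_on S)"
  using test_fun_imp_smooth_on[OF assms]
  by (auto intro!: continuous_on_UNIV_imp_measurable_lebesgue_on
      smooth_on_imp_continuous_on smooth_on_imp_continuous_on_grad)

section \<open>Convergence in the mean\<close>

lemma tendsto_0_ennreal_le:
  fixes a b :: "'i \<Rightarrow> ennreal"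
  assumes "\<And>i. a i \<le> b i" "(b \<longlongrightarrow> 0) F"
  shows "(a \<longlongrightarrow> 0) F"
  by (rule tendsto_sandwich[of "\<lambda>_. 0" a F b]) (use assms in auto)

definition L1_tendsto ::
  "'a measure \<Rightarrow> (nat \<Rightarrow> 'a \<Rightarrow> 'b::real_normed_vector) \<Rightarrow> ('a \<Rightarrow> 'b) \<Rightarrow> bool" where
  "L1_tendsto M F f \<longleftrightarrow> (\<lambda>n. \<integral>\<^sup>+x. ennreal (norm (F n x - f x)) \<partial>M) \<longlonglongrightarrow> 0"

lemma L1_tendsto_inner_Basis:
  fixes F :: "nat \<Rightarrow> 'a \<Rightarrow> 'b::euclidean_space"
  assumes "L1_tendsto M F f" "i \<in> Basis"
  shows "L1_tendsto M (\<lambda>n x. F n x \<bullet> i) (\<lambda>x. f x \<bullet> i)"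
  unfolding L1_tendsto_def
  by (rule tendsto_0_ennreal_le[OF _ assms(1)[unfolded L1_tendsto_def]])
    (auto intro!: nn_integral_mono ennreal_leI Basis_le_norm[OF assms(2)]
      simp flip: inner_diff_left)

lemma L1_tendsto_mult_bounded:
  fixes F :: "nat \<Rightarrow> 'a \<Rightarrow> real"
  assumes "L1_tendsto M F f"
    and [measurable]: "\<And>n. F n \<in> borel_measurable M" "f \<in> borel_measurable M"
    and g: "\<And>x. norm (g x) \<le> B"
  shows "L1_tendsto M (\<lambda>n x. F n x * g x) (\<lambda>x. f x * g x)"
proof -
  have "(\<integral>\<^sup>+x. ennreal (norm (F n x * g x - f x * g x)) \<partial>M)
      \<le> ennreal B * (\<integral>\<^sup>+x. ennreal (norm (F n x - f x)) \<partial>M)" for n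
  proof -
    have "ennreal (norm (F n x * g x - f x * g x)) \<le> ennreal B * ennreal (norm (F n x - f x))" for x
    proof -
      have "norm (F n x * g x - f x * g x) = norm (g x) * norm (F n x - f x)"
        by (simp only: norm_mult[symmetric] mult.commute[of "g x"] left_diff_distrib)
      also have "\<dots> \<le> B * norm (F n x - f x)" using g by (intro mult_right_mono) auto
      finally show ?thesis by (simp add: ennreal_leI flip: ennreal_mult'')
    qed
    then have "(\<integral>\<^sup>+x. ennreal (norm (F n x * g x - f x * g x)) \<partial>M)
        \<le> (\<integral>\<^sup>+x. ennreal B * ennreal (norm (F n x - f x)) \<partial>M)"
      by (rule nn_integral_mono)
    also have "\<dots> = ennreal B * (\<integral>\<^sup>+x. ennreal (norm (F n x - f x)) \<partial>M)"
      by (rule nn_integral_cmult) measurable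
    finally show ?thesis .
  qed
  moreover have "(\<lambda>n. ennreal B * (\<integral>\<^sup>+x. ennreal (norm (F n x - f x)) \<partial>M)) \<longlonglongrightarrow> ennreal B * 0"
    using assms(1) unfolding L1_tendsto_def by (intro tendsto_intros) auto
  ultimately show ?thesis
    unfolding L1_tendsto_def mult_zero_right by (rule tendsto_0_ennreal_le)
qed

lemma L1_tendsto_imp_integrable:
  fixes f :: "'a \<Rightarrow> 'b::{banach, second_countable_topology}"
  assumes lim: "L1_tendsto M F f"
    and F: "\<And>n. integrable M (F n)" and f: "f \<in> borel_measurable M"
  shows "integrable M f"
proof -
  note [measurable] = borel_measurable_integrable[OF F] f
  have "\<forall>\<^sub>F n in sequentially. (\<integral>\<^sup>+x. ennreal (norm (F n x - f x)) \<partial>M) < \<infinity>"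
    using lim unfolding L1_tendsto_def by (rule order_tendstoD) simp
  then obtain n where "(\<integral>\<^sup>+x. ennreal (norm (F n x - f x)) \<partial>M) < \<infinity>"
    by (auto simp: eventually_sequentially)
  then have "integrable M (\<lambda>x. F n x - f x)"
    by (intro integrableI_bounded) measurable
  from Bochner_Integration.integrable_diff[OF F[of n] this] show ?thesis by simp
qed

section \<open>Weak gradients\<close>

lemma weak_grad_iff_inner_grad:
  "weak_grad \<Omega> u g \<longleftrightarrow> u \<in> borel_measurable (lebesgue_on \<Omega>) \<and> g \<in> borel_measurable (lebesgue_on \<Omega>) \<and>
    (\<forall>\<phi> i. test_fun \<Omega> \<phi> \<and> i \<in> Basis \<longrightarrow>
      integrable (lebesgue_on \<Omega>) (\<lambda>x. u x * (grad \<phi> x \<bullet> i)) \<and>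
      integrable (lebesgue_on \<Omega>) (\<lambda>x. (g x \<bullet> i) * \<phi> x) \<and>
      (\<integral>x. u x * (grad \<phi> x \<bullet> i) \<partial>lebesgue_on \<Omega>) = - (\<integral>x. (g x \<bullet> i) * \<phi> x \<partial>lebesgue_on \<Omega>))"
  by (auto simp: weak_grad_def inner_grad_Basis)

lemma weak_grad_measurable:
  assumes "weak_grad \<Omega> u g"
  shows "u \<in> borel_measurable (lebesgue_on \<Omega>)" "g \<in> borel_measurable (lebesgue_on \<Omega>)"
  using assms by (simp_all add: weak_grad_def)

lemma weak_grad_integrable:
  assumes "weak_grad \<Omega> u g" "test_fun \<Omega> \<phi>" "i \<in> Basis"
  shows "integrable (lebesgue_on \<Omega>) (\<lambda>x. u x * (grad \<phi> x \<bullet> i))"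
    "integrable (lebesgue_on \<Omega>) (\<lambda>x. (g x \<bullet> i) * \<phi> x)"
  using assms by (auto simp: weak_grad_iff_inner_grad)

lemma weak_grad_integral_eq:
  assumes "weak_grad \<Omega> u g" "test_fun \<Omega> \<phi>" "i \<in> Basis"
  shows "(\<integral>x. u x * (grad \<phi> x \<bullet> i) \<partial>lebesgue_on \<Omega>) = - (\<integral>x. (g x \<bullet> i) * \<phi> x \<partial>lebesgue_on \<Omega>)"
  using assms by (auto simp: weak_grad_iff_inner_grad)

lemma weak_grad_0: "weak_grad \<Omega> (\<lambda>_. 0) (\<lambda>_. 0)"
  by (simp add: weak_grad_def)

lemma weak_grad_lincomb:
  fixes u v :: "'a::euclidean_space \<Rightarrow> real"
  assumes u: "weak_grad \<Omega> u g" and v: "weak_grad \<Omega> v h"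
  shows "weak_grad \<Omega> (\<lambda>x. c * u x + d * v x) (\<lambda>x. c *\<^sub>R g x + d *\<^sub>R h x)"
  unfolding weak_grad_iff_inner_grad
proof (intro conjI allI impI; (elim conjE)?)
  note [measurable] = weak_grad_measurable[OF u] weak_grad_measurable[OF v]
  show "(\<lambda>x. c * u x + d * v x) \<in> borel_measurable (lebesgue_on \<Omega>)"
    "(\<lambda>x. c *\<^sub>R g x + d *\<^sub>R h x) \<in> borel_measurable (lebesgue_on \<Omega>)"
    by measurable
  fix \<phi> :: "'a \<Rightarrow> real" and i :: 'a assume \<phi>: "test_fun \<Omega> \<phi>" and i: "i \<in> Basis"
  let ?D = "\<lambda>x. grad \<phi> x \<bullet> i"
  have expand:
    "(c * u x + d * v x) * ?D x = c * (u x * ?D x) + d * (v x * ?D x)"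
    "(c *\<^sub>R g x + d *\<^sub>R h x) \<bullet> i * \<phi> x = c * ((g x \<bullet> i) * \<phi> x) + d * ((h x \<bullet> i) * \<phi> x)" for x
    by (auto simp: algebra_simps inner_simps)
  note integrable = weak_grad_integrable[OF u \<phi> i] weak_grad_integrable[OF v \<phi> i]
  then show "integrable (lebesgue_on \<Omega>) (\<lambda>x. (c * u x + d * v x) * ?D x)"
    "integrable (lebesgue_on \<Omega>) (\<lambda>x. (c *\<^sub>R g x + d *\<^sub>R h x) \<bullet> i * \<phi> x)"
    unfolding expand by auto
  show "(\<integral>x. (c * u x + d * v x) * ?D x \<partial>lebesgue_on \<Omega>) =
      - (\<integral>x. (c *\<^sub>R g x + d *\<^sub>R h x) \<bullet> i * \<phi> x \<partial>lebesgue_on \<Omega>)"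
    unfolding expand
    using integrable weak_grad_integral_eq[OF u \<phi> i] weak_grad_integral_eq[OF v \<phi> i] by simp
qed

lemma weak_grad_unique:
  fixes g h :: "'a::euclidean_space \<Rightarrow> 'a"
  assumes "open \<Omega>" "weak_grad \<Omega> u g" "weak_grad \<Omega> u h"
  shows "AE x in lebesgue_on \<Omega>. g x = h x"
proof -
  have diff: "weak_grad \<Omega> (\<lambda>_. 0) (\<lambda>x. g x - h x)"
    using weak_grad_lincomb[OF assms(2,3), of 1 "- 1"] by simp
  have "AE x in lebesgue_on \<Omega>. (g x - h x) \<bullet> i = 0" if i: "i \<in> Basis" for i
  proof (rule fundamental_lemma_calculus_of_variations[OF assms(1)])
    fix \<phi> :: "'a \<Rightarrow> real" assume \<phi>: "test_fun \<Omega> \<phi>"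
    show "integrable (lebesgue_on \<Omega>) (\<lambda>x. (g x - h x) \<bullet> i * \<phi> x)"
      by (rule weak_grad_integrable[OF diff \<phi> i])
    show "(\<integral>x. (g x - h x) \<bullet> i * \<phi> x \<partial>lebesgue_on \<Omega>) = 0"
      using weak_grad_integral_eq[OF diff \<phi> i] by simp
  qed
  then have "AE x in lebesgue_on \<Omega>. \<forall>i\<in>Basis. (g x - h x) \<bullet> i = 0"
    by (simp add: AE_finite_all)
  then show ?thesis
    by eventually_elim (auto simp: inner_diff_left intro: euclidean_eqI)
qed

lemma weak_grad_L1_limit:
  fixes u :: "'a::euclidean_space \<Rightarrow> real"
  assumes UG: "\<And>n. weak_grad \<Omega> (U n) (G n)"
    and [measurable]: "u \<in> borel_measurable (lebesgue_on \<Omega>)" "g \<in> borel_measurable (lebesgue_on \<Omega>)"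
    and U_lim: "L1_tendsto (lebesgue_on \<Omega>) U u" and G_lim: "L1_tendsto (lebesgue_on \<Omega>) G g"
  shows "weak_grad \<Omega> u g"
  unfolding weak_grad_iff_inner_grad
proof (intro conjI allI impI; (elim conjE)?)
  note [measurable] = weak_grad_measurable[OF UG]
  let ?M = "lebesgue_on \<Omega>"
  fix \<phi> :: "'a \<Rightarrow> real" and i :: 'a assume \<phi>: "test_fun \<Omega> \<phi>" and i: "i \<in> Basis"
  note [measurable] = test_fun_measurable[OF \<phi>]
  note UG_integrable = weak_grad_integrable[OF UG \<phi> i]
  obtain B where "norm (grad \<phi> x) \<le> B" for x using grad_test_fun_bounded[OF \<phi>] by blast
  then have B: "norm (grad \<phi> x \<bullet> i) \<le> B" for x
    using Basis_le_norm[OF i, of "grad \<phi> x"] order_trans by fastforce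
  have lim_u: "L1_tendsto ?M (\<lambda>n x. U n x * (grad \<phi> x \<bullet> i)) (\<lambda>x. u x * (grad \<phi> x \<bullet> i))"
    by (rule L1_tendsto_mult_bounded[OF U_lim _ _ B]) measurable
  obtain C where C: "norm (\<phi> x) \<le> C" for x using test_fun_bounded[OF \<phi>] by blast
  have lim_g: "L1_tendsto ?M (\<lambda>n x. (G n x \<bullet> i) * \<phi> x) (\<lambda>x. (g x \<bullet> i) * \<phi> x)"
    by (rule L1_tendsto_mult_bounded[OF L1_tendsto_inner_Basis[OF G_lim i] _ _ C]) measurable
  show u_integrable: "integrable ?M (\<lambda>x. u x * (grad \<phi> x \<bullet> i))"
    by (rule L1_tendsto_imp_integrable[OF lim_u UG_integrable(1)]) measurable
  show g_integrable: "integrable ?M (\<lambda>x. (g x \<bullet> i) * \<phi> x)"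
    by (rule L1_tendsto_imp_integrable[OF lim_g UG_integrable(2)]) measurable
  have "(\<lambda>n. \<integral>x. U n x * (grad \<phi> x \<bullet> i) \<partial>?M) \<longlonglongrightarrow> (\<integral>x. u x * (grad \<phi> x \<bullet> i) \<partial>?M)"
    by (rule tendsto_L1_int[OF UG_integrable(1) u_integrable lim_u[unfolded L1_tendsto_def]])
  moreover have "(\<lambda>n. \<integral>x. (G n x \<bullet> i) * \<phi> x \<partial>?M) \<longlonglongrightarrow> (\<integral>x. (g x \<bullet> i) * \<phi> x \<partial>?M)"
    by (rule tendsto_L1_int[OF UG_integrable(2) g_integrable lim_g[unfolded L1_tendsto_def]])
  then have "(\<lambda>n. \<integral>x. U n x * (grad \<phi> x \<bullet> i) \<partial>?M) \<longlonglongrightarrow> - (\<integral>x. (g x \<bullet> i) * \<phi> x \<partial>?M)"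
    unfolding weak_grad_integral_eq[OF UG \<phi> i] by (rule tendsto_minus)
  ultimately show "(\<integral>x. u x * (grad \<phi> x \<bullet> i) \<partial>?M) = - (\<integral>x. (g x \<bullet> i) * \<phi> x \<partial>?M)"
    by (rule LIMSEQ_unique)
qed measurable

section \<open>Modulars\<close>

abbreviation norm_modular ::
  "'a::euclidean_space set \<Rightarrow> ('a \<Rightarrow> real) \<Rightarrow> ('a \<Rightarrow> 'b::real_normed_vector) \<Rightarrow> ennreal" where
  "norm_modular \<Omega> p v \<equiv> modular \<Omega> p (\<lambda>x. norm (v x))"

definition Lp_field ::
  "'a::euclidean_space set \<Rightarrow> ('a \<Rightarrow> real) \<Rightarrow> ('a \<Rightarrow> 'b::real_normed_vector) set" where
  "Lp_field \<Omega> p = {v. v \<in> borel_measurable (lebesgue_on \<Omega>) \<and> norm_modular \<Omega> p v < \<infinity>}"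

definition modular_tendsto ::
  "'a::euclidean_space set \<Rightarrow> ('a \<Rightarrow> real) \<Rightarrow> (nat \<Rightarrow> 'a \<Rightarrow> 'b::real_normed_vector) \<Rightarrow> ('a \<Rightarrow> 'b) \<Rightarrow> bool"
  where "modular_tendsto \<Omega> p s t \<longleftrightarrow> (\<lambda>n. norm_modular \<Omega> p (\<lambda>x. s n x - t x)) \<longlonglongrightarrow> 0"

definition modular_Cauchy ::
  "'a::euclidean_space set \<Rightarrow> ('a \<Rightarrow> real) \<Rightarrow> (nat \<Rightarrow> 'a \<Rightarrow> 'b::real_normed_vector) \<Rightarrow> bool" where
  "modular_Cauchy \<Omega> p s \<longleftrightarrow>
    (\<forall>e>0. \<exists>N. \<forall>i\<ge>N. \<forall>j\<ge>N. norm_modular \<Omega> p (\<lambda>x. s i x - s j x) \<le> ennreal e)"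

lemma modular_abs [simp]: "modular \<Omega> p (\<lambda>x. \<bar>u x\<bar>) = modular \<Omega> p u"
  by (simp add: modular_def)

lemma modular_0 [simp]: "modular \<Omega> p (\<lambda>_. 0) = 0"
  by (simp add: modular_def)

lemma modular_cong_AE:
  assumes "AE x in lebesgue_on \<Omega>. u x = v x"
  shows "modular \<Omega> p u = modular \<Omega> p v"
  unfolding modular_def using assms by (intro nn_integral_cong_AE) auto

lemma norm_modular_scaleR_le:
  fixes v :: "'a::euclidean_space \<Rightarrow> 'b::real_normed_vector"
  assumes [measurable]: "p \<in> borel_measurable (lebesgue_on \<Omega>)"
      "v \<in> borel_measurable (lebesgue_on \<Omega>)"
    and K: "\<And>x. x \<in> \<Omega> \<Longrightarrow> \<bar>c\<bar> powr p x \<le> K"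
  shows "norm_modular \<Omega> p (\<lambda>x. c *\<^sub>R v x) \<le> ennreal K * norm_modular \<Omega> p v"
proof -
  have "norm_modular \<Omega> p (\<lambda>x. c *\<^sub>R v x)
      \<le> (\<integral>\<^sup>+x. ennreal K * ennreal (norm (v x) powr p x) \<partial>lebesgue_on \<Omega>)"
    unfolding modular_def
  proof (rule nn_integral_mono)
    fix x assume "x \<in> space (lebesgue_on \<Omega>)"
    then have "\<bar>c\<bar> powr p x * norm (v x) powr p x \<le> K * norm (v x) powr p x"
      using K by (intro mult_right_mono) auto
    then show "ennreal (\<bar>norm (c *\<^sub>R v x)\<bar> powr p x) \<le> ennreal K * ennreal (norm (v x) powr p x)"
      by (simp add: powr_mult ennreal_leI flip: ennreal_mult'')
  qed
  also have "\<dots> = ennreal K * norm_modular \<Omega> p v"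
    unfolding modular_def by (simp add: nn_integral_cmult)
  finally show ?thesis .
qed

lemma powr_add_le:
  fixes a b p :: real
  assumes "0 \<le> a" "0 \<le> b" "0 \<le> p"
  shows "(a + b) powr p \<le> 2 powr p * (a powr p + b powr p)"
proof -
  have "(a + b) powr p \<le> (2 * max a b) powr p" using assms by (intro powr_mono2) auto
  also have "\<dots> = 2 powr p * max a b powr p" using assms by (simp add: powr_mult)
  also have "\<dots> \<le> 2 powr p * (a powr p + b powr p)"
    by (intro mult_left_mono) (auto simp: max_def)
  finally show ?thesis .
qed

lemma le_add_powr:
  fixes a e p m :: real
  assumes "0 \<le> a" "0 < e" "e \<le> 1" "1 \<le> p" "p \<le> m"
  shows "a \<le> e + e powr (1 - m) * a powr p"
proof (cases "a \<le> e")
  case False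
  then have "1 \<le> a / e" using assms by (simp add: field_simps)
  then have "(a / e) powr 1 \<le> (a / e) powr p" using assms by (intro powr_mono) auto
  then have "a \<le> e * (a / e) powr p" using assms by (simp add: field_simps)
  also have "\<dots> = e powr (1 - p) * a powr p"
    using assms by (simp add: powr_divide powr_diff)
  also have "\<dots> \<le> e powr (1 - m) * a powr p"
    using assms by (intro mult_right_mono powr_mono') auto
  finally show ?thesis using assms by simp
qed (simp add: add_increasing2)

locale bounded_exponent =
  fixes \<Omega> :: "'a::euclidean_space set" and p :: "'a \<Rightarrow> real" and l m :: real
  assumes p_measurable [measurable]: "p \<in> borel_measurable (lebesgue_on \<Omega>)"
    and l_gt_1: "1 < l"
    and l_le_p: "x \<in> \<Omega> \<Longrightarrow> l \<le> p x"
    and p_le_m: "x \<in> \<Omega> \<Longrightarrow> p x \<le> m"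
begin

lemma p_gt_1: "x \<in> \<Omega> \<Longrightarrow> 1 < p x"
  using l_gt_1 l_le_p by force

lemma norm_modular_scaleR_le_upper:
  assumes "v \<in> borel_measurable (lebesgue_on \<Omega>)"
  shows "norm_modular \<Omega> p (\<lambda>x. c *\<^sub>R v x) \<le> ennreal (max 1 \<bar>c\<bar> powr m) * norm_modular \<Omega> p v"
proof (rule norm_modular_scaleR_le[OF p_measurable assms])
  fix x assume x: "x \<in> \<Omega>"
  have "\<bar>c\<bar> powr p x \<le> max 1 \<bar>c\<bar> powr p x" using p_gt_1[OF x] by (intro powr_mono2) auto
  also have "\<dots> \<le> max 1 \<bar>c\<bar> powr m" using p_le_m[OF x] by (intro powr_mono) auto
  finally show "\<bar>c\<bar> powr p x \<le> max 1 \<bar>c\<bar> powr m" .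
qed

lemma norm_modular_scaleR_le_lower:
  assumes "v \<in> borel_measurable (lebesgue_on \<Omega>)" "\<bar>c\<bar> \<le> 1"
  shows "norm_modular \<Omega> p (\<lambda>x. c *\<^sub>R v x) \<le> ennreal (\<bar>c\<bar> powr l) * norm_modular \<Omega> p v"
  using assms l_le_p by (intro norm_modular_scaleR_le powr_mono') auto

lemma norm_modular_add_le:
  fixes u v :: "'a \<Rightarrow> 'b::real_normed_vector"
  assumes [measurable]: "u \<in> borel_measurable (lebesgue_on \<Omega>)"
      "v \<in> borel_measurable (lebesgue_on \<Omega>)"
  shows "norm_modular \<Omega> p (\<lambda>x. u x + v x)
    \<le> ennreal (2 powr m) * (norm_modular \<Omega> p u + norm_modular \<Omega> p v)"
proof -
  have "norm_modular \<Omega> p (\<lambda>x. u x + v x) \<le> (\<integral>\<^sup>+x. ennreal (2 powr m) *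
      (ennreal (norm (u x) powr p x) + ennreal (norm (v x) powr p x)) \<partial>lebesgue_on \<Omega>)"
    unfolding modular_def
  proof (rule nn_integral_mono)
    fix x assume "x \<in> space (lebesgue_on \<Omega>)"
    then have x: "x \<in> \<Omega>" by simp
    have "norm (u x + v x) powr p x \<le> (norm (u x) + norm (v x)) powr p x"
      using p_gt_1[OF x] by (intro powr_mono2 norm_triangle_ineq) auto
    also have "\<dots> \<le> 2 powr p x * (norm (u x) powr p x + norm (v x) powr p x)"
      using p_gt_1[OF x] by (intro powr_add_le) auto
    also have "\<dots> \<le> 2 powr m * (norm (u x) powr p x + norm (v x) powr p x)"
      using p_le_m[OF x] by (intro mult_right_mono powr_mono) auto
    finally show "ennreal (\<bar>norm (u x + v x)\<bar> powr p x)
        \<le> ennreal (2 powr m) * (ennreal (norm (u x) powr p x) + ennreal (norm (v x) powr p x))"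
      by (simp flip: ennreal_mult ennreal_plus)
  qed
  also have "\<dots> = ennreal (2 powr m) * (norm_modular \<Omega> p u + norm_modular \<Omega> p v)"
    unfolding modular_def by (simp add: nn_integral_cmult nn_integral_add)
  finally show ?thesis .
qed

lemma Lp_var_eq_Lp_field: "Lp_var \<Omega> p = Lp_field \<Omega> p"
  by (simp add: Lp_var_def Lp_field_def)

lemma norm_mem_Lp_var_iff:
  "v \<in> borel_measurable (lebesgue_on \<Omega>) \<Longrightarrow> (\<lambda>x. norm (v x)) \<in> Lp_var \<Omega> p \<longleftrightarrow> v \<in> Lp_field \<Omega> p"
  by (simp add: Lp_var_def Lp_field_def)

lemma Lp_field_imp_norm_Lp_var: "v \<in> Lp_field \<Omega> p \<Longrightarrow> (\<lambda>x. norm (v x)) \<in> Lp_var \<Omega> p"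
  by (subst norm_mem_Lp_var_iff) (auto simp: Lp_field_def)

lemma Lp_field_0: "(\<lambda>_. 0) \<in> Lp_field \<Omega> p"
  by (simp add: Lp_field_def)

lemma Lp_field_add:
  fixes u v :: "'a \<Rightarrow> 'b::{real_normed_vector, second_countable_topology}"
  assumes u: "u \<in> Lp_field \<Omega> p" and v: "v \<in> Lp_field \<Omega> p"
  shows "(\<lambda>x. u x + v x) \<in> Lp_field \<Omega> p"
proof -
  have "norm_modular \<Omega> p (\<lambda>x. u x + v x)
      \<le> ennreal (2 powr m) * (norm_modular \<Omega> p u + norm_modular \<Omega> p v)"
    using assms by (intro norm_modular_add_le) (auto simp: Lp_field_def)
  also have "\<dots> < \<infinity>" using assms by (auto simp: Lp_field_def ennreal_mult_less_top)
  finally show ?thesis using assms by (auto simp: Lp_field_def)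
qed

lemma Lp_field_scaleR:
  assumes "v \<in> Lp_field \<Omega> p"
  shows "(\<lambda>x. c *\<^sub>R v x) \<in> Lp_field \<Omega> p"
proof -
  have "norm_modular \<Omega> p (\<lambda>x. c *\<^sub>R v x) \<le> ennreal (max 1 \<bar>c\<bar> powr m) * norm_modular \<Omega> p v"
    using assms by (intro norm_modular_scaleR_le_upper) (auto simp: Lp_field_def)
  also have "\<dots> < \<infinity>" using assms by (auto simp: Lp_field_def ennreal_mult_less_top)
  finally show ?thesis using assms by (auto simp: Lp_field_def)
qed

lemma Lp_field_diff:
  fixes u v :: "'a \<Rightarrow> 'b::{real_normed_vector, second_countable_topology}"
  assumes "u \<in> Lp_field \<Omega> p" "v \<in> Lp_field \<Omega> p"
  shows "(\<lambda>x. u x - v x) \<in> Lp_field \<Omega> p"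
  using Lp_field_add[OF assms(1) Lp_field_scaleR[OF assms(2), of "- 1"]] by simp

lemma modular_null_scaleR:
  assumes "\<And>n. s n \<in> borel_measurable (lebesgue_on \<Omega>)"
    and "(\<lambda>n. norm_modular \<Omega> p (s n)) \<longlonglongrightarrow> 0"
  shows "(\<lambda>n. norm_modular \<Omega> p (\<lambda>x. c *\<^sub>R s n x)) \<longlonglongrightarrow> 0"
proof (rule tendsto_0_ennreal_le)
  show "norm_modular \<Omega> p (\<lambda>x. c *\<^sub>R s n x)
      \<le> ennreal (max 1 \<bar>c\<bar> powr m) * norm_modular \<Omega> p (s n)" for n
    by (intro norm_modular_scaleR_le_upper assms)
  have "(\<lambda>n. ennreal (max 1 \<bar>c\<bar> powr m) * norm_modular \<Omega> p (s n))
      \<longlonglongrightarrow> ennreal (max 1 \<bar>c\<bar> powr m) * 0"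
    by (intro tendsto_intros assms) auto
  then show "(\<lambda>n. ennreal (max 1 \<bar>c\<bar> powr m) * norm_modular \<Omega> p (s n)) \<longlonglongrightarrow> 0" by simp
qed

lemma modular_null_add:
  fixes s t :: "nat \<Rightarrow> 'a \<Rightarrow> 'b::real_normed_vector"
  assumes "\<And>n. s n \<in> borel_measurable (lebesgue_on \<Omega>)" "\<And>n. t n \<in> borel_measurable (lebesgue_on \<Omega>)"
    and "(\<lambda>n. norm_modular \<Omega> p (s n)) \<longlonglongrightarrow> 0" "(\<lambda>n. norm_modular \<Omega> p (t n)) \<longlonglongrightarrow> 0"
  shows "(\<lambda>n. norm_modular \<Omega> p (\<lambda>x. s n x + t n x)) \<longlonglongrightarrow> 0"
proof (rule tendsto_0_ennreal_le)
  show "norm_modular \<Omega> p (\<lambda>x. s n x + t n x)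
      \<le> ennreal (2 powr m) * (norm_modular \<Omega> p (s n) + norm_modular \<Omega> p (t n))" for n
    by (intro norm_modular_add_le assms)
  have "(\<lambda>n. ennreal (2 powr m) * (norm_modular \<Omega> p (s n) + norm_modular \<Omega> p (t n)))
      \<longlonglongrightarrow> ennreal (2 powr m) * (0 + 0)"
    by (intro tendsto_intros assms) auto
  then show "(\<lambda>n. ennreal (2 powr m) * (norm_modular \<Omega> p (s n) + norm_modular \<Omega> p (t n))) \<longlonglongrightarrow> 0"
    by simp
qed

lemma modular_tendsto_lincomb:
  fixes s t :: "nat \<Rightarrow> 'a \<Rightarrow> 'b::{real_normed_vector, second_countable_topology}"
  assumes [measurable]: "\<And>n. s n \<in> borel_measurable (lebesgue_on \<Omega>)"
      "u \<in> borel_measurable (lebesgue_on \<Omega>)"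
      "\<And>n. t n \<in> borel_measurable (lebesgue_on \<Omega>)" "v \<in> borel_measurable (lebesgue_on \<Omega>)"
    and lim: "modular_tendsto \<Omega> p s u" "modular_tendsto \<Omega> p t v"
  shows "modular_tendsto \<Omega> p (\<lambda>n x. c *\<^sub>R s n x + d *\<^sub>R t n x) (\<lambda>x. c *\<^sub>R u x + d *\<^sub>R v x)"
proof -
  have "(\<lambda>n. norm_modular \<Omega> p (\<lambda>x. c *\<^sub>R (s n x - u x) + d *\<^sub>R (t n x - v x))) \<longlonglongrightarrow> 0"
    using lim unfolding modular_tendsto_def
    by (intro modular_null_add modular_null_scaleR) measurable
  then show ?thesis
    unfolding modular_tendsto_def by (simp add: algebra_simps)
qed

lemma modular_tendsto_trans:
  fixes r s :: "nat \<Rightarrow> 'a \<Rightarrow> 'b::{real_normed_vector, second_countable_topology}"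
  assumes [measurable]: "\<And>n. r n \<in> borel_measurable (lebesgue_on \<Omega>)"
      "\<And>n. s n \<in> borel_measurable (lebesgue_on \<Omega>)" "t \<in> borel_measurable (lebesgue_on \<Omega>)"
    and "(\<lambda>n. norm_modular \<Omega> p (\<lambda>x. r n x - s n x)) \<longlonglongrightarrow> 0" "modular_tendsto \<Omega> p s t"
  shows "modular_tendsto \<Omega> p r t"
proof -
  have "(\<lambda>n. norm_modular \<Omega> p (\<lambda>x. (r n x - s n x) + (s n x - t x))) \<longlonglongrightarrow> 0"
    using assms(4,5) unfolding modular_tendsto_def by (intro modular_null_add) measurable
  then show ?thesis unfolding modular_tendsto_def by simp
qed

lemma modular_tendsto_imp_Lp_field:
  fixes s :: "nat \<Rightarrow> 'a \<Rightarrow> 'b::{real_normed_vector, second_countable_topology}"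
  assumes s: "\<And>n. s n \<in> Lp_field \<Omega> p" and t: "t \<in> borel_measurable (lebesgue_on \<Omega>)"
    and lim: "modular_tendsto \<Omega> p s t"
  shows "t \<in> Lp_field \<Omega> p"
proof -
  have "\<forall>\<^sub>F n in sequentially. norm_modular \<Omega> p (\<lambda>x. s n x - t x) < \<infinity>"
    using lim unfolding modular_tendsto_def by (rule order_tendstoD) simp
  then obtain n where "norm_modular \<Omega> p (\<lambda>x. s n x - t x) < \<infinity>"
    by (auto simp: eventually_sequentially)
  then have "(\<lambda>x. s n x - t x) \<in> Lp_field \<Omega> p"
    using s[of n] t by (auto simp: Lp_field_def)
  from Lp_field_diff[OF s[of n] this] show ?thesis by simp
qed

lemma nn_integral_norm_le_modular:
  fixes v :: "'a \<Rightarrow> 'b::real_normed_vector"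
  assumes [measurable]: "v \<in> borel_measurable (lebesgue_on \<Omega>)" and e: "0 < e" "e \<le> 1"
  shows "(\<integral>\<^sup>+x. ennreal (norm (v x)) \<partial>lebesgue_on \<Omega>)
    \<le> ennreal e * emeasure (lebesgue_on \<Omega>) \<Omega> + ennreal (e powr (1 - m)) * norm_modular \<Omega> p v"
proof -
  have "(\<integral>\<^sup>+x. ennreal (norm (v x)) \<partial>lebesgue_on \<Omega>)
    \<le> (\<integral>\<^sup>+x. ennreal e + ennreal (e powr (1 - m)) * ennreal (norm (v x) powr p x) \<partial>lebesgue_on \<Omega>)"
  proof (rule nn_integral_mono)
    fix x assume "x \<in> space (lebesgue_on \<Omega>)"
    then have "norm (v x) \<le> e + e powr (1 - m) * norm (v x) powr p x"
      using e p_gt_1[of x] p_le_m[of x] by (intro le_add_powr) auto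
    then show "ennreal (norm (v x))
        \<le> ennreal e + ennreal (e powr (1 - m)) * ennreal (norm (v x) powr p x)"
      using e by (simp flip: ennreal_mult ennreal_plus)
  qed
  also have "\<dots> = ennreal e * emeasure (lebesgue_on \<Omega>) \<Omega>
      + ennreal (e powr (1 - m)) * norm_modular \<Omega> p v"
    unfolding modular_def by (subst nn_integral_add) (auto simp: nn_integral_cmult)
  finally show ?thesis .
qed

lemma L1_small_if_modular_small:
  assumes finite: "emeasure (lebesgue_on \<Omega>) \<Omega> < \<infinity>" and e: "0 < (e::real)"
  obtains d :: real where "0 < d"
    "\<And>v :: 'a \<Rightarrow> 'b::real_normed_vector. v \<in> borel_measurable (lebesgue_on \<Omega>) \<Longrightarrow>
      norm_modular \<Omega> p v \<le> ennreal d \<Longrightarrow> (\<integral>\<^sup>+x. ennreal (norm (v x)) \<partial>lebesgue_on \<Omega>) < ennreal e"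
proof -
  obtain V where V: "V \<ge> 0" "emeasure (lebesgue_on \<Omega>) \<Omega> = ennreal V"
    using finite by (cases "emeasure (lebesgue_on \<Omega>) \<Omega>") auto
  define c where "c = min 1 (e / (2 * (V + 1)))"
  have c: "0 < c" "c \<le> 1" using e V by (auto simp: c_def)
  have "c * V \<le> e / (2 * (V + 1)) * V" using V by (intro mult_right_mono) (auto simp: c_def)
  also have "\<dots> < e / 2" using V e by (simp add: field_simps)
  finally have cV: "c * V < e / 2" .
  define d where "d = c powr (m - 1) * (e / 2)"
  have cd: "c powr (1 - m) * d = e / 2" using c by (simp add: d_def flip: powr_add)
  show ?thesis
  proof (rule that)
    show "0 < d" using c e by (simp add: d_def)
    fix v :: "'a \<Rightarrow> 'b"
    assume v: "v \<in> borel_measurable (lebesgue_on \<Omega>)" "norm_modular \<Omega> p v \<le> ennreal d"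
    have "(\<integral>\<^sup>+x. ennreal (norm (v x)) \<partial>lebesgue_on \<Omega>)
        \<le> ennreal c * ennreal V + ennreal (c powr (1 - m)) * norm_modular \<Omega> p v"
      using nn_integral_norm_le_modular[OF v(1) c] by (simp add: V(2))
    also have "\<dots> \<le> ennreal c * ennreal V + ennreal (c powr (1 - m)) * ennreal d"
      using v(2) by (intro add_left_mono mult_left_mono) auto
    also have "\<dots> = ennreal (c * V + e / 2)"
      using c V e \<open>0 < d\<close> by (simp add: ennreal_mult ennreal_plus flip: cd)
    also have "\<dots> < ennreal e" using cV e by (intro ennreal_lessI) auto
    finally show "(\<integral>\<^sup>+x. ennreal (norm (v x)) \<partial>lebesgue_on \<Omega>) < ennreal e" .
  qed
qed

lemma modular_tendsto_imp_L1_tendsto: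
  fixes s :: "nat \<Rightarrow> 'a \<Rightarrow> 'b::{real_normed_vector, second_countable_topology}"
  assumes [measurable]: "\<And>n. s n \<in> borel_measurable (lebesgue_on \<Omega>)"
      "t \<in> borel_measurable (lebesgue_on \<Omega>)"
    and finite: "emeasure (lebesgue_on \<Omega>) \<Omega> < \<infinity>"
    and lim: "modular_tendsto \<Omega> p s t"
  shows "L1_tendsto (lebesgue_on \<Omega>) s t"
  unfolding L1_tendsto_def
proof (rule tendsto_zero_ennreal)
  fix e :: real assume "0 < e"
  with finite obtain d :: real where "0 < d"
    and d: "\<And>v :: 'a \<Rightarrow> 'b. v \<in> borel_measurable (lebesgue_on \<Omega>) \<Longrightarrow>
      norm_modular \<Omega> p v \<le> ennreal d \<Longrightarrow> (\<integral>\<^sup>+x. ennreal (norm (v x)) \<partial>lebesgue_on \<Omega>) < ennreal e"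
    using L1_small_if_modular_small[where 'b='b] by blast
  have "\<forall>\<^sub>F n in sequentially. norm_modular \<Omega> p (\<lambda>x. s n x - t x) < ennreal d"
    using lim unfolding modular_tendsto_def by (rule order_tendstoD(2)) (use \<open>0 < d\<close> in simp)
  then show "\<forall>\<^sub>F n in sequentially.
      (\<integral>\<^sup>+x. ennreal (norm (s n x - t x)) \<partial>lebesgue_on \<Omega>) < ennreal e"
    by eventually_elim (intro d less_imp_le, measurable)
qed

section \<open>Luxemburg norms and modular convergence\<close>

lemma lux_norm_set_nonempty:
  assumes u: "u \<in> Lp_var \<Omega> p"
  shows "{t::real. t > 0 \<and> modular \<Omega> p (\<lambda>x. u x / t) \<le> 1} \<noteq> {}"
proof -
  obtain r where r: "r \<ge> 0" "modular \<Omega> p u = ennreal r"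
    using u by (cases "modular \<Omega> p u") (auto simp: Lp_var_def)
  define t where "t = max 1 r"
  have t: "t \<ge> 1" "r \<le> t" by (auto simp: t_def)
  have "modular \<Omega> p (\<lambda>x. u x / t) = norm_modular \<Omega> p (\<lambda>x. (1/t) *\<^sub>R u x)"
    unfolding real_norm_def modular_abs by simp
  also have "\<dots> \<le> ennreal ((1/t) powr l) * ennreal r"
    using norm_modular_scaleR_le_lower[of u "1/t"] u t r(2)
    unfolding real_norm_def modular_abs by (simp add: Lp_var_def)
  also have "\<dots> \<le> ennreal ((1/t) powr 1) * ennreal r"
    using t l_gt_1 by (intro mult_right_mono ennreal_leI powr_mono') auto
  also have "\<dots> \<le> 1" using t r by (simp flip: ennreal_mult add: field_simps)
  finally show ?thesis using t by (auto intro!: exI[of _ t])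
qed

lemma lux_norm_nonneg: "u \<in> Lp_var \<Omega> p \<Longrightarrow> 0 \<le> lux_norm \<Omega> p u"
  unfolding lux_norm_def by (rule cInf_greatest[OF lux_norm_set_nonempty]) auto

lemma modular_le_if_lux_norm_less:
  assumes u: "u \<in> Lp_var \<Omega> p" and e: "lux_norm \<Omega> p u < e" "e \<le> 1"
  shows "modular \<Omega> p u \<le> ennreal e"
proof -
  obtain t where t: "t > 0" "modular \<Omega> p (\<lambda>x. u x / t) \<le> 1" "t < e"
    using cInf_lessD[OF lux_norm_set_nonempty[OF u]] e(1) unfolding lux_norm_def by blast
  have "modular \<Omega> p u \<le> ennreal (t powr l) * modular \<Omega> p (\<lambda>x. u x / t)"
    using norm_modular_scaleR_le_lower[of "\<lambda>x. u x / t" t] t e u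
    unfolding real_norm_def modular_abs by (auto simp: Lp_var_def)
  also have "\<dots> \<le> ennreal (t powr l) * 1" using t by (intro mult_left_mono) auto
  also have "\<dots> \<le> ennreal e"
    using powr_mono'[of 1 l t] t e l_gt_1 by (auto intro!: ennreal_leI)
  finally show ?thesis .
qed

lemma lux_norm_le_if_modular_le:
  assumes u: "u \<in> Lp_var \<Omega> p" and e: "0 < e" "e \<le> 1" "modular \<Omega> p u \<le> ennreal (e powr m)"
  shows "lux_norm \<Omega> p u \<le> e"
proof -
  have max_eq: "max 1 \<bar>1/e\<bar> = 1/e" using e by (simp add: max_def)
  have "modular \<Omega> p (\<lambda>x. u x / e) = norm_modular \<Omega> p (\<lambda>x. (1/e) *\<^sub>R u x)"
    unfolding real_norm_def modular_abs by simp
  also have "\<dots> \<le> ennreal ((1/e) powr m) * modular \<Omega> p u"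
    using norm_modular_scaleR_le_upper[of u "1/e"] u
    unfolding real_norm_def modular_abs max_eq by (simp add: Lp_var_def)
  also have "\<dots> \<le> ennreal ((1/e) powr m) * ennreal (e powr m)" using e by (intro mult_left_mono) auto
  also have "\<dots> = 1" using e by (simp add: powr_divide flip: ennreal_mult)
  finally show ?thesis
    unfolding lux_norm_def using e by (intro cInf_lower bdd_belowI[of _ 0]) auto
qed

lemma lux_norm_tendsto_0_iff:
  assumes u: "\<And>k. u k \<in> Lp_var \<Omega> p"
  shows "(\<lambda>k. lux_norm \<Omega> p (u k)) \<longlonglongrightarrow> 0 \<longleftrightarrow> (\<lambda>k. modular \<Omega> p (u k)) \<longlonglongrightarrow> 0"
proof
  assume lim: "(\<lambda>k. lux_norm \<Omega> p (u k)) \<longlonglongrightarrow> 0"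
  show "(\<lambda>k. modular \<Omega> p (u k)) \<longlonglongrightarrow> 0"
  proof (rule tendsto_zero_ennreal)
    fix b :: real assume "0 < b"
    define e where "e = min 1 (b / 2)"
    have e: "0 < e" "e \<le> 1" "ennreal e < ennreal b"
      using \<open>0 < b\<close> by (auto simp: e_def intro!: ennreal_lessI)
    have "\<forall>\<^sub>F k in sequentially. lux_norm \<Omega> p (u k) < e"
      using lim e(1) by (rule order_tendstoD(2))
    then show "\<forall>\<^sub>F k in sequentially. modular \<Omega> p (u k) < ennreal b"
      by eventually_elim (rule le_less_trans[OF modular_le_if_lux_norm_less[OF u _ e(2)] e(3)])
  qed
next
  assume lim: "(\<lambda>k. modular \<Omega> p (u k)) \<longlonglongrightarrow> 0"
  show "(\<lambda>k. lux_norm \<Omega> p (u k)) \<longlonglongrightarrow> 0"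
  proof (rule order_tendstoI)
    fix b :: real assume "b < 0"
    then show "\<forall>\<^sub>F k in sequentially. b < lux_norm \<Omega> p (u k)"
      using lux_norm_nonneg[OF u] by (auto intro!: always_eventually intro: less_le_trans)
  next
    fix b :: real assume "0 < b"
    define e where "e = min 1 (b / 2)"
    have e: "0 < e" "e \<le> 1" "e < b" using \<open>0 < b\<close> by (auto simp: e_def)
    have "\<forall>\<^sub>F k in sequentially. modular \<Omega> p (u k) < ennreal (e powr m)"
      using lim by (rule order_tendstoD(2)) (use e in auto)
    then show "\<forall>\<^sub>F k in sequentially. lux_norm \<Omega> p (u k) < b"
      by eventually_elim
        (rule le_less_trans[OF lux_norm_le_if_modular_le[OF u e(1,2) less_imp_le] e(3)])
  qed
qed

end

section \<open>Variable exponent spaces over bounded domains\<close>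

locale bounded_domain =
  fixes \<Omega> :: "'a::euclidean_space set"
  assumes open_\<Omega>: "open \<Omega>" and bounded_\<Omega>: "bounded \<Omega>" and nonempty_\<Omega>: "\<Omega> \<noteq> {}"
begin

abbreviation "M \<equiv> lebesgue_on \<Omega>"

sublocale finite_measure M
  using open_\<Omega> bounded_\<Omega> by (intro finite_measure_lebesgue_on) (simp add: lmeasurable_open)

lemma emeasure_\<Omega>_finite: "emeasure M \<Omega> < \<infinity>"
  by (metis emeasure_finite infinity_ennreal_def less_top)

lemma compact_closure_\<Omega>: "compact (closure \<Omega>)" "closure \<Omega> \<noteq> {}"
  using bounded_\<Omega> nonempty_\<Omega> by (simp_all add: compact_closure)

lemma continuous_on_closure_imp_measurable:
  assumes "continuous_on (closure \<Omega>) f"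
  shows "f \<in> borel_measurable M"
  using open_\<Omega> continuous_on_subset[OF assms closure_subset]
  by (intro continuous_imp_measurable_on_sets_lebesgue) auto

end

locale exponent_on_domain = bounded_domain \<Omega> + bounded_exponent \<Omega> p l m
  for \<Omega> :: "'a::euclidean_space set" and p l m
begin

lemma l_le_m: "l \<le> m"
  using nonempty_\<Omega> l_le_p p_le_m by (meson all_not_in_conv order_trans)

lemma bounded_imp_Lp_field:
  assumes v: "v \<in> borel_measurable M" "\<And>x. norm (v x) \<le> B"
  shows "v \<in> Lp_field \<Omega> p"
proof -
  have "norm_modular \<Omega> p v \<le> (\<integral>\<^sup>+x. ennreal (max 1 B powr m) \<partial>M)"
    unfolding modular_def
  proof (rule nn_integral_mono)
    fix x assume "x \<in> space M"
    then have x: "x \<in> \<Omega>" by simp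
    have "norm (v x) powr p x \<le> max 1 B powr p x"
      using p_gt_1[OF x] v(2)[of x] by (intro powr_mono2) auto
    also have "\<dots> \<le> max 1 B powr m" using p_le_m[OF x] by (intro powr_mono) auto
    finally show "ennreal (\<bar>norm (v x)\<bar> powr p x) \<le> ennreal (max 1 B powr m)"
      by (simp add: ennreal_leI)
  qed
  also have "\<dots> < \<infinity>" using emeasure_\<Omega>_finite by (simp add: ennreal_mult_less_top)
  finally show ?thesis using v by (simp add: Lp_field_def)
qed

lemma Lp_field_imp_integrable:
  fixes v :: "'a \<Rightarrow> 'b::{banach, second_countable_topology}"
  assumes "v \<in> Lp_field \<Omega> p"
  shows "integrable M v"
proof (rule integrableI_bounded)
  show [measurable]: "v \<in> borel_measurable M" using assms by (simp add: Lp_field_def)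
  have "(\<integral>\<^sup>+x. ennreal (norm (v x)) \<partial>M) \<le> ennreal 1 * emeasure M \<Omega> + norm_modular \<Omega> p v"
    using nn_integral_norm_le_modular[of v 1] by simp
  also have "\<dots> < \<infinity>" using assms emeasure_\<Omega>_finite by (simp add: Lp_field_def)
  finally show "(\<integral>\<^sup>+x. ennreal (norm (v x)) \<partial>M) < \<infinity>" .
qed

lemma modular_Cauchy_imp_L1_Cauchy:
  fixes s :: "nat \<Rightarrow> 'a \<Rightarrow> 'b::{banach, second_countable_topology}"
  assumes s: "\<And>n. s n \<in> Lp_field \<Omega> p" and Cauchy: "modular_Cauchy \<Omega> p s" and e: "0 < (e::real)"
  shows "\<exists>N. \<forall>i\<ge>N. \<forall>j\<ge>N. (\<integral>x. norm (s i x - s j x) \<partial>M) < e"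
proof -
  obtain d :: real where "0 < d"
    and d: "\<And>v :: 'a \<Rightarrow> 'b. v \<in> borel_measurable M \<Longrightarrow>
      norm_modular \<Omega> p v \<le> ennreal d \<Longrightarrow> (\<integral>\<^sup>+x. ennreal (norm (v x)) \<partial>M) < ennreal e"
    using L1_small_if_modular_small[OF emeasure_\<Omega>_finite e, where 'b='b] by blast
  then obtain N where N: "\<And>i j. i \<ge> N \<Longrightarrow> j \<ge> N \<Longrightarrow>
      norm_modular \<Omega> p (\<lambda>x. s i x - s j x) \<le> ennreal d"
    using Cauchy unfolding modular_Cauchy_def by blast
  have "(\<integral>x. norm (s i x - s j x) \<partial>M) < e" if "i \<ge> N" "j \<ge> N" for i j
  proof -
    have integrable: "integrable M (\<lambda>x. s i x - s j x)"
      by (intro Lp_field_imp_integrable Lp_field_diff s)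
    have "ennreal (\<integral>x. norm (s i x - s j x) \<partial>M) = (\<integral>\<^sup>+x. ennreal (norm (s i x - s j x)) \<partial>M)"
      using integrable by (intro nn_integral_eq_integral[symmetric]) auto
    also have "\<dots> < ennreal e"
      by (intro d borel_measurable_integrable[OF integrable] N that)
    finally show ?thesis by (simp add: ennreal_less_iff)
  qed
  then show ?thesis by blast
qed

lemma modular_Cauchy_AE_convergent_subseq:
  fixes s :: "nat \<Rightarrow> 'a \<Rightarrow> 'b::{banach, second_countable_topology}"
  assumes s: "\<And>n. s n \<in> Lp_field \<Omega> p" and Cauchy: "modular_Cauchy \<Omega> p s"
  obtains t r where "t \<in> borel_measurable M" "strict_mono r" "AE x in M. (\<lambda>k. s (r k) x) \<longlonglongrightarrow> t x"
proof -
  have [measurable]: "s n \<in> borel_measurable M" for n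
    using s by (simp add: Lp_field_def)
  obtain r where r: "strict_mono r" "AE x in M. Cauchy (\<lambda>i. s (r i) x)"
    using cauchy_L1_AE_cauchy_subseq[of M s] Lp_field_imp_integrable[OF s]
      modular_Cauchy_imp_L1_Cauchy[OF s Cauchy] by blast
  define t where "t x = lim (\<lambda>i. s (r i) x)" for x
  show ?thesis
  proof (rule that[OF _ r(1)])
    show "t \<in> borel_measurable M"
      unfolding t_def by (rule borel_measurable_lim_metric) measurable
    show "AE x in M. (\<lambda>k. s (r k) x) \<longlonglongrightarrow> t x"
      using r(2)
      by eventually_elim (auto simp: t_def Cauchy_convergent_iff convergent_LIMSEQ_iff)
  qed
qed

lemma norm_modular_le_if_AE_tendsto:
  fixes v :: "nat \<Rightarrow> 'a \<Rightarrow> 'b::real_normed_vector"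
  assumes [measurable]: "\<And>k. v k \<in> borel_measurable M"
    and lim: "AE x in M. (\<lambda>k. v k x) \<longlonglongrightarrow> w x"
    and bound: "\<forall>\<^sub>F k in sequentially. norm_modular \<Omega> p (v k) \<le> B"
  shows "norm_modular \<Omega> p w \<le> B"
proof -
  have "norm_modular \<Omega> p w = (\<integral>\<^sup>+x. liminf (\<lambda>k. ennreal (norm (v k x) powr p x)) \<partial>M)"
    unfolding modular_def
  proof (rule nn_integral_cong_AE)
    show "AE x in M. ennreal (\<bar>norm (w x)\<bar> powr p x)
        = liminf (\<lambda>k. ennreal (norm (v k x) powr p x))"
      using lim AE_space
    proof eventually_elim
      case (elim x)
      then have "(\<lambda>k. ennreal (norm (v k x) powr p x)) \<longlonglongrightarrow> ennreal (norm (w x) powr p x)"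
        using p_gt_1[of x] by (intro tendsto_ennrealI tendsto_powr2 tendsto_intros) auto
      from lim_imp_Liminf[OF _ this] show ?case by simp
    qed
  qed
  also have "\<dots> \<le> liminf (\<lambda>k. norm_modular \<Omega> p (v k))"
    unfolding modular_def abs_norm_cancel by (rule nn_integral_liminf) measurable
  also have "\<dots> \<le> B"
    by (intro Liminf_le bound) simp
  finally show ?thesis .
qed

lemma modular_Cauchy_imp_modular_tendsto:
  fixes s :: "nat \<Rightarrow> 'a \<Rightarrow> 'b::{real_normed_vector, second_countable_topology}"
  assumes [measurable]: "\<And>n. s n \<in> borel_measurable M" and Cauchy: "modular_Cauchy \<Omega> p s"
    and r: "strict_mono r" and lim: "AE x in M. (\<lambda>k. s (r k) x) \<longlonglongrightarrow> t x"
  shows "modular_tendsto \<Omega> p s t"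
  unfolding modular_tendsto_def
proof (rule tendsto_zero_ennreal)
  fix e :: real assume "0 < e"
  then obtain N where N: "\<And>i j. i \<ge> N \<Longrightarrow> j \<ge> N \<Longrightarrow>
      norm_modular \<Omega> p (\<lambda>x. s i x - s j x) \<le> ennreal (e / 2)"
    using Cauchy unfolding modular_Cauchy_def by (meson half_gt_zero)
  have "norm_modular \<Omega> p (\<lambda>x. s n x - t x) \<le> ennreal (e / 2)" if n: "n \<ge> N" for n
  proof (rule norm_modular_le_if_AE_tendsto[where v="\<lambda>k x. s n x - s (r k) x"])
    show "AE x in M. (\<lambda>k. s n x - s (r k) x) \<longlonglongrightarrow> s n x - t x"
      using lim by eventually_elim (intro tendsto_intros)
    have "norm_modular \<Omega> p (\<lambda>x. s n x - s (r k) x) \<le> ennreal (e / 2)" if "k \<ge> N" for k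
      using N n that seq_suble[OF r, of k] by simp
    then show "\<forall>\<^sub>F k in sequentially. norm_modular \<Omega> p (\<lambda>x. s n x - s (r k) x) \<le> ennreal (e / 2)"
      by (auto simp: eventually_sequentially)
  qed measurable
  moreover have "ennreal (e / 2) < ennreal e" using \<open>0 < e\<close> by (intro ennreal_lessI) auto
  ultimately show "\<forall>\<^sub>F n in sequentially. norm_modular \<Omega> p (\<lambda>x. s n x - t x) < ennreal e"
    by (auto simp: eventually_sequentially intro: le_less_trans)
qed

section \<open>Sobolev spaces with zero boundary values\<close>

lemma add_tendsto_0_iff:
  fixes a b :: "'i \<Rightarrow> real"
  assumes "\<And>i. 0 \<le> a i" "\<And>i. 0 \<le> b i"
  shows "((\<lambda>i. a i + b i) \<longlongrightarrow> 0) F \<longleftrightarrow> (a \<longlongrightarrow> 0) F \<and> (b \<longlongrightarrow> 0) F"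
proof (intro iffI conjI)
  assume lim: "((\<lambda>i. a i + b i) \<longlongrightarrow> 0) F"
  show "(a \<longlongrightarrow> 0) F" "(b \<longlongrightarrow> 0) F"
    by (rule tendsto_sandwich[OF _ _ tendsto_const lim]; use assms in simp)+
qed (use tendsto_add_zero in blast)

lemma W0_grad_iff:
  "W0_grad \<Omega> p u g \<longleftrightarrow> weak_grad \<Omega> u g \<and> u \<in> Lp_field \<Omega> p \<and> g \<in> Lp_field \<Omega> p \<and>
    (\<exists>\<phi>. (\<forall>k. test_fun \<Omega> (\<phi> k)) \<and>
      modular_tendsto \<Omega> p \<phi> u \<and> modular_tendsto \<Omega> p (\<lambda>k. grad (\<phi> k)) g)"
proof -
  have "(\<lambda>k. lux_norm \<Omega> p (\<lambda>x. \<phi> k x - u x) + lux_norm \<Omega> p (\<lambda>x. norm (grad (\<phi> k) x - g x)))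
      \<longlonglongrightarrow> 0 \<longleftrightarrow> modular_tendsto \<Omega> p \<phi> u \<and> modular_tendsto \<Omega> p (\<lambda>k. grad (\<phi> k)) g"
    if u: "u \<in> Lp_field \<Omega> p" and g: "g \<in> Lp_field \<Omega> p" and \<phi>: "\<forall>k. test_fun \<Omega> (\<phi> k)" for \<phi>
  proof -
    note measurable = test_fun_measurable[OF \<phi>[rule_format]]
    have "\<phi> k \<in> Lp_field \<Omega> p" "grad (\<phi> k) \<in> Lp_field \<Omega> p" for k
      using \<phi> by (metis test_fun_bounded bounded_imp_Lp_field measurable(1),
          metis grad_test_fun_bounded bounded_imp_Lp_field measurable(2))
    then have diff: "(\<lambda>x. \<phi> k x - u x) \<in> Lp_field \<Omega> p"
      "(\<lambda>x. grad (\<phi> k) x - g x) \<in> Lp_field \<Omega> p" for k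
      using u g by (auto intro: Lp_field_diff)
    then have Lp_var: "(\<lambda>x. \<phi> k x - u x) \<in> Lp_var \<Omega> p"
      "(\<lambda>x. norm (grad (\<phi> k) x - g x)) \<in> Lp_var \<Omega> p" for k
      using diff(1) Lp_field_imp_norm_Lp_var[OF diff(2)] by (auto simp: Lp_var_eq_Lp_field)
    show ?thesis
      using lux_norm_tendsto_0_iff[OF Lp_var(1)] lux_norm_tendsto_0_iff[OF Lp_var(2)]
      by (simp add: add_tendsto_0_iff lux_norm_nonneg Lp_var modular_tendsto_def)
  qed
  moreover have "(\<lambda>x. norm (g x)) \<in> Lp_var \<Omega> p \<longleftrightarrow> g \<in> Lp_field \<Omega> p" if "weak_grad \<Omega> u g"
    using weak_grad_measurable(2)[OF that] by (rule norm_mem_Lp_var_iff)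
  ultimately show ?thesis unfolding W0_grad_def Lp_var_eq_Lp_field by blast
qed

lemma W0_gradD:
  assumes "W0_grad \<Omega> p u g"
  shows "weak_grad \<Omega> u g" "u \<in> Lp_field \<Omega> p" "g \<in> Lp_field \<Omega> p"
    "u \<in> borel_measurable M" "g \<in> borel_measurable M"
  using assms by (auto simp: W0_grad_iff Lp_field_def)

lemma W0_grad_0: "W0_grad \<Omega> p (\<lambda>_. 0) (\<lambda>_. 0)"
proof -
  have "grad (\<lambda>_::'a. 0) x = 0" for x by (simp add: grad_def)
  then show ?thesis
    by (auto simp: W0_grad_iff weak_grad_0 Lp_field_0 modular_tendsto_def
        intro!: exI[where x="\<lambda>_ _. 0"] test_fun_0)
qed

lemma W0_grad_lincomb:
  assumes u: "W0_grad \<Omega> p u g" and v: "W0_grad \<Omega> p v h"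
  shows "W0_grad \<Omega> p (\<lambda>x. c * u x + d * v x) (\<lambda>x. c *\<^sub>R g x + d *\<^sub>R h x)"
proof -
  note [measurable] = W0_gradD(4,5)[OF u] W0_gradD(4,5)[OF v]
  obtain \<phi> where \<phi>: "\<And>k. test_fun \<Omega> (\<phi> k)"
    and \<phi>_lim: "modular_tendsto \<Omega> p \<phi> u" "modular_tendsto \<Omega> p (\<lambda>k. grad (\<phi> k)) g"
    using u by (auto simp: W0_grad_iff)
  obtain \<psi> where \<psi>: "\<And>k. test_fun \<Omega> (\<psi> k)"
    and \<psi>_lim: "modular_tendsto \<Omega> p \<psi> v" "modular_tendsto \<Omega> p (\<lambda>k. grad (\<psi> k)) h"
    using v by (auto simp: W0_grad_iff)
  note [measurable] = test_fun_measurable[OF \<phi>] test_fun_measurable[OF \<psi>]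
  let ?\<chi> = "\<lambda>k x. c * \<phi> k x + d * \<psi> k x"
  have "modular_tendsto \<Omega> p (\<lambda>k x. c *\<^sub>R \<phi> k x + d *\<^sub>R \<psi> k x) (\<lambda>x. c *\<^sub>R u x + d *\<^sub>R v x)"
    by (rule modular_tendsto_lincomb[OF _ _ _ _ \<phi>_lim(1) \<psi>_lim(1)]) measurable
  then have "modular_tendsto \<Omega> p ?\<chi> (\<lambda>x. c * u x + d * v x)" by simp
  moreover have "modular_tendsto \<Omega> p (\<lambda>k. grad (?\<chi> k)) (\<lambda>x. c *\<^sub>R g x + d *\<^sub>R h x)"
    unfolding grad_lincomb[OF test_fun_has_frechet_derivative[OF \<phi>]
        test_fun_has_frechet_derivative[OF \<psi>], abs_def]
    by (rule modular_tendsto_lincomb[OF _ _ _ _ \<phi>_lim(2) \<psi>_lim(2)]) measurable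
  moreover have "(\<lambda>x. c *\<^sub>R u x + d *\<^sub>R v x) \<in> Lp_field \<Omega> p"
      "(\<lambda>x. c *\<^sub>R g x + d *\<^sub>R h x) \<in> Lp_field \<Omega> p"
    by (intro Lp_field_add Lp_field_scaleR W0_gradD(2,3)[OF u] W0_gradD(2,3)[OF v])+
  moreover have "test_fun \<Omega> (?\<chi> k)" for k by (intro test_fun_lincomb \<phi> \<psi>)
  ultimately show ?thesis
    using weak_grad_lincomb[OF W0_gradD(1)[OF u] W0_gradD(1)[OF v]]
    by (auto simp: W0_grad_iff intro!: exI[where x="?\<chi>"])
qed

lemma W0_grad_scale: "W0_grad \<Omega> p u g \<Longrightarrow> W0_grad \<Omega> p (\<lambda>x. c * u x) (\<lambda>x. c *\<^sub>R g x)"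
  using W0_grad_lincomb[OF _ W0_grad_0, of u g c 0] by simp

lemma W0_grad_any_weak_grad:
  assumes u: "W0_grad \<Omega> p u g" and h: "weak_grad \<Omega> u h"
  shows "W0_grad \<Omega> p u h"
proof -
  note AE_eq = weak_grad_unique[OF open_\<Omega> W0_gradD(1)[OF u] h]
  have "norm_modular \<Omega> p (\<lambda>x. grad \<phi> x - g x) = norm_modular \<Omega> p (\<lambda>x. grad \<phi> x - h x)" for \<phi>
    using AE_eq by (intro modular_cong_AE) auto
  moreover have "norm_modular \<Omega> p g = norm_modular \<Omega> p h"
    using AE_eq by (intro modular_cong_AE) auto
  ultimately show ?thesis
    using u h weak_grad_measurable(2)[OF h]
    by (auto simp: W0_grad_iff Lp_field_def modular_tendsto_def)
qed

lemma W0_grad_close_test_fun: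
  assumes u: "W0_grad \<Omega> p u g" and e: "e > 0"
  obtains \<phi> where "test_fun \<Omega> \<phi>" "norm_modular \<Omega> p (\<lambda>x. \<phi> x - u x) < e"
    "norm_modular \<Omega> p (\<lambda>x. grad \<phi> x - g x) < e"
proof -
  obtain \<phi> where \<phi>: "\<And>k. test_fun \<Omega> (\<phi> k)"
    and lim: "modular_tendsto \<Omega> p \<phi> u" "modular_tendsto \<Omega> p (\<lambda>k. grad (\<phi> k)) g"
    using u by (auto simp: W0_grad_iff)
  have "\<forall>\<^sub>F k in sequentially. norm_modular \<Omega> p (\<lambda>x. \<phi> k x - u x) < e"
    using lim(1) e unfolding modular_tendsto_def by (rule order_tendstoD(2))
  moreover have "\<forall>\<^sub>F k in sequentially. norm_modular \<Omega> p (\<lambda>x. grad (\<phi> k) x - g x) < e"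
    using lim(2) e unfolding modular_tendsto_def by (rule order_tendstoD(2))
  ultimately have "\<forall>\<^sub>F k in sequentially. norm_modular \<Omega> p (\<lambda>x. \<phi> k x - u x) < e \<and>
      norm_modular \<Omega> p (\<lambda>x. grad (\<phi> k) x - g x) < e"
    by (rule eventually_conj)
  then show ?thesis
    using that[OF \<phi>] by (auto simp: eventually_sequentially)
qed

lemma W0_grad_modular_limit:
  assumes UG: "\<And>n. W0_grad \<Omega> p (U n) (G n)"
    and [measurable]: "u \<in> borel_measurable M" "g \<in> borel_measurable M"
    and U_lim: "modular_tendsto \<Omega> p U u" and G_lim: "modular_tendsto \<Omega> p G g"
  shows "W0_grad \<Omega> p u g"
proof -
  note [measurable] = W0_gradD(4,5)[OF UG]
  have "weak_grad \<Omega> u g"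
  proof (rule weak_grad_L1_limit[OF W0_gradD(1)[OF UG]])
    show "L1_tendsto M U u"
      by (rule modular_tendsto_imp_L1_tendsto[OF _ _ emeasure_\<Omega>_finite U_lim]) measurable
    show "L1_tendsto M G g"
      by (rule modular_tendsto_imp_L1_tendsto[OF _ _ emeasure_\<Omega>_finite G_lim]) measurable
  qed measurable
  moreover have "u \<in> Lp_field \<Omega> p" "g \<in> Lp_field \<Omega> p"
    by (rule modular_tendsto_imp_Lp_field[OF W0_gradD(2)[OF UG] _ U_lim],
        measurable, rule modular_tendsto_imp_Lp_field[OF W0_gradD(3)[OF UG] _ G_lim], measurable)
  moreover have "\<exists>\<phi>. test_fun \<Omega> \<phi> \<and>
      norm_modular \<Omega> p (\<lambda>x. \<phi> x - U n x) < ennreal (1 / real (Suc n)) \<and>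
      norm_modular \<Omega> p (\<lambda>x. grad \<phi> x - G n x) < ennreal (1 / real (Suc n))" for n
    by (rule W0_grad_close_test_fun[OF UG, of "ennreal (1 / real (Suc n))" n]) auto
  then obtain \<phi> where \<phi>: "\<And>n. test_fun \<Omega> (\<phi> n)"
    and \<phi>U: "\<And>n. norm_modular \<Omega> p (\<lambda>x. \<phi> n x - U n x) < ennreal (1 / real (Suc n))"
    and \<phi>G: "\<And>n. norm_modular \<Omega> p (\<lambda>x. grad (\<phi> n) x - G n x) < ennreal (1 / real (Suc n))"
    by metis
  note [measurable] = test_fun_measurable[OF \<phi>]
  have inverse_Suc: "(\<lambda>n. ennreal (1 / real (Suc n))) \<longlonglongrightarrow> 0"
    using tendsto_ennrealI[OF LIMSEQ_inverse_real_of_nat] by (simp add: inverse_eq_divide)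
  have "modular_tendsto \<Omega> p \<phi> u"
    by (rule modular_tendsto_trans[OF _ _ _
          tendsto_0_ennreal_le[OF less_imp_le[OF \<phi>U] inverse_Suc] U_lim]) measurable
  moreover have "modular_tendsto \<Omega> p (\<lambda>n. grad (\<phi> n)) g"
    by (rule modular_tendsto_trans[OF _ _ _
          tendsto_0_ennreal_le[OF less_imp_le[OF \<phi>G] inverse_Suc] G_lim]) measurable
  ultimately show ?thesis using \<phi> by (auto simp: W0_grad_iff)
qed

lemma W0_grad_L1_approx:
  assumes u: "W0_grad \<Omega> p u g"
  obtains \<phi> where "\<And>k. test_fun \<Omega> (\<phi> k)" "L1_tendsto M \<phi> u" "L1_tendsto M (\<lambda>k. grad (\<phi> k)) g"
proof -
  note [measurable] = W0_gradD(4,5)[OF u]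
  obtain \<phi> where \<phi>: "\<And>k. test_fun \<Omega> (\<phi> k)"
    and lim: "modular_tendsto \<Omega> p \<phi> u" "modular_tendsto \<Omega> p (\<lambda>k. grad (\<phi> k)) g"
    using u by (auto simp: W0_grad_iff)
  note [measurable] = test_fun_measurable[OF \<phi>]
  show ?thesis
  proof (rule that[OF \<phi>])
    show "L1_tendsto M \<phi> u"
      by (rule modular_tendsto_imp_L1_tendsto[OF _ _ emeasure_\<Omega>_finite lim(1)]) measurable
    show "L1_tendsto M (\<lambda>k. grad (\<phi> k)) g"
      by (rule modular_tendsto_imp_L1_tendsto[OF _ _ emeasure_\<Omega>_finite lim(2)]) measurable
  qed
qed

end

section \<open>The Riesz kernel\<close>

definition riesz_kernel :: "'a::euclidean_space \<Rightarrow> real" where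
  "riesz_kernel w = norm w powr (1 - real DIM('a))"

lemma riesz_kernel_nonneg: "0 \<le> riesz_kernel w"
  by (simp add: riesz_kernel_def)

lemma riesz_kernel_minus: "riesz_kernel (- w) = riesz_kernel w"
  by (simp add: riesz_kernel_def)

lemma riesz_kernel_measurable [measurable]: "riesz_kernel \<in> borel_measurable borel"
  unfolding riesz_kernel_def[abs_def] by measurable

lemma nn_integral_inverse_power_dyadic_le:
  fixes r :: real
  assumes "r \<ge> 0"
  shows "(\<integral>\<^sup>+t. indicator {r<..<2*r} t * ennreal (1 / t ^ N) \<partial>lborel)
    \<le> ennreal (r powr (1 - real N))"
proof (cases "r = 0")
  case False
  with assms have r: "r > 0" by simp
  have "(\<integral>\<^sup>+t. indicator {r<..<2*r} t * ennreal (1 / t ^ N) \<partial>lborel)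
      \<le> (\<integral>\<^sup>+t. ennreal (1 / r ^ N) * indicator {r<..<2*r} t \<partial>lborel)"
    using r by (intro nn_integral_mono)
      (auto simp: indicator_def intro!: ennreal_leI divide_left_mono power_mono)
  also have "\<dots> = ennreal (1 / r ^ N) * ennreal r"
    using r by (simp add: nn_integral_cmult_indicator)
  also have "\<dots> = ennreal (r powr (1 - real N))"
    using r by (simp add: powr_diff powr_realpow flip: ennreal_mult)
  finally show ?thesis .
qed simp

definition half_annulus :: "'a::euclidean_space set" where
  "half_annulus = {z. 1/2 < norm z \<and> norm z < 1}"

definition half_annulus_vol :: "'a::euclidean_space itself \<Rightarrow> real" where
  "half_annulus_vol _ = measure lborel (half_annulus :: 'a set)"

lemma open_half_annulus: "open (half_annulus :: 'a::euclidean_space set)"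
  unfolding half_annulus_def by (intro open_Collect_conj open_Collect_less continuous_intros)

lemma half_annulus_measurable [measurable]:
  "(half_annulus :: 'a::euclidean_space set) \<in> sets borel"
  by (simp add: open_half_annulus)

lemma emeasure_half_annulus:
  "emeasure lborel (half_annulus :: 'a::euclidean_space set) = ennreal (half_annulus_vol TYPE('a))"
proof -
  have "(half_annulus :: 'a set) \<subseteq> ball 0 1" by (auto simp: half_annulus_def)
  then have "bounded (half_annulus :: 'a set)" using bounded_ball bounded_subset by blast
  then have "emeasure lborel (half_annulus :: 'a set) \<noteq> top"
    using emeasure_bounded_finite by fastforce
  then show ?thesis
    unfolding half_annulus_vol_def by (rule emeasure_eq_ennreal_measure)
qed

lemma half_annulus_vol_pos: "0 < half_annulus_vol TYPE('a::euclidean_space)"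
proof -
  obtain b :: 'a where b: "norm b = 3/4" using vector_choose_size[of "3/4"] by auto
  then have "b \<in> half_annulus" by (simp add: half_annulus_def)
  then have "\<not> negligible (half_annulus :: 'a set)"
    using open_half_annulus by (metis empty_iff open_not_negligible)
  then show ?thesis
    using emeasure_half_annulus[where 'a='a]
    by (simp add: negligible_iff_emeasure0 ennreal_eq_0_iff flip: not_le)
qed

text \<open>Integrating over rays in the directions of an annulus and substituting \<open>y = x + t z\<close>
  produces the kernel without polar coordinates.\<close>

lemma nn_integral_half_annulus_substitution:
  fixes x :: "'a::euclidean_space" and n :: "'a \<Rightarrow> ennreal"
  assumes [measurable]: "n \<in> borel_measurable borel" and t: "t > 0"
  shows "(\<integral>\<^sup>+z. indicator half_annulus z * n (x + t *\<^sub>R z) \<partial>lborel)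
    = (\<integral>\<^sup>+y. ennreal (1 / t ^ DIM('a)) *
        (indicator {norm (x - y)<..<2 * norm (x - y)} t * n y) \<partial>lborel)"
proof -
  have indicator: "indicator {norm (x - (x + t *\<^sub>R z))<..<2 * norm (x - (x + t *\<^sub>R z))} t
      = (indicator half_annulus z :: ennreal)" for z
    using t by (auto simp: indicator_def half_annulus_def field_simps)
  have "(\<integral>\<^sup>+y. ennreal (1 / t ^ DIM('a)) *
        (indicator {norm (x - y)<..<2 * norm (x - y)} t * n y) \<partial>lborel)
    = (\<integral>\<^sup>+z. ennreal (\<bar>t\<bar> ^ DIM('a)) * (ennreal (1 / t ^ DIM('a)) *
        (indicator {norm (x - (x + t *\<^sub>R z))<..<2 * norm (x - (x + t *\<^sub>R z))} t
          * n (x + t *\<^sub>R z))) \<partial>lborel)"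
    by (subst lborel_affine[of t x])
      (use t in \<open>simp_all add: nn_integral_density nn_integral_distr indicator_def\<close>)
  also have "\<dots> = (\<integral>\<^sup>+z. indicator half_annulus z * n (x + t *\<^sub>R z) \<partial>lborel)"
    using t unfolding indicator by (intro nn_integral_cong) (simp flip: ennreal_mult mult.assoc)
  finally show ?thesis by simp
qed

lemma nn_integral_rays_le_riesz_kernel:
  fixes x :: "'a::euclidean_space" and n :: "'a \<Rightarrow> ennreal"
  assumes [measurable]: "n \<in> borel_measurable borel"
  shows "(\<integral>\<^sup>+z. indicator half_annulus z *
      (\<integral>\<^sup>+t. indicator {0<..T} t * n (x + t *\<^sub>R z) \<partial>lborel) \<partial>lborel)
    \<le> (\<integral>\<^sup>+y. n y * ennreal (riesz_kernel (x - y)) \<partial>lborel)"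
proof -
  have "(\<integral>\<^sup>+z. indicator half_annulus z *
      (\<integral>\<^sup>+t. indicator {0<..T} t * n (x + t *\<^sub>R z) \<partial>lborel) \<partial>lborel)
    = (\<integral>\<^sup>+z. \<integral>\<^sup>+t. indicator half_annulus z *
        (indicator {0<..T} t * n (x + t *\<^sub>R z)) \<partial>lborel \<partial>lborel)"
    by (simp add: nn_integral_cmult)
  also have "\<dots> = (\<integral>\<^sup>+t. \<integral>\<^sup>+z. indicator half_annulus z *
        (indicator {0<..T} t * n (x + t *\<^sub>R z)) \<partial>lborel \<partial>lborel)"
    by (rule lborel_pair.Fubini') measurable
  also have "\<dots> = (\<integral>\<^sup>+t. indicator {0<..T} t *
        (\<integral>\<^sup>+z. indicator half_annulus z * n (x + t *\<^sub>R z) \<partial>lborel) \<partial>lborel)"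
    by (simp add: mult.left_commute[of "indicator half_annulus _"] nn_integral_cmult)
  also have "\<dots> \<le> (\<integral>\<^sup>+t. \<integral>\<^sup>+y. ennreal (1 / t ^ DIM('a)) *
        (indicator {norm (x - y)<..<2 * norm (x - y)} t * n y) \<partial>lborel \<partial>lborel)"
    by (intro nn_integral_mono)
      (auto simp: indicator_times_eq_if nn_integral_half_annulus_substitution
        split: split_indicator)
  also have "\<dots> = (\<integral>\<^sup>+y. \<integral>\<^sup>+t. ennreal (1 / t ^ DIM('a)) *
        (indicator {norm (x - y)<..<2 * norm (x - y)} t * n y) \<partial>lborel \<partial>lborel)"
    unfolding indicator_def greaterThanLessThan_iff by (rule lborel_pair.Fubini') measurable
  also have "\<dots> = (\<integral>\<^sup>+y. n y * (\<integral>\<^sup>+t. indicator {norm (x - y)<..<2 * norm (x - y)} t *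
        ennreal (1 / t ^ DIM('a)) \<partial>lborel) \<partial>lborel)"
    by (simp add: mult_ac flip: nn_integral_cmult)
  also have "\<dots> \<le> (\<integral>\<^sup>+y. n y * ennreal (riesz_kernel (x - y)) \<partial>lborel)"
    unfolding riesz_kernel_def
    by (intro nn_integral_mono mult_left_mono nn_integral_inverse_power_dyadic_le) auto
  finally show ?thesis .
qed

lemma le_suminf_ennreal:
  fixes a :: "nat \<Rightarrow> ennreal"
  shows "a j \<le> suminf a"
  using sum_le_suminf[of a "{j}"] by simp

lemma norm_powr_le_dyadic_suminf:
  fixes w :: "'a::real_normed_vector" and \<gamma> R :: real
  assumes \<gamma>: "0 \<le> \<gamma>" and R: "0 < R"
  shows "indicator (ball 0 R) w * ennreal (norm w powr (- \<gamma>))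
    \<le> (\<Sum>k. ennreal ((R * (1/2) ^ Suc k) powr (- \<gamma>)) * indicator (ball 0 (R * (1/2) ^ k)) w)"
proof (cases "w \<in> ball 0 R \<and> w \<noteq> 0")
  case True
  have "(\<lambda>k. R * (1/2) ^ k) \<longlonglongrightarrow> R * 0" by (intro tendsto_intros LIMSEQ_realpow_zero) auto
  then have "\<forall>\<^sub>F k in sequentially. R * (1/2) ^ k < norm w"
    by (rule order_tendstoD(2)) (use True in auto)
  then have ex: "\<exists>k. R * (1/2) ^ k \<le> norm w"
    by (auto simp: eventually_sequentially intro: less_imp_le)
  define k where "k = (LEAST k. R * (1/2) ^ k \<le> norm w)"
  have k: "R * (1/2) ^ k \<le> norm w" unfolding k_def using ex by (rule LeastI_ex)
  have "k \<noteq> 0" by (rule notI) (use k True in simp)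
  then obtain j where j: "k = Suc j" by (cases k) auto
  have "norm w < R * (1/2) ^ j"
    using not_less_Least[of j "\<lambda>k. R * (1/2) ^ k \<le> norm w"] j by (auto simp: k_def)
  moreover have "norm w powr (- \<gamma>) \<le> (R * (1/2) ^ Suc j) powr (- \<gamma>)"
    using k R \<gamma> unfolding j by (intro powr_mono2') auto
  ultimately have "indicator (ball 0 R) w * ennreal (norm w powr (- \<gamma>))
      \<le> ennreal ((R * (1/2) ^ Suc j) powr (- \<gamma>)) * indicator (ball 0 (R * (1/2) ^ j)) w"
    using True by (simp add: ennreal_leI)
  also have "\<dots> \<le> (\<Sum>k. ennreal ((R * (1/2) ^ Suc k) powr (- \<gamma>))
      * indicator (ball 0 (R * (1/2) ^ k)) w)"
    by (rule le_suminf_ennreal)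
  finally show ?thesis .
next
  case False
  then have "indicator (ball 0 R) w * ennreal (norm w powr (- \<gamma>)) = 0" by (cases "w = 0") auto
  then show ?thesis by (metis zero_le)
qed

lemma nn_integral_norm_powr_ball_finite:
  fixes \<gamma> R :: real
  assumes \<gamma>: "0 \<le> \<gamma>" "\<gamma> < real DIM('a::euclidean_space)" and R: "0 < R"
  shows "(\<integral>\<^sup>+w. indicator (ball 0 R) w * ennreal (norm w powr (- \<gamma>)) \<partial>(lborel :: 'a measure)) < \<infinity>"
proof -
  define q where "q = 2 powr \<gamma> * (1/2) ^ DIM('a)"
  have "2 powr \<gamma> < 2 powr real DIM('a)" using \<gamma> by (intro powr_less_mono) auto
  then have q: "0 \<le> q" "q < 1" by (simp_all add: q_def powr_realpow field_simps power_divide)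
  define C where "C = unit_ball_vol (real DIM('a)) * R ^ DIM('a) * (R / 2) powr (- \<gamma>)"
  have C: "C \<ge> 0" using R by (simp add: C_def)
  have dyadic_term: "(R * (1/2) ^ Suc k) powr (- \<gamma>)
      * (unit_ball_vol (real DIM('a)) * (R * (1/2) ^ k) ^ DIM('a)) = C * q ^ k" for k
  proof -
    have "(R * (1/2) ^ Suc k) powr (- \<gamma>) = ((R / 2) * (1/2) ^ k) powr (- \<gamma>)" by simp
    also have "\<dots> = (R / 2) powr (- \<gamma>) * ((1/2) ^ k) powr (- \<gamma>)" using R by (simp only: powr_mult)
    also have "(1/2::real) ^ k = 2 powr (- real k)"
      by (simp add: powr_minus powr_realpow power_one_over inverse_eq_divide)
    also have "(2 powr (- real k)) powr (- \<gamma>) = (2 powr \<gamma>) ^ k"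
      by (simp add: powr_powr powr_power mult.commute)
    finally have "(R * (1/2) ^ Suc k) powr (- \<gamma>) = (R / 2) powr (- \<gamma>) * (2 powr \<gamma>) ^ k" .
    then show ?thesis
      by (simp add: C_def q_def power_mult_distrib power_commutes mult_ac flip: power_mult)
  qed
  have "(\<integral>\<^sup>+w. indicator (ball 0 R) w * ennreal (norm w powr (- \<gamma>)) \<partial>(lborel :: 'a measure))
      \<le> (\<integral>\<^sup>+w. (\<Sum>k. ennreal ((R * (1/2) ^ Suc k) powr (- \<gamma>))
          * indicator (ball 0 (R * (1/2) ^ k)) w) \<partial>(lborel :: 'a measure))"
    by (intro nn_integral_mono norm_powr_le_dyadic_suminf \<gamma> R)
  also have "\<dots> = (\<Sum>k. \<integral>\<^sup>+w. ennreal ((R * (1/2) ^ Suc k) powr (- \<gamma>))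
      * indicator (ball 0 (R * (1/2) ^ k)) w \<partial>(lborel :: 'a measure))"
    by (rule nn_integral_suminf,
        intro borel_measurable_times_ennreal borel_measurable_const borel_measurable_indicator) simp
  also have "\<dots> = (\<Sum>k. ennreal (C * q ^ k))"
    using R by (intro suminf_cong) (simp add: nn_integral_cmult_indicator emeasure_ball
        dyadic_term[simplified] flip: ennreal_mult)
  also have "\<dots> < \<infinity>"
    using q C by (subst suminf_ennreal2) (auto intro!: summable_mult summable_geometric)
  finally show ?thesis .
qed

lemma nn_integral_lborel_translate:
  fixes f :: "'a::euclidean_space \<Rightarrow> ennreal"
  assumes "f \<in> borel_measurable borel"
  shows "(\<integral>\<^sup>+y. f (y - x) \<partial>lborel) = (\<integral>\<^sup>+w. f w \<partial>lborel)"
proof -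
  have "(\<integral>\<^sup>+w. f w \<partial>lborel) = (\<integral>\<^sup>+w. f w \<partial>distr lborel borel ((+) (- x)))"
    by (simp add: lborel_distr_plus)
  also have "\<dots> = (\<integral>\<^sup>+y. f (- x + y) \<partial>lborel)"
    using assms by (intro nn_integral_distr) auto
  finally show ?thesis by simp
qed

lemma nn_integral_lebesgue_on_eq_lborel:
  assumes "S \<in> sets borel"
  shows "(\<integral>\<^sup>+x. f x \<partial>lebesgue_on S) = (\<integral>\<^sup>+x. f x * indicator S x \<partial>lborel)"
  using assms by (simp add: nn_integral_restrict_space nn_integral_completion)

context bounded_domain
begin

lemma nn_integral_riesz_kernel_powr_bounded:
  assumes S: "0 \<le> S" "(real DIM('a) - 1) * S < real DIM('a)"
  obtains C where "0 \<le> C"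
    "\<And>x. x \<in> \<Omega> \<Longrightarrow> (\<integral>\<^sup>+y. ennreal (riesz_kernel (x - y) powr S) \<partial>M) \<le> ennreal C"
proof -
  obtain R where R: "R > 0" "\<Omega> \<subseteq> ball 0 R" using bounded_\<Omega> bounded_subset_ballD by blast
  define \<gamma> where "\<gamma> = (real DIM('a) - 1) * S"
  have \<gamma>: "0 \<le> \<gamma>" "\<gamma> < real DIM('a)" using S DIM_positive[where 'a='a] by (auto simp: \<gamma>_def)
  have kernel_powr: "riesz_kernel w powr S = norm w powr (- \<gamma>)" for w :: 'a
    by (simp add: riesz_kernel_def powr_powr \<gamma>_def algebra_simps)
  let ?F = "\<lambda>w::'a. indicator (ball 0 (2*R)) w * ennreal (norm w powr (- \<gamma>))"
  have F_measurable: "?F \<in> borel_measurable borel"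
    by (intro borel_measurable_times_ennreal borel_measurable_indicator) auto
  have "(\<integral>\<^sup>+w. ?F w \<partial>lborel) < \<infinity>" using R by (intro nn_integral_norm_powr_ball_finite \<gamma>) auto
  then obtain C where C: "C \<ge> 0" "(\<integral>\<^sup>+w. ?F w \<partial>lborel) = ennreal C"
    by (cases "\<integral>\<^sup>+w. ?F w \<partial>lborel") auto
  have "(\<integral>\<^sup>+y. ennreal (riesz_kernel (x - y) powr S) \<partial>M) \<le> ennreal C" if x: "x \<in> \<Omega>" for x
  proof -
    have "(\<integral>\<^sup>+y. ennreal (riesz_kernel (x - y) powr S) \<partial>M)
        = (\<integral>\<^sup>+y. ennreal (riesz_kernel (x - y) powr S) * indicator \<Omega> y \<partial>lborel)"
      using open_\<Omega> by (intro nn_integral_lebesgue_on_eq_lborel) auto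
    also have "\<dots> \<le> (\<integral>\<^sup>+y. ?F (y - x) \<partial>lborel)"
    proof (rule nn_integral_mono)
      fix y
      have "norm (y - x) < 2 * R" if "y \<in> \<Omega>"
      proof -
        have "norm y < R" "norm x < R" using R(2) x that by auto
        then show ?thesis using norm_triangle_ineq4[of y x] by linarith
      qed
      then show "ennreal (riesz_kernel (x - y) powr S) * indicator \<Omega> y \<le> ?F (y - x)"
        by (auto simp: indicator_def kernel_powr norm_minus_commute)
    qed
    also have "\<dots> = ennreal C" using C(2) nn_integral_lborel_translate[OF F_measurable] by simp
    finally show ?thesis .
  qed
  with C(1) show ?thesis by (rule that)
qed

section \<open>The potential estimate\<close>

sublocale domain_pair: pair_sigma_finite M M ..

lemma ident_measurable: "(\<lambda>x. x) \<in> borel_measurable M"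
  by (intro continuous_on_UNIV_imp_measurable_lebesgue_on continuous_on_id)

lemma diff_kernel_measurable:
  assumes k: "k \<in> borel_measurable borel"
  shows "(\<lambda>z. k (fst z - snd z)) \<in> borel_measurable (M \<Otimes>\<^sub>M M)"
    "(\<lambda>z. k (snd z - fst z)) \<in> borel_measurable (M \<Otimes>\<^sub>M M)"
    "(\<lambda>y. k (x - y)) \<in> borel_measurable M" "(\<lambda>y. k (y - x)) \<in> borel_measurable M"
proof -
  note fst_snd = measurable_compose[OF measurable_fst ident_measurable]
    measurable_compose[OF measurable_snd ident_measurable]
  show "(\<lambda>z. k (fst z - snd z)) \<in> borel_measurable (M \<Otimes>\<^sub>M M)"
    "(\<lambda>z. k (snd z - fst z)) \<in> borel_measurable (M \<Otimes>\<^sub>M M)"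
    by (intro measurable_compose[OF borel_measurable_diff k] fst_snd)+
  show "(\<lambda>y. k (x - y)) \<in> borel_measurable M" "(\<lambda>y. k (y - x)) \<in> borel_measurable M"
    by (intro measurable_compose[OF borel_measurable_diff k] ident_measurable
        borel_measurable_const)+
qed

lemmas riesz_kernel_diff_measurable [measurable] =
  diff_kernel_measurable[OF riesz_kernel_measurable]

lemma nn_integral_symmetric_convolution_le:
  fixes k :: "'a \<Rightarrow> ennreal"
  assumes k: "k \<in> borel_measurable borel" and symmetric: "\<And>z. k (- z) = k z"
    and bound: "\<And>x. x \<in> \<Omega> \<Longrightarrow> (\<integral>\<^sup>+y. k (x - y) \<partial>M) \<le> C"
    and [measurable]: "G \<in> borel_measurable M"
  shows "(\<integral>\<^sup>+x. \<integral>\<^sup>+y. G y * k (x - y) \<partial>M \<partial>M) \<le> C * (\<integral>\<^sup>+y. G y \<partial>M)"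
proof -
  note [measurable] = diff_kernel_measurable[OF k]
  have "k (x - y) = k (y - x)" for x y using symmetric[of "x - y"] by simp
  then have "(\<integral>\<^sup>+x. \<integral>\<^sup>+y. G y * k (x - y) \<partial>M \<partial>M) = (\<integral>\<^sup>+x. \<integral>\<^sup>+y. G y * k (y - x) \<partial>M \<partial>M)"
    by simp
  also have "\<dots> = (\<integral>\<^sup>+y. \<integral>\<^sup>+x. G y * k (y - x) \<partial>M \<partial>M)"
    by (rule domain_pair.Fubini') measurable
  also have "\<dots> = (\<integral>\<^sup>+y. G y * (\<integral>\<^sup>+x. k (y - x) \<partial>M) \<partial>M)"
    by (intro nn_integral_cong nn_integral_cmult) measurable
  also have "\<dots> \<le> (\<integral>\<^sup>+y. G y * C \<partial>M)"
    using bound by (intro nn_integral_mono mult_left_mono) auto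
  also have "\<dots> = C * (\<integral>\<^sup>+y. G y \<partial>M)"
    by (subst nn_integral_multc) (auto simp: mult.commute)
  finally show ?thesis .
qed

definition potential :: "('a \<Rightarrow> 'b::real_normed_vector) \<Rightarrow> 'a \<Rightarrow> ennreal" where
  "potential g x = (\<integral>\<^sup>+y. ennreal (norm (g y)) * ennreal (riesz_kernel (x - y)) \<partial>M)"

lemma potential_measurable [measurable (raw)]:
  assumes [measurable]: "g \<in> borel_measurable M"
  shows "potential g \<in> borel_measurable M"
  unfolding potential_def[abs_def] by measurable

lemma potential_eq_0:
  assumes "AE x in M. g x = 0"
  shows "potential g x = 0"
proof -
  have "potential g x = (\<integral>\<^sup>+y. 0 \<partial>M)"
    unfolding potential_def using assms by (intro nn_integral_cong_AE) auto
  then show ?thesis by simp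
qed

lemma potential_add_le:
  assumes [measurable]: "g \<in> borel_measurable M" "h \<in> borel_measurable M"
  shows "potential (\<lambda>x. g x + h x) x \<le> potential g x + potential h x"
proof -
  have "potential (\<lambda>x. g x + h x) x \<le> (\<integral>\<^sup>+y. ennreal (norm (g y)) * ennreal (riesz_kernel (x - y))
      + ennreal (norm (h y)) * ennreal (riesz_kernel (x - y)) \<partial>M)"
    unfolding potential_def
    by (intro nn_integral_mono) (auto simp flip: distrib_right ennreal_plus
        intro!: mult_right_mono ennreal_leI norm_triangle_ineq)
  also have "\<dots> = potential g x + potential h x"
    unfolding potential_def by (rule nn_integral_add) measurable
  finally show ?thesis .
qed

lemma nn_integral_potential_bounded:
  obtains C where "0 \<le> C" "\<And>g :: 'a \<Rightarrow> 'b::real_normed_vector. g \<in> borel_measurable M \<Longrightarrow>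
    (\<integral>\<^sup>+x. potential g x \<partial>M) \<le> ennreal C * (\<integral>\<^sup>+y. ennreal (norm (g y)) \<partial>M)"
proof -
  obtain C where C: "0 \<le> C"
    "\<And>x. x \<in> \<Omega> \<Longrightarrow> (\<integral>\<^sup>+y. ennreal (riesz_kernel (x - y) powr 1) \<partial>M) \<le> ennreal C"
    using nn_integral_riesz_kernel_powr_bounded[of 1] by auto
  show ?thesis
  proof (rule that[OF C(1)])
    fix g :: "'a \<Rightarrow> 'b" assume [measurable]: "g \<in> borel_measurable M"
    show "(\<integral>\<^sup>+x. potential g x \<partial>M) \<le> ennreal C * (\<integral>\<^sup>+y. ennreal (norm (g y)) \<partial>M)"
      unfolding potential_def using C(2)
      by (intro nn_integral_symmetric_convolution_le[of "\<lambda>z. ennreal (riesz_kernel z)"])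
        (auto simp: riesz_kernel_minus riesz_kernel_nonneg)
  qed
qed

lemma ray_leaves_domain:
  assumes "\<Omega> \<subseteq> ball 0 R" "x \<in> \<Omega>" "1/2 < norm z"
  shows "x + (4 * R) *\<^sub>R z \<notin> \<Omega>"
proof -
  have R: "norm x < R" using assms(1,2) by auto
  then have "0 \<le> R" using norm_ge_zero[of x] by linarith
  then have "R = 4 * R * (1/2) - R" "4 * R * (1/2) \<le> 4 * R * norm z"
    using assms(3) by (simp, intro mult_left_mono) auto
  moreover have "norm ((4 * R) *\<^sub>R z) - norm x \<le> norm (x + (4 * R) *\<^sub>R z)"
    by (metis add.commute norm_diff_ineq)
  ultimately have "R \<le> norm (x + (4 * R) *\<^sub>R z)"
    using R \<open>0 \<le> R\<close> by simp
  then show ?thesis using assms(1) by auto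
qed

lemma test_fun_le_ray_integral:
  assumes \<phi>: "test_fun \<Omega> \<phi>" and R: "\<Omega> \<subseteq> ball 0 R" and x: "x \<in> \<Omega>" and z: "z \<in> half_annulus"
  shows "ennreal \<bar>\<phi> x\<bar>
    \<le> (\<integral>\<^sup>+t. indicator {0<..4*R} t * ennreal (norm (grad \<phi> (x + t *\<^sub>R z))) \<partial>lborel)"
proof -
  note D = test_fun_has_frechet_derivative[OF \<phi>]
  have "norm x < R" using R x by auto
  then have "0 < R" using norm_ge_zero[of x] by linarith
  define F where "F t = grad \<phi> (x + t *\<^sub>R z) \<bullet> z" for t
  have F: "continuous_on {0..4*R} F" unfolding F_def
    by (intro continuous_intros continuous_on_compose2[OF
          smooth_on_imp_continuous_on_grad[OF test_fun_imp_smooth_on[OF \<phi>]]]) auto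
  have "((\<lambda>t. \<phi> (x + t *\<^sub>R z)) has_vector_derivative F t) (at t within {0..4*R})" for t
  proof -
    have "((\<lambda>t. \<phi> (x + t *\<^sub>R z)) has_derivative
        (\<lambda>s. frechet_derivative \<phi> (at (x + t *\<^sub>R z)) (s *\<^sub>R z))) (at t within {0..4*R})"
      by (rule has_derivative_compose[where g=\<phi>, OF _ D]) (auto intro!: derivative_eq_intros)
    then show ?thesis
      by (simp add: has_vector_derivative_def F_def frechet_derivative_eq_inner_grad[OF D])
  qed
  then have "has_bochner_integral lborel (\<lambda>t. indicator {0..4*R} t *\<^sub>R F t)
      (\<phi> (x + (4*R) *\<^sub>R z) - \<phi> (x + 0 *\<^sub>R z))"
    using \<open>0 < R\<close> F by (intro has_bochner_integral_FTC_Icc) auto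
  moreover have "\<phi> (x + (4*R) *\<^sub>R z) = 0"
    using z by (intro test_fun_eq_0[OF \<phi>] ray_leaves_domain R x) (simp add: half_annulus_def)
  ultimately have "ennreal \<bar>\<phi> x\<bar> \<le> (\<integral>\<^sup>+t. norm (indicator {0..4*R} t *\<^sub>R F t) \<partial>lborel)"
    using has_bochner_integral_norm_bound by fastforce
  also have "\<dots> \<le> (\<integral>\<^sup>+t. indicator {0<..4*R} t * ennreal (norm (grad \<phi> (x + t *\<^sub>R z))) \<partial>lborel)"
  proof (rule nn_integral_mono_AE)
    have "\<bar>F t\<bar> \<le> norm (grad \<phi> (x + t *\<^sub>R z)) * norm z" for t
      unfolding F_def by (rule Cauchy_Schwarz_ineq2)
    also have "\<dots> t \<le> norm (grad \<phi> (x + t *\<^sub>R z))" for t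
      using z by (simp add: mult_left_le half_annulus_def)
    finally have F_le: "\<bar>F t\<bar> \<le> norm (grad \<phi> (x + t *\<^sub>R z))" for t .
    have "AE t in lborel. t \<noteq> (0::real)" by (rule AE_lborel_singleton)
    then show "AE t in lborel. ennreal (norm (indicator {0..4*R} t *\<^sub>R F t))
        \<le> indicator {0<..4*R} t * ennreal (norm (grad \<phi> (x + t *\<^sub>R z)))"
      by eventually_elim (use F_le in \<open>auto simp: indicator_def intro: ennreal_leI\<close>)
  qed
  finally show ?thesis .
qed

lemma test_fun_le_potential:
  assumes \<phi>: "test_fun \<Omega> \<phi>" and x: "x \<in> \<Omega>"
  shows "ennreal (half_annulus_vol TYPE('a)) * ennreal \<bar>\<phi> x\<bar> \<le> potential (grad \<phi>) x"
proof -
  let ?n = "\<lambda>y. ennreal (norm (grad \<phi> y))"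
  have "continuous_on UNIV (grad \<phi>)"
    by (intro smooth_on_imp_continuous_on_grad test_fun_imp_smooth_on[OF \<phi>])
  then have [measurable]: "grad \<phi> \<in> borel_measurable borel"
    by (rule borel_measurable_continuous_onI)
  obtain R where R: "\<Omega> \<subseteq> ball 0 R" using bounded_\<Omega> bounded_subset_ballD by blast
  have "ennreal (half_annulus_vol TYPE('a)) * ennreal \<bar>\<phi> x\<bar>
      = (\<integral>\<^sup>+z. ennreal \<bar>\<phi> x\<bar> * indicator (half_annulus :: 'a set) z \<partial>lborel)"
    by (subst nn_integral_cmult_indicator) (simp_all add: emeasure_half_annulus mult.commute)
  also have "\<dots> \<le> (\<integral>\<^sup>+z. indicator half_annulus z *
      (\<integral>\<^sup>+t. indicator {0<..4*R} t * ?n (x + t *\<^sub>R z) \<partial>lborel) \<partial>lborel)"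
    using test_fun_le_ray_integral[OF \<phi> R x]
    by (intro nn_integral_mono) (auto simp: indicator_def)
  also have "\<dots> \<le> (\<integral>\<^sup>+y. ?n y * ennreal (riesz_kernel (x - y)) \<partial>lborel)"
    by (rule nn_integral_rays_le_riesz_kernel[of ?n]) measurable
  also have "\<dots> = potential (grad \<phi>) x"
    unfolding potential_def using open_\<Omega> test_fun_grad_eq_0[OF \<phi>]
    by (subst nn_integral_lebesgue_on_eq_lborel) (auto intro!: nn_integral_cong simp: indicator_def)
  finally show ?thesis .
qed

lemma nn_integral_excess_over_potential_le:
  fixes u :: "'a \<Rightarrow> real" and g :: "'a \<Rightarrow> 'a"
  defines "A \<equiv> ennreal (half_annulus_vol TYPE('a))"
  assumes \<phi>: "test_fun \<Omega> \<phi>" and [measurable]: "u \<in> borel_measurable M" "g \<in> borel_measurable M"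
  shows "(\<integral>\<^sup>+x. A * ennreal \<bar>u x\<bar> - potential g x \<partial>M)
    \<le> A * (\<integral>\<^sup>+x. ennreal (norm (\<phi> x - u x)) \<partial>M) + (\<integral>\<^sup>+x. potential (\<lambda>x. grad \<phi> x - g x) x \<partial>M)"
proof -
  note [measurable] = test_fun_measurable[OF \<phi>]
  have "A * ennreal \<bar>u x\<bar> - potential g x
      \<le> A * ennreal (norm (\<phi> x - u x)) + potential (\<lambda>x. grad \<phi> x - g x) x" if x: "x \<in> \<Omega>" for x
  proof -
    have "ennreal \<bar>u x\<bar> \<le> ennreal (norm (\<phi> x - u x)) + ennreal \<bar>\<phi> x\<bar>"
      by (auto simp flip: ennreal_plus intro!: ennreal_leI)
    then have "A * ennreal \<bar>u x\<bar> \<le> A * ennreal (norm (\<phi> x - u x)) + A * ennreal \<bar>\<phi> x\<bar>"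
      by (metis distrib_left mult_left_mono zero_le)
    also have "A * ennreal \<bar>\<phi> x\<bar> \<le> potential (grad \<phi>) x"
      unfolding A_def by (rule test_fun_le_potential[OF \<phi> x])
    also have "potential (grad \<phi>) x \<le> potential (\<lambda>x. grad \<phi> x - g x) x + potential g x"
      using potential_add_le[of "\<lambda>x. grad \<phi> x - g x" g x] by simp
    finally show ?thesis
      by (auto simp: A_def ennreal_minus_le_iff add_ac ennreal_mult_eq_top_iff)
  qed
  then have "(\<integral>\<^sup>+x. A * ennreal \<bar>u x\<bar> - potential g x \<partial>M)
      \<le> (\<integral>\<^sup>+x. A * ennreal (norm (\<phi> x - u x)) + potential (\<lambda>x. grad \<phi> x - g x) x \<partial>M)"
    by (intro nn_integral_mono) simp
  also have "\<dots> = A * (\<integral>\<^sup>+x. ennreal (norm (\<phi> x - u x)) \<partial>M)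
      + (\<integral>\<^sup>+x. potential (\<lambda>x. grad \<phi> x - g x) x \<partial>M)"
    by (simp add: nn_integral_add nn_integral_cmult)
  finally show ?thesis .
qed

end

lemma (in exponent_on_domain) W0_grad_le_potential:
  assumes u: "W0_grad \<Omega> p u g"
  shows "AE x in M. ennreal (half_annulus_vol TYPE('a)) * ennreal \<bar>u x\<bar> \<le> potential g x"
proof -
  let ?A = "ennreal (half_annulus_vol TYPE('a))"
  note [measurable] = W0_gradD(4,5)[OF u]
  obtain \<phi> where \<phi>: "\<And>k. test_fun \<Omega> (\<phi> k)"
    and lim: "L1_tendsto M \<phi> u" "L1_tendsto M (\<lambda>k. grad (\<phi> k)) g"
    using W0_grad_L1_approx[OF u] by blast
  note [measurable] = test_fun_measurable[OF \<phi>]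
  obtain C where C: "\<And>g :: 'a \<Rightarrow> 'a. g \<in> borel_measurable M \<Longrightarrow>
      (\<integral>\<^sup>+x. potential g x \<partial>M) \<le> ennreal C * (\<integral>\<^sup>+y. ennreal (norm (g y)) \<partial>M)"
    using nn_integral_potential_bounded by blast
  have "(\<integral>\<^sup>+x. ?A * ennreal \<bar>u x\<bar> - potential g x \<partial>M)
      \<le> ?A * (\<integral>\<^sup>+x. ennreal (norm (\<phi> k x - u x)) \<partial>M)
        + ennreal C * (\<integral>\<^sup>+x. ennreal (norm (grad (\<phi> k) x - g x)) \<partial>M)" for k
  proof -
    have "(\<integral>\<^sup>+x. ?A * ennreal \<bar>u x\<bar> - potential g x \<partial>M)
        \<le> ?A * (\<integral>\<^sup>+x. ennreal (norm (\<phi> k x - u x)) \<partial>M)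
          + (\<integral>\<^sup>+x. potential (\<lambda>x. grad (\<phi> k) x - g x) x \<partial>M)"
      by (rule nn_integral_excess_over_potential_le[OF \<phi>]) measurable
    also have "(\<integral>\<^sup>+x. potential (\<lambda>x. grad (\<phi> k) x - g x) x \<partial>M)
        \<le> ennreal C * (\<integral>\<^sup>+x. ennreal (norm (grad (\<phi> k) x - g x)) \<partial>M)"
      by (rule C) measurable
    finally show ?thesis by (simp add: add_left_mono)
  qed
  moreover have "(\<lambda>k. ?A * (\<integral>\<^sup>+x. ennreal (norm (\<phi> k x - u x)) \<partial>M)
      + ennreal C * (\<integral>\<^sup>+x. ennreal (norm (grad (\<phi> k) x - g x)) \<partial>M)) \<longlonglongrightarrow> ?A * 0 + ennreal C * 0"
    using lim unfolding L1_tendsto_def by (intro tendsto_intros) auto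
  ultimately have "(\<integral>\<^sup>+x. ?A * ennreal \<bar>u x\<bar> - potential g x \<partial>M) \<le> 0"
    by (intro LIMSEQ_le_const) auto
  then have "AE x in M. ?A * ennreal \<bar>u x\<bar> - potential g x = 0"
    by (simp add: nn_integral_0_iff_AE)
  then show ?thesis
    by eventually_elim (auto simp: diff_eq_0_iff_ennreal)
qed

section \<open>A trilinear estimate\<close>

definition one_plus_powr :: "real \<Rightarrow> real \<Rightarrow> real" where
  "one_plus_powr t a = 1 + t powr a"

lemma one_plus_powr_ge_1: "1 \<le> one_plus_powr t a"
  by (simp add: one_plus_powr_def)

lemma le_one_plus_powr_root:
  assumes "0 \<le> t" "0 < a"
  shows "t \<le> one_plus_powr t a powr (1 / a)"
proof -
  have "t = (t powr a) powr (1 / a)" using assms by (simp add: powr_powr)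
  also have "\<dots> \<le> one_plus_powr t a powr (1 / a)"
    unfolding one_plus_powr_def using assms by (intro powr_mono2) auto
  finally show ?thesis .
qed

lemma le_one_plus_powr:
  assumes "0 \<le> t" "1 \<le> a"
  shows "t \<le> one_plus_powr t a"
proof -
  have "t \<le> one_plus_powr t a powr (1 / a)" using assms by (intro le_one_plus_powr_root) auto
  also have "\<dots> \<le> one_plus_powr t a powr 1"
    using assms by (intro powr_mono one_plus_powr_ge_1) auto
  also have "\<dots> = one_plus_powr t a"
    using one_plus_powr_ge_1[of t a] by (intro powr_one) linarith
  finally show ?thesis .
qed

lemma powr_mult3_le_largest_two:
  fixes x y z r s t :: real
  assumes "1 \<le> z" "z \<le> x" "z \<le> y" "0 \<le> s" "s \<le> 1" "0 \<le> t" "t \<le> 1" "s + t + r \<le> 2"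
  shows "x powr s * y powr t * z powr r \<le> x * y"
proof -
  have "z powr r \<le> z powr ((1 - s) + (1 - t))" using assms by (intro powr_mono) auto
  also have "\<dots> = z powr (1 - s) * z powr (1 - t)" by (rule powr_add)
  also have "\<dots> \<le> x powr (1 - s) * y powr (1 - t)" using assms by (intro mult_mono powr_mono2) auto
  finally have "x powr s * y powr t * z powr r
      \<le> x powr s * y powr t * (x powr (1 - s) * y powr (1 - t))"
    by (intro mult_left_mono) auto
  also have "\<dots> = (x powr s * x powr (1 - s)) * (y powr t * y powr (1 - t))" by (simp add: mult_ac)
  also have "\<dots> = x * y" using assms by (simp flip: powr_add)
  finally show ?thesis .
qed

lemma powr_mult3_le_sum_pairwise:
  fixes x y z r s t :: real
  assumes "1 \<le> x" "1 \<le> y" "1 \<le> z"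
    and "0 \<le> s" "s \<le> 1" "0 \<le> t" "t \<le> 1" "0 \<le> r" "r \<le> 1" "s + t + r \<le> 2"
  shows "x powr s * y powr t * z powr r \<le> x * y + x * z + y * z"
proof -
  have "0 \<le> x * y" "0 \<le> x * z" "0 \<le> y * z" using assms by auto
  moreover consider "z \<le> x" "z \<le> y" | "y \<le> x" "y \<le> z" | "x \<le> y" "x \<le> z" by linarith
  then have "x powr s * y powr t * z powr r \<le> x * y \<or> x powr s * y powr t * z powr r \<le> x * z
      \<or> x powr s * y powr t * z powr r \<le> y * z"
    using powr_mult3_le_largest_two[of z x y s t r] powr_mult3_le_largest_two[of y x z s r t]
      powr_mult3_le_largest_two[of x y z t r s] assms
    by cases (simp_all add: mult_ac add_ac)
  ultimately show ?thesis by linarith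
qed

lemma trilinear_young:
  fixes h g k a q \<theta> :: real
  assumes "0 \<le> h" "0 \<le> g" "0 \<le> k" "1 < a" "1 < q" "0 < \<theta>" "\<theta> \<le> 1" "1 / a + 1 / q + \<theta> \<le> 2"
  shows "h * (g * k) \<le> one_plus_powr h a * one_plus_powr g q
    + one_plus_powr h a * one_plus_powr k (1 / \<theta>) + one_plus_powr g q * one_plus_powr k (1 / \<theta>)"
proof -
  have "h \<le> one_plus_powr h a powr (1 / a)" "g \<le> one_plus_powr g q powr (1 / q)"
    "k \<le> one_plus_powr k (1 / \<theta>) powr \<theta>"
    using le_one_plus_powr_root[of h a] le_one_plus_powr_root[of g q]
      le_one_plus_powr_root[of k "1 / \<theta>"] assms by auto
  then have "h * (g * k) \<le> one_plus_powr h a powr (1 / a) *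
      (one_plus_powr g q powr (1 / q) * one_plus_powr k (1 / \<theta>) powr \<theta>)"
    using assms by (intro mult_mono) auto
  also have "\<dots> \<le> one_plus_powr h a * one_plus_powr g q
      + one_plus_powr h a * one_plus_powr k (1 / \<theta>) + one_plus_powr g q * one_plus_powr k (1 / \<theta>)"
    unfolding mult.assoc[symmetric] using assms
    by (intro powr_mult3_le_sum_pairwise one_plus_powr_ge_1) auto
  finally show ?thesis .
qed

lemma mult3_le_one_plus_powr:
  fixes h g k a q L :: real
  assumes "0 \<le> h" "0 \<le> g" "0 \<le> k" "k \<le> L" "1 \<le> a" "1 \<le> q"
  shows "h * (g * k) \<le> L * (one_plus_powr h a * one_plus_powr g q)"
proof -
  have "h * (g * k) \<le> one_plus_powr h a * (one_plus_powr g q * L)"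
    using assms order_trans[OF zero_le_one one_plus_powr_ge_1]
    by (intro mult_mono le_one_plus_powr) auto
  then show ?thesis by (simp add: mult_ac)
qed

lemma trilinear_constant_le:
  fixes A B I J :: ennreal and L V c :: real
  assumes I: "I \<le> ennreal V * A" and J: "J \<le> ennreal V * B" and "1 \<le> A" "1 \<le> B"
    and nonneg: "0 \<le> L" "0 \<le> V" "0 \<le> c"
  shows "ennreal L * (I * J) + I * ennreal c + J * ennreal c
    \<le> ennreal (L * (V * V) + V * c + V * c) * (A * B)"
proof -
  have AB: "A \<le> A * B" "B \<le> A * B"
    using mult_left_mono[OF \<open>1 \<le> B\<close>, of A] mult_right_mono[OF \<open>1 \<le> A\<close>, of B] by auto
  have "ennreal L * (I * J) + I * ennreal c + J * ennreal c
      \<le> ennreal L * ((ennreal V * A) * (ennreal V * B))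
        + (ennreal V * A) * ennreal c + (ennreal V * B) * ennreal c"
    by (intro add_mono mult_mono I J order_refl) auto
  also have "\<dots> = ennreal (L * (V * V)) * (A * B) + ennreal (V * c) * A + ennreal (V * c) * B"
    using nonneg by (simp add: ennreal_mult mult_ac)
  also have "\<dots> \<le> ennreal (L * (V * V)) * (A * B) + ennreal (V * c) * (A * B)
      + ennreal (V * c) * (A * B)"
    by (intro add_mono mult_left_mono AB order_refl) auto
  also have "\<dots> = ennreal (L * (V * V) + V * c + V * c) * (A * B)"
    using nonneg by (simp only: ennreal_plus add_nonneg_nonneg mult_nonneg_nonneg distrib_right)
  finally show ?thesis .
qed

context bounded_domain
begin

lemma exponent_margin:
  assumes a: "C_plus \<Omega> a" and q: "C_plus \<Omega> q"
    and subcritical: "\<And>x. x \<in> closure \<Omega> \<Longrightarrow> 1 / a x + 1 / q x < 1 + 1 / real DIM('a)"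
  obtains \<theta> d where "0 < \<theta>" "\<theta> \<le> 1" "1 - 1 / real DIM('a) < \<theta>" "0 < d"
    "\<And>x y. x \<in> \<Omega> \<Longrightarrow> y \<in> \<Omega> \<Longrightarrow> dist y x < d \<Longrightarrow> 1 / a x + 1 / q y + \<theta> \<le> 2"
proof -
  define N where "N = real DIM('a)"
  have N: "N \<ge> 1" using DIM_positive[where 'a='a] by (simp add: N_def Suc_leI)
  have inverse_continuous: "continuous_on (closure \<Omega>) (\<lambda>x. 1 / a x)"
      "continuous_on (closure \<Omega>) (\<lambda>x. 1 / q x)"
    using a q unfolding C_plus_def by (intro continuous_intros; fastforce)+
  obtain z where z: "z \<in> closure \<Omega>"
    "\<And>x. x \<in> closure \<Omega> \<Longrightarrow> 1 / a x + 1 / q x \<le> 1 / a z + 1 / q z"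
    using continuous_attains_sup[OF compact_closure_\<Omega> continuous_on_add[OF inverse_continuous]]
    by blast
  define e where "e = min (1 / N) ((1 + 1 / N - (1 / a z + 1 / q z)) / 2)"
  have e: "0 < e" "e \<le> 1 / N" "2 * e \<le> 1 + 1 / N - (1 / a z + 1 / q z)"
    using subcritical[OF z(1)] N by (auto simp: e_def N_def min_def)
  obtain d where d: "0 < d"
    "\<And>x y. x \<in> closure \<Omega> \<Longrightarrow> y \<in> closure \<Omega> \<Longrightarrow> dist y x < d \<Longrightarrow> dist (1 / q y) (1 / q x) < e"
    using compact_uniformly_continuous[OF inverse_continuous(2) compact_closure_\<Omega>(1)] e(1)
    unfolding uniformly_continuous_on_def by meson
  show ?thesis
  proof (rule that[of "1 - 1 / N + e" d])
    have "1 / N \<le> 1" using N by simp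
    then show "0 < 1 - 1 / N + e" "1 - 1 / N + e \<le> 1" "1 - 1 / real DIM('a) < 1 - 1 / N + e" "0 < d"
      using e(1,2) d(1) unfolding N_def[symmetric] by linarith+
    fix x y assume "x \<in> \<Omega>" "y \<in> \<Omega>" "dist y x < d"
    then have "x \<in> closure \<Omega>" "\<bar>1 / q y - 1 / q x\<bar> < e"
      using d(2)[of x y] closure_subset by (auto simp: dist_real_def)
    with z(2)[of x] e(3) show "1 / a x + 1 / q y + (1 - 1 / N + e) \<le> 2" by linarith
  qed
qed

lemma riesz_kernel_le_powr:
  fixes z :: 'a
  assumes "0 < d" "d \<le> norm z"
  shows "riesz_kernel z \<le> d powr (1 - real DIM('a))"
  unfolding riesz_kernel_def using assms by (intro powr_mono2') (auto simp: Suc_leI)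

lemma trilinear_pointwise_bound:
  assumes a: "C_plus \<Omega> a" and q: "C_plus \<Omega> q"
    and subcritical: "\<And>x. x \<in> closure \<Omega> \<Longrightarrow> 1 / a x + 1 / q x < 1 + 1 / real DIM('a)"
  obtains L S where "1 \<le> L" "0 < S" "(real DIM('a) - 1) * S < real DIM('a)"
    "\<And>x y h g. x \<in> \<Omega> \<Longrightarrow> y \<in> \<Omega> \<Longrightarrow> 0 \<le> h \<Longrightarrow> 0 \<le> g \<Longrightarrow> h * (g * riesz_kernel (x - y)) \<le>
       L * (one_plus_powr h (a x) * one_plus_powr g (q y))
       + one_plus_powr h (a x) * one_plus_powr (riesz_kernel (x - y)) S
       + one_plus_powr g (q y) * one_plus_powr (riesz_kernel (x - y)) S"
proof -
  obtain \<theta> d where \<theta>: "0 < \<theta>" "\<theta> \<le> 1" "1 - 1 / real DIM('a) < \<theta>" and "0 < d"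
    and near: "\<And>x y. x \<in> \<Omega> \<Longrightarrow> y \<in> \<Omega> \<Longrightarrow> dist y x < d \<Longrightarrow> 1 / a x + 1 / q y + \<theta> \<le> 2"
    using exponent_margin[OF a q subcritical] by blast
  define L where "L = 1 + d powr (1 - real DIM('a))"
  have "1 \<le> L" by (simp add: L_def)
  show ?thesis
  proof (rule that[of L "1 / \<theta>"])
    show "(real DIM('a) - 1) * (1 / \<theta>) < real DIM('a)"
      using \<theta> by (simp add: field_simps)
    fix x y and h g :: real
    assume xy: "x \<in> \<Omega>" "y \<in> \<Omega>" and hg: "0 \<le> h" "0 \<le> g"
    let ?k = "riesz_kernel (x - y)"
    let ?F = "one_plus_powr h (a x)" and ?G = "one_plus_powr g (q y)"
      and ?K = "one_plus_powr ?k (1 / \<theta>)"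
    note FGK = one_plus_powr_ge_1[of h "a x"] one_plus_powr_ge_1[of g "q y"]
      one_plus_powr_ge_1[of ?k "1 / \<theta>"]
    have gt_1: "1 < a x" "1 < q y" using a q xy closure_subset by (auto simp: C_plus_def)
    show "h * (g * ?k) \<le> L * (?F * ?G) + ?F * ?K + ?G * ?K"
    proof (cases "dist y x < d")
      case True
      have "h * (g * ?k) \<le> ?F * ?G + ?F * ?K + ?G * ?K"
        using hg gt_1 \<theta> near[OF xy True] by (intro trilinear_young riesz_kernel_nonneg) auto
      moreover have "?F * ?G \<le> L * (?F * ?G)"
        using \<open>1 \<le> L\<close> FGK mult_right_mono[of 1 L "?F * ?G"] by simp
      ultimately show ?thesis by linarith
    next
      case False
      have "h * (g * ?k) \<le> L * (?F * ?G)"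
        using hg gt_1 riesz_kernel_nonneg[of "x - y"] False
          riesz_kernel_le_powr[OF \<open>0 < d\<close>, of "x - y"]
        by (intro mult3_le_one_plus_powr) (auto simp: L_def dist_norm norm_minus_commute)
      moreover have "0 \<le> ?F * ?K" "0 \<le> ?G * ?K" using FGK by auto
      ultimately show ?thesis by linarith
    qed
  qed (use \<open>1 \<le> L\<close> \<theta> in auto)
qed

lemma nn_integral_trilinear_le:
  fixes F G K :: "'a \<Rightarrow> ennreal"
  assumes [measurable]: "F \<in> borel_measurable M" "G \<in> borel_measurable M"
    and K: "K \<in> borel_measurable borel" and symmetric: "\<And>z. K (- z) = K z"
    and bound: "\<And>x. x \<in> \<Omega> \<Longrightarrow> (\<integral>\<^sup>+y. K (x - y) \<partial>M) \<le> c"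
  shows "(\<integral>\<^sup>+x. \<integral>\<^sup>+y. L * (F x * G y) + F x * K (x - y) + G y * K (x - y) \<partial>M \<partial>M)
    \<le> L * ((\<integral>\<^sup>+x. F x \<partial>M) * (\<integral>\<^sup>+y. G y \<partial>M)) + (\<integral>\<^sup>+x. F x \<partial>M) * c + (\<integral>\<^sup>+y. G y \<partial>M) * c"
proof -
  note [measurable] = diff_kernel_measurable[OF K]
  have "(\<integral>\<^sup>+x. \<integral>\<^sup>+y. L * (F x * G y) + F x * K (x - y) + G y * K (x - y) \<partial>M \<partial>M)
    = (\<integral>\<^sup>+x. L * (F x * (\<integral>\<^sup>+y. G y \<partial>M)) + F x * (\<integral>\<^sup>+y. K (x - y) \<partial>M)
        + (\<integral>\<^sup>+y. G y * K (x - y) \<partial>M) \<partial>M)"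
    by (simp add: nn_integral_add nn_integral_cmult)
  also have "\<dots> \<le> (\<integral>\<^sup>+x. L * (F x * (\<integral>\<^sup>+y. G y \<partial>M)) + F x * c
        + (\<integral>\<^sup>+y. G y * K (x - y) \<partial>M) \<partial>M)"
    by (intro nn_integral_mono add_mono mult_left_mono bound) auto
  also have "\<dots> = L * ((\<integral>\<^sup>+x. F x \<partial>M) * (\<integral>\<^sup>+y. G y \<partial>M)) + (\<integral>\<^sup>+x. F x \<partial>M) * c
        + (\<integral>\<^sup>+x. \<integral>\<^sup>+y. G y * K (x - y) \<partial>M \<partial>M)"
    by (simp add: nn_integral_add nn_integral_cmult nn_integral_multc)
  also have "(\<integral>\<^sup>+x. \<integral>\<^sup>+y. G y * K (x - y) \<partial>M \<partial>M) \<le> (\<integral>\<^sup>+y. G y \<partial>M) * c"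
    unfolding mult.commute[of _ c]
    by (intro nn_integral_symmetric_convolution_le K symmetric bound) auto
  finally show ?thesis by (simp add: add_left_mono)
qed

lemma nn_integral_one_plus_powr_le:
  fixes v :: "'a \<Rightarrow> 'b::real_normed_vector"
  assumes [measurable]: "a \<in> borel_measurable M" "v \<in> borel_measurable M"
  shows "(\<integral>\<^sup>+x. ennreal (one_plus_powr (norm (v x)) (a x)) \<partial>M)
    \<le> ennreal (1 + measure M \<Omega>) * (1 + norm_modular \<Omega> a v)"
proof -
  let ?V = "1 + measure M \<Omega>"
  have "(\<integral>\<^sup>+x. ennreal (one_plus_powr (norm (v x)) (a x)) \<partial>M) = emeasure M \<Omega> + norm_modular \<Omega> a v"
    unfolding one_plus_powr_def modular_def by (simp add: nn_integral_add)
  also have "\<dots> \<le> ennreal ?V * 1 + ennreal ?V * norm_modular \<Omega> a v"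
    using mult_right_mono[of 1 "ennreal ?V" "norm_modular \<Omega> a v"]
    by (intro add_mono) (auto simp: emeasure_eq_measure)
  finally show ?thesis by (simp add: distrib_left)
qed

lemma nn_integral_one_plus_riesz_kernel_powr_bounded:
  assumes "0 \<le> S" "(real DIM('a) - 1) * S < real DIM('a)"
  obtains c where "0 \<le> c" "\<And>x. x \<in> \<Omega> \<Longrightarrow>
    (\<integral>\<^sup>+y. ennreal (one_plus_powr (riesz_kernel (x - y)) S) \<partial>M) \<le> ennreal c"
proof -
  obtain c where c: "0 \<le> c"
    "\<And>x. x \<in> \<Omega> \<Longrightarrow> (\<integral>\<^sup>+y. ennreal (riesz_kernel (x - y) powr S) \<partial>M) \<le> ennreal c"
    using nn_integral_riesz_kernel_powr_bounded[OF assms] by blast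
  show ?thesis
  proof (rule that)
    show "0 \<le> measure M \<Omega> + c" using c(1) by simp
    fix x assume "x \<in> \<Omega>"
    have "(\<integral>\<^sup>+y. ennreal (one_plus_powr (riesz_kernel (x - y)) S) \<partial>M)
        = ennreal (measure M \<Omega>) + (\<integral>\<^sup>+y. ennreal (riesz_kernel (x - y) powr S) \<partial>M)"
      unfolding one_plus_powr_def by (simp add: nn_integral_add emeasure_eq_measure)
    also have "\<dots> \<le> ennreal (measure M \<Omega>) + ennreal c"
      by (intro add_left_mono c(2) \<open>x \<in> \<Omega>\<close>)
    finally show "(\<integral>\<^sup>+y. ennreal (one_plus_powr (riesz_kernel (x - y)) S) \<partial>M)
        \<le> ennreal (measure M \<Omega> + c)"
      using c(1) by simp
  qed
qed

lemma C_plus_measurable: "C_plus \<Omega> a \<Longrightarrow> a \<in> borel_measurable M"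
  by (simp add: C_plus_def continuous_on_closure_imp_measurable)

lemma nn_integral_mult_potential_le:
  fixes h :: "'a \<Rightarrow> real" and g :: "'a \<Rightarrow> 'b::real_normed_vector"
  assumes pointwise: "\<And>x y h g. x \<in> \<Omega> \<Longrightarrow> y \<in> \<Omega> \<Longrightarrow> 0 \<le> h \<Longrightarrow> 0 \<le> g \<Longrightarrow>
      h * (g * riesz_kernel (x - y)) \<le> L * (one_plus_powr h (a x) * one_plus_powr g (q y))
      + one_plus_powr h (a x) * one_plus_powr (riesz_kernel (x - y)) S
      + one_plus_powr g (q y) * one_plus_powr (riesz_kernel (x - y)) S"
    and "1 \<le> L"
    and c: "\<And>x. x \<in> \<Omega> \<Longrightarrow> (\<integral>\<^sup>+y. ennreal (one_plus_powr (riesz_kernel (x - y)) S) \<partial>M) \<le> c"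
    and [measurable]: "a \<in> borel_measurable M" "q \<in> borel_measurable M"
    and [measurable]: "h \<in> borel_measurable M" "g \<in> borel_measurable M"
  defines "F \<equiv> \<lambda>x. ennreal (one_plus_powr (norm (h x)) (a x))"
    and "G \<equiv> \<lambda>y. ennreal (one_plus_powr (norm (g y)) (q y))"
  shows "(\<integral>\<^sup>+x. ennreal \<bar>h x\<bar> * potential g x \<partial>M)
    \<le> ennreal L * ((\<integral>\<^sup>+x. F x \<partial>M) * (\<integral>\<^sup>+y. G y \<partial>M))
      + (\<integral>\<^sup>+x. F x \<partial>M) * c + (\<integral>\<^sup>+y. G y \<partial>M) * c"
proof -
  define K where "K z = ennreal (one_plus_powr (riesz_kernel z) S)" for z :: 'a
  have K: "K \<in> borel_measurable borel" "K (- z) = K z" for z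
    unfolding K_def one_plus_powr_def by (measurable, simp add: riesz_kernel_minus)
  have [measurable]: "F \<in> borel_measurable M" "G \<in> borel_measurable M"
    unfolding F_def G_def one_plus_powr_def by measurable
  have "(\<integral>\<^sup>+x. ennreal \<bar>h x\<bar> * potential g x \<partial>M) = (\<integral>\<^sup>+x. \<integral>\<^sup>+y. ennreal \<bar>h x\<bar> *
      (ennreal (norm (g y)) * ennreal (riesz_kernel (x - y))) \<partial>M \<partial>M)"
    unfolding potential_def by (intro nn_integral_cong nn_integral_cmult[symmetric]) measurable
  also have "\<dots> \<le> (\<integral>\<^sup>+x. \<integral>\<^sup>+y. ennreal L * (F x * G y) + F x * K (x - y) + G y * K (x - y) \<partial>M \<partial>M)"
  proof (intro nn_integral_mono)
    fix x y assume "x \<in> space M" "y \<in> space M"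
    then show "ennreal \<bar>h x\<bar> * (ennreal (norm (g y)) * ennreal (riesz_kernel (x - y)))
        \<le> ennreal L * (F x * G y) + F x * K (x - y) + G y * K (x - y)"
      using pointwise[of x y "norm (h x)" "norm (g y)"] \<open>1 \<le> L\<close> riesz_kernel_nonneg[of "x - y"]
        order_trans[OF zero_le_one one_plus_powr_ge_1]
      unfolding F_def G_def K_def by (simp flip: ennreal_mult ennreal_plus)
  qed
  also have "\<dots> \<le> ennreal L * ((\<integral>\<^sup>+x. F x \<partial>M) * (\<integral>\<^sup>+y. G y \<partial>M))
      + (\<integral>\<^sup>+x. F x \<partial>M) * c + (\<integral>\<^sup>+y. G y \<partial>M) * c"
    by (intro nn_integral_trilinear_le K c[folded K_def]) measurable
  finally show ?thesis .
qed

lemma nn_integral_mult_potential_bounded: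
  assumes a: "C_plus \<Omega> a" and q: "C_plus \<Omega> q"
    and subcritical: "\<And>x. x \<in> closure \<Omega> \<Longrightarrow> 1 / a x + 1 / q x < 1 + 1 / real DIM('a)"
  obtains C where "0 \<le> C"
    "\<And>(h :: 'a \<Rightarrow> real) (g :: 'a \<Rightarrow> 'b::real_normed_vector).
      h \<in> borel_measurable M \<Longrightarrow> g \<in> borel_measurable M \<Longrightarrow>
      (\<integral>\<^sup>+x. ennreal \<bar>h x\<bar> * potential g x \<partial>M)
        \<le> ennreal C * ((1 + modular \<Omega> a h) * (1 + norm_modular \<Omega> q g))"
proof -
  obtain L S where L: "1 \<le> L" and S: "0 < S" "(real DIM('a) - 1) * S < real DIM('a)"
    and pointwise: "\<And>x y h g. x \<in> \<Omega> \<Longrightarrow> y \<in> \<Omega> \<Longrightarrow> 0 \<le> h \<Longrightarrow> 0 \<le> g \<Longrightarrow>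
       h * (g * riesz_kernel (x - y)) \<le> L * (one_plus_powr h (a x) * one_plus_powr g (q y))
       + one_plus_powr h (a x) * one_plus_powr (riesz_kernel (x - y)) S
       + one_plus_powr g (q y) * one_plus_powr (riesz_kernel (x - y)) S"
    using trilinear_pointwise_bound[OF a q subcritical] by blast
  obtain c where c: "0 \<le> c"
    "\<And>x. x \<in> \<Omega> \<Longrightarrow> (\<integral>\<^sup>+y. ennreal (one_plus_powr (riesz_kernel (x - y)) S) \<partial>M) \<le> ennreal c"
    using nn_integral_one_plus_riesz_kernel_powr_bounded[of S] S by auto
  note measurable_exponents = C_plus_measurable[OF a] C_plus_measurable[OF q]
  define V where "V = 1 + measure M \<Omega>"
  have V: "0 \<le> V" by (simp add: V_def)
  show ?thesis
  proof (rule that)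
    show "0 \<le> L * (V * V) + V * c + V * c" using L V c(1) by simp
    fix h :: "'a \<Rightarrow> real" and g :: "'a \<Rightarrow> 'b"
    assume h: "h \<in> borel_measurable M" and g: "g \<in> borel_measurable M"
    have "(\<integral>\<^sup>+x. ennreal (one_plus_powr (norm (h x)) (a x)) \<partial>M) \<le> ennreal V * (1 + modular \<Omega> a h)"
      "(\<integral>\<^sup>+y. ennreal (one_plus_powr (norm (g y)) (q y)) \<partial>M)
        \<le> ennreal V * (1 + norm_modular \<Omega> q g)"
      using nn_integral_one_plus_powr_le[OF measurable_exponents(1) h]
        nn_integral_one_plus_powr_le[OF measurable_exponents(2) g] by (simp_all add: V_def)
    note trilinear_constant_le[OF this _ _ _ V c(1)]
    with nn_integral_mult_potential_le[OF pointwise L c(2) measurable_exponents h g]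
    show "(\<integral>\<^sup>+x. ennreal \<bar>h x\<bar> * potential g x \<partial>M)
        \<le> ennreal (L * (V * V) + V * c + V * c)
          * ((1 + modular \<Omega> a h) * (1 + norm_modular \<Omega> q g))"
      by (rule order_trans) (use L in auto)
  qed
qed

end

section \<open>The pairing estimate and the Poincare inequality\<close>

context exponent_on_domain
begin

lemma nn_integral_mult_W0_le_potential:
  fixes h :: "'a \<Rightarrow> real"
  assumes [measurable]: "h \<in> borel_measurable M" and u: "W0_grad \<Omega> p u g"
  shows "(\<integral>\<^sup>+x. ennreal \<bar>h x * u x\<bar> \<partial>M)
    \<le> ennreal (1 / half_annulus_vol TYPE('a)) * (\<integral>\<^sup>+x. ennreal \<bar>h x\<bar> * potential g x \<partial>M)"
proof -
  define A where "A = half_annulus_vol TYPE('a)"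
  have "0 < A" using half_annulus_vol_pos by (simp add: A_def)
  note [measurable] = W0_gradD(4,5)[OF u]
  have "AE x in M. ennreal \<bar>h x * u x\<bar> \<le> ennreal (1 / A) * (ennreal \<bar>h x\<bar> * potential g x)"
    using W0_grad_le_potential[OF u]
  proof eventually_elim
    case (elim x)
    have "ennreal \<bar>h x * u x\<bar> = ennreal (1 / A) * (ennreal \<bar>h x\<bar> * (ennreal A * ennreal \<bar>u x\<bar>))"
      using \<open>0 < A\<close> by (simp add: abs_mult flip: ennreal_mult)
    also have "\<dots> \<le> ennreal (1 / A) * (ennreal \<bar>h x\<bar> * potential g x)"
      using elim by (intro mult_left_mono) (auto simp: A_def)
    finally show ?case .
  qed
  then have "(\<integral>\<^sup>+x. ennreal \<bar>h x * u x\<bar> \<partial>M)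
      \<le> (\<integral>\<^sup>+x. ennreal (1 / A) * (ennreal \<bar>h x\<bar> * potential g x) \<partial>M)"
    by (rule nn_integral_mono_AE)
  also have "\<dots> = ennreal (1 / A) * (\<integral>\<^sup>+x. ennreal \<bar>h x\<bar> * potential g x \<partial>M)"
    by (simp add: nn_integral_cmult)
  finally show ?thesis by (simp add: A_def)
qed

lemma W0_pairing_bounded:
  assumes a: "C_plus \<Omega> a" and q: "C_plus \<Omega> q"
    and subcritical: "\<And>x. x \<in> closure \<Omega> \<Longrightarrow> 1 / a x + 1 / q x < 1 + 1 / real DIM('a)"
  obtains C where "0 \<le> C"
    "\<And>(h :: 'a \<Rightarrow> real) u g. h \<in> borel_measurable M \<Longrightarrow> W0_grad \<Omega> p u g \<Longrightarrow>
      (\<integral>\<^sup>+x. ennreal \<bar>h x * u x\<bar> \<partial>M) \<le> ennreal C * ((1 + modular \<Omega> a h) * (1 + norm_modular \<Omega> q g))"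
proof -
  obtain c where c: "0 \<le> c"
    "\<And>(h :: 'a \<Rightarrow> real) (g :: 'a \<Rightarrow> 'a). h \<in> borel_measurable M \<Longrightarrow> g \<in> borel_measurable M \<Longrightarrow>
      (\<integral>\<^sup>+x. ennreal \<bar>h x\<bar> * potential g x \<partial>M)
        \<le> ennreal c * ((1 + modular \<Omega> a h) * (1 + norm_modular \<Omega> q g))"
    using nn_integral_mult_potential_bounded[OF a q subcritical, where 'b='a] by blast
  have vol: "0 \<le> 1 / half_annulus_vol TYPE('a)"
    using half_annulus_vol_pos[where 'a='a] by simp
  show ?thesis
  proof (rule that)
    show "0 \<le> (1 / half_annulus_vol TYPE('a)) * c" using vol c(1) by simp
    fix h :: "'a \<Rightarrow> real" and u g
    assume h: "h \<in> borel_measurable M" and u: "W0_grad \<Omega> p u g"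
    note nn_integral_mult_W0_le_potential[OF h u]
    also have "ennreal (1 / half_annulus_vol TYPE('a)) * (\<integral>\<^sup>+x. ennreal \<bar>h x\<bar> * potential g x \<partial>M)
        \<le> ennreal (1 / half_annulus_vol TYPE('a))
          * (ennreal c * ((1 + modular \<Omega> a h) * (1 + norm_modular \<Omega> q g)))"
      by (intro mult_left_mono c(2) h W0_gradD(5)[OF u]) simp
    finally show "(\<integral>\<^sup>+x. ennreal \<bar>h x * u x\<bar> \<partial>M) \<le> ennreal ((1 / half_annulus_vol TYPE('a)) * c)
        * ((1 + modular \<Omega> a h) * (1 + norm_modular \<Omega> q g))"
      by (simp only: ennreal_mult[OF vol c(1)] mult.assoc)
  qed
qed

definition conjugate :: "'a \<Rightarrow> real" where
  "conjugate x = p x / (p x - 1)"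

lemma C_plus_conjugate:
  assumes "C_plus \<Omega> p"
  shows "C_plus \<Omega> conjugate"
proof -
  have "continuous_on (closure \<Omega>) conjugate"
    using assms unfolding C_plus_def conjugate_def[abs_def] by (intro continuous_intros) fastforce+
  then show ?thesis using assms by (auto simp: C_plus_def conjugate_def field_simps)
qed

lemma conjugate_subcritical:
  assumes "C_plus \<Omega> p" "x \<in> closure \<Omega>"
  shows "1 / conjugate x + 1 / p x < 1 + 1 / real DIM('a)"
proof -
  have "1 < p x" using assms by (simp add: C_plus_def)
  then have "1 / conjugate x + 1 / p x = 1" by (simp add: conjugate_def field_simps)
  then show ?thesis by simp
qed

lemma modular_conjugate_dual_power_le:
  assumes [measurable]: "u \<in> borel_measurable M" and s: "1 \<le> s"
  shows "modular \<Omega> conjugate (\<lambda>x. \<bar>u x\<bar> powr (p x - 1) / s)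
    \<le> ennreal ((1/s) powr (m / (m - 1))) * modular \<Omega> p u"
proof -
  have [measurable]: "conjugate \<in> borel_measurable M" unfolding conjugate_def[abs_def] by measurable
  have "modular \<Omega> conjugate (\<lambda>x. \<bar>u x\<bar> powr (p x - 1) / s)
      = norm_modular \<Omega> conjugate (\<lambda>x. (1/s) *\<^sub>R (\<bar>u x\<bar> powr (p x - 1)))"
    unfolding real_norm_def modular_abs by simp
  also have "\<dots> \<le> ennreal ((1/s) powr (m / (m - 1)))
      * norm_modular \<Omega> conjugate (\<lambda>x. \<bar>u x\<bar> powr (p x - 1))"
  proof (rule norm_modular_scaleR_le)
    fix x assume x: "x \<in> \<Omega>"
    have "m / (m - 1) \<le> conjugate x"
      using p_gt_1[OF x] p_le_m[OF x] by (simp add: conjugate_def field_simps)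
    then show "\<bar>1/s\<bar> powr conjugate x \<le> (1/s) powr (m / (m - 1))"
      using s by (simp add: powr_mono')
  qed measurable
  also have "norm_modular \<Omega> conjugate (\<lambda>x. \<bar>u x\<bar> powr (p x - 1)) = modular \<Omega> p u"
    unfolding modular_def
  proof (rule nn_integral_cong)
    fix x assume "x \<in> space M"
    then show "ennreal (\<bar>norm (\<bar>u x\<bar> powr (p x - 1))\<bar> powr conjugate x) = ennreal (\<bar>u x\<bar> powr p x)"
      using p_gt_1[of x] by (simp add: powr_powr conjugate_def)
  qed
  finally show ?thesis .
qed

text \<open>The pairing estimate is tested with \<open>|u|^(p-1) / s\<close>; for large \<open>s\<close> the modular of \<open>u\<close> on the
  right-hand side can be absorbed.\<close>

lemma modular_le_absorbable:
  assumes C_plus: "C_plus \<Omega> p"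
  obtains c where "0 \<le> c"
    "\<And>u g s \<mu>. W0_grad \<Omega> p u g \<Longrightarrow> norm_modular \<Omega> p g \<le> 1 \<Longrightarrow> 1 \<le> s \<Longrightarrow>
      modular \<Omega> p u = ennreal \<mu> \<Longrightarrow> 0 \<le> \<mu> \<Longrightarrow> \<mu> \<le> 2 * c * s * (1 + (1/s) powr (m / (m - 1)) * \<mu>)"
proof -
  obtain c where c: "0 \<le> c"
    "\<And>(h :: 'a \<Rightarrow> real) u g. h \<in> borel_measurable M \<Longrightarrow> W0_grad \<Omega> p u g \<Longrightarrow>
      (\<integral>\<^sup>+x. ennreal \<bar>h x * u x\<bar> \<partial>M)
        \<le> ennreal c * ((1 + modular \<Omega> conjugate h) * (1 + norm_modular \<Omega> p g))"
    using W0_pairing_bounded[OF C_plus_conjugate[OF C_plus] C_plus conjugate_subcritical[OF C_plus]]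
    by blast
  show ?thesis
  proof (rule that[OF c(1)])
    fix u g and s \<mu> :: real
    assume u: "W0_grad \<Omega> p u g" and g: "norm_modular \<Omega> p g \<le> 1" and s: "1 \<le> s"
      and \<mu>: "modular \<Omega> p u = ennreal \<mu>" "0 \<le> \<mu>"
    note [measurable] = W0_gradD(4)[OF u]
    define \<epsilon> where "\<epsilon> = (1/s) powr (m / (m - 1))"
    define h where "h x = \<bar>u x\<bar> powr (p x - 1) / s" for x
    have [measurable]: "h \<in> borel_measurable M" unfolding h_def by measurable
    have h_le: "modular \<Omega> conjugate h \<le> ennreal (\<epsilon> * \<mu>)"
      using modular_conjugate_dual_power_le[OF W0_gradD(4)[OF u] s] \<mu>
      by (simp add: h_def[abs_def] \<epsilon>_def ennreal_mult)
    have "\<bar>u x\<bar> powr p x / s = \<bar>h x * u x\<bar>" for x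
      using s powr_add[of "\<bar>u x\<bar>" "p x - 1" 1] by (cases "u x = 0") (auto simp: h_def abs_mult)
    then have "ennreal (1/s) * ennreal \<mu> = (\<integral>\<^sup>+x. ennreal \<bar>h x * u x\<bar> \<partial>M)"
      using s \<mu>(1)[symmetric] unfolding modular_def
      by (simp add: nn_integral_cmult[symmetric] flip: ennreal_mult)
    also have "\<dots> \<le> ennreal c * ((1 + modular \<Omega> conjugate h) * (1 + norm_modular \<Omega> p g))"
      by (intro c(2) u) measurable
    also have "\<dots> \<le> ennreal c * ((1 + ennreal (\<epsilon> * \<mu>)) * (1 + 1))"
      using h_le g by (intro mult_left_mono mult_mono add_left_mono) auto
    also have "\<dots> = ennreal (c * ((1 + \<epsilon> * \<mu>) * 2))"
      using c(1) \<mu>(2) by (simp add: \<epsilon>_def ennreal_mult)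
    finally have "\<mu> / s \<le> c * ((1 + \<epsilon> * \<mu>) * 2)"
      using s \<mu>(2) c by (simp add: \<epsilon>_def flip: ennreal_mult)
    then show "\<mu> \<le> 2 * c * s * (1 + (1/s) powr (m / (m - 1)) * \<mu>)"
      using s by (simp add: \<epsilon>_def[symmetric] field_simps)
  qed
qed

lemma modular_poincare:
  assumes C_plus: "C_plus \<Omega> p"
  obtains C where "0 \<le> C"
    "\<And>u g. W0_grad \<Omega> p u g \<Longrightarrow> norm_modular \<Omega> p g \<le> 1 \<Longrightarrow> modular \<Omega> p u \<le> ennreal C"
proof -
  obtain c where c: "0 \<le> c"
    and absorbable: "\<And>u g s \<mu>. W0_grad \<Omega> p u g \<Longrightarrow> norm_modular \<Omega> p g \<le> 1 \<Longrightarrow> 1 \<le> s \<Longrightarrow>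
      modular \<Omega> p u = ennreal \<mu> \<Longrightarrow> 0 \<le> \<mu> \<Longrightarrow> \<mu> \<le> 2 * c * s * (1 + (1/s) powr (m / (m - 1)) * \<mu>)"
    using modular_le_absorbable[OF C_plus] by blast
  have "1 < m" using l_gt_1 l_le_m by linarith
  define s where "s = max 1 (4 * c) powr (m - 1)"
  have s: "1 \<le> s" unfolding s_def using \<open>1 < m\<close> by (intro ge_one_powr_ge_zero) auto
  have "s powr (m / (m - 1)) = s powr (1 + 1 / (m - 1))"
    using \<open>1 < m\<close> by (simp add: field_simps)
  also have "\<dots> = s * max 1 (4 * c)"
    using s \<open>1 < m\<close> by (simp add: powr_add) (simp add: s_def powr_powr)
  finally have "s * (1/s) powr (m / (m - 1)) = 1 / max 1 (4 * c)"
    using s by (simp add: powr_divide)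
  then have half: "2 * c * (s * (1/s) powr (m / (m - 1))) \<le> 1 / 2"
    by (simp only:) (simp add: divide_le_eq)
  show ?thesis
  proof (rule that)
    show "0 \<le> 4 * c * s" using c s by simp
    fix u g assume u: "W0_grad \<Omega> p u g" and g: "norm_modular \<Omega> p g \<le> 1"
    obtain \<mu> where \<mu>: "0 \<le> \<mu>" "modular \<Omega> p u = ennreal \<mu>"
      using W0_gradD(2)[OF u] by (cases "modular \<Omega> p u") (auto simp: Lp_field_def)
    have "\<mu> \<le> 2 * c * s + (2 * c * (s * (1/s) powr (m / (m - 1)))) * \<mu>"
      using absorbable[OF u g s \<mu>(2,1)] by (simp add: algebra_simps)
    also have "\<dots> \<le> 2 * c * s + 1 / 2 * \<mu>"
      using half \<mu>(1) by (intro add_left_mono mult_right_mono)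
    finally show "modular \<Omega> p u \<le> ennreal (4 * c * s)" using \<mu> by (simp add: ennreal_leI)
  qed
qed

lemma modular_small_if_grad_modular_small:
  assumes "C_plus \<Omega> p" and e: "0 < e"
  obtains d :: real where "0 < d"
    "\<And>u g. W0_grad \<Omega> p u g \<Longrightarrow> norm_modular \<Omega> p g \<le> ennreal d \<Longrightarrow> modular \<Omega> p u \<le> ennreal e"
proof -
  obtain C where C: "0 \<le> C"
    "\<And>u g. W0_grad \<Omega> p u g \<Longrightarrow> norm_modular \<Omega> p g \<le> 1 \<Longrightarrow> modular \<Omega> p u \<le> ennreal C"
    using modular_poincare[OF assms(1)] by blast
  define t where "t = max 1 (C / e)"
  have t: "1 \<le> t" "C / t \<le> e" using e by (auto simp: t_def field_simps max_def)
  show ?thesis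
  proof (rule that[of "t powr (- m)"])
    show "0 < t powr (- m)" using t by simp
    fix u g assume u: "W0_grad \<Omega> p u g" and g: "norm_modular \<Omega> p g \<le> ennreal (t powr (- m))"
    have max_t: "max 1 \<bar>t\<bar> = t" using t by simp
    have "norm_modular \<Omega> p (\<lambda>x. t *\<^sub>R g x) \<le> ennreal (t powr m) * norm_modular \<Omega> p g"
      using norm_modular_scaleR_le_upper[OF W0_gradD(5)[OF u], of t] unfolding max_t .
    also have "\<dots> \<le> ennreal (t powr m) * ennreal (t powr (- m))"
      using g by (intro mult_left_mono) auto
    also have "\<dots> = 1" using t by (simp flip: ennreal_mult powr_add)
    finally have tu: "modular \<Omega> p (\<lambda>x. t * u x) \<le> ennreal C" by (rule C(2)[OF W0_grad_scale[OF u]])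
    have "modular \<Omega> p u = norm_modular \<Omega> p (\<lambda>x. (1/t) *\<^sub>R (t * u x))"
      unfolding real_norm_def modular_abs using t by simp
    also have "\<dots> \<le> ennreal (\<bar>1/t\<bar> powr l) * norm_modular \<Omega> p (\<lambda>x. t * u x)"
      using t W0_gradD(4)[OF u] by (intro norm_modular_scaleR_le_lower) auto
    also have "\<dots> \<le> ennreal (\<bar>1/t\<bar> powr 1) * ennreal C"
      using t l_gt_1 tu by (intro mult_mono ennreal_leI powr_mono') auto
    also have "\<dots> \<le> ennreal e" using t C(1) by (simp add: ennreal_leI flip: ennreal_mult)
    finally show "modular \<Omega> p u \<le> ennreal e" .
  qed
qed

lemma W0_grad_Cauchy:
  assumes "C_plus \<Omega> p" and Cauchy: "modular_Cauchy \<Omega> p G"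
    and diff: "\<And>i j. W0_grad \<Omega> p (\<lambda>x. U i x - U j x) (\<lambda>x. G i x - G j x)"
  shows "modular_Cauchy \<Omega> p U"
  unfolding modular_Cauchy_def
proof (intro allI impI)
  fix e :: real assume "0 < e"
  then obtain d where "0 < d"
    and d: "\<And>u g. W0_grad \<Omega> p u g \<Longrightarrow> norm_modular \<Omega> p g \<le> ennreal d \<Longrightarrow> modular \<Omega> p u \<le> ennreal e"
    using modular_small_if_grad_modular_small[OF assms(1)] by blast
  then obtain N where "\<forall>i\<ge>N. \<forall>j\<ge>N. norm_modular \<Omega> p (\<lambda>x. G i x - G j x) \<le> ennreal d"
    using Cauchy unfolding modular_Cauchy_def by blast
  then show "\<exists>N. \<forall>i\<ge>N. \<forall>j\<ge>N. norm_modular \<Omega> p (\<lambda>x. U i x - U j x) \<le> ennreal e"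
    unfolding real_norm_def modular_abs using d[OF diff] by blast
qed

end

section \<open>Convexity of powers of the norm\<close>

definition power_flux :: "real \<Rightarrow> 'a::real_inner \<Rightarrow> 'a" where
  "power_flux p \<xi> = norm \<xi> powr (p - 2) *\<^sub>R \<xi>"

lemma norm_power_flux: "norm (power_flux p \<xi>) = norm \<xi> powr (p - 1)"
  using powr_add[of "norm \<xi>" "p - 2" 1] by (cases "\<xi> = 0") (simp_all add: power_flux_def)

lemma power_flux_inner_self: "power_flux p \<xi> \<bullet> \<xi> = norm \<xi> powr p"
  using powr_add[of "norm \<xi>" "p - 2" 2]
  by (cases "\<xi> = 0") (simp_all add: power_flux_def powr_numeral flip: power2_norm_eq_inner)

lemma powr_minus_1_mult_self: "0 \<le> a \<Longrightarrow> a powr (p - 1) * a = a powr p" for a :: real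
  using powr_add[of a "p - 1" 1] by (cases "a = 0") auto

lemma powr_gt_tangent:
  fixes a b p :: real
  assumes p: "1 < p" and "0 \<le> a" "0 \<le> b" "a \<noteq> b"
  shows "a powr p + p * a powr (p - 1) * (b - a) < b powr p"
proof -
  define lo hi where "lo = min a b" and "hi = max a b"
  have "0 \<le> lo" "lo < hi" using assms by (auto simp: lo_def hi_def)
  obtain z where z: "lo < z" "z < hi"
    "hi powr p - lo powr p = (hi - lo) * (p * z powr (p - 1))"
  proof -
    have "continuous_on {lo..hi} (\<lambda>x. x powr p)"
      using p \<open>0 \<le> lo\<close> by (intro continuous_on_powr' continuous_intros) auto
    moreover have "((\<lambda>x. x powr p) has_real_derivative p * x powr (p - 1)) (at x)" if "lo < x" for x
      using that \<open>0 \<le> lo\<close> by (intro has_real_derivative_powr) auto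
    ultimately show ?thesis
      using mvt[OF \<open>lo < hi\<close>, of "\<lambda>x. x powr p" "\<lambda>x. (*) (p * x powr (p - 1))"] that
      unfolding has_field_derivative_def by (metis mult.commute)
  qed
  have "lo powr (p - 1) < z powr (p - 1)" "z powr (p - 1) < hi powr (p - 1)"
    using z(1,2) p \<open>0 \<le> lo\<close> by (auto intro: powr_less_mono2)
  then have "(hi - lo) * (p * lo powr (p - 1)) < hi powr p - lo powr p"
    "hi powr p - lo powr p < (hi - lo) * (p * hi powr (p - 1))"
    using p \<open>lo < hi\<close> unfolding z(3) by auto
  then show ?thesis by (cases "a < b") (auto simp: lo_def hi_def algebra_simps)
qed

lemma norm_powr_gt_tangent:
  fixes \<xi> \<eta> :: "'a::real_inner"
  assumes p: "1 < p" and "\<xi> \<noteq> \<eta>"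
  shows "norm \<xi> powr p + p * (power_flux p \<xi> \<bullet> (\<eta> - \<xi>)) < norm \<eta> powr p"
proof (cases "norm \<xi> = norm \<eta>")
  case False
  have "power_flux p \<xi> \<bullet> (\<eta> - \<xi>) \<le> norm \<xi> powr (p - 1) * norm \<eta> - norm \<xi> powr p"
    using norm_cauchy_schwarz[of "power_flux p \<xi>" \<eta>]
    by (simp add: inner_diff_right norm_power_flux power_flux_inner_self)
  also have "\<dots> = norm \<xi> powr (p - 1) * (norm \<eta> - norm \<xi>)"
    by (simp add: right_diff_distrib powr_minus_1_mult_self)
  finally have "norm \<xi> powr p + p * (power_flux p \<xi> \<bullet> (\<eta> - \<xi>))
      \<le> norm \<xi> powr p + p * (norm \<xi> powr (p - 1) * (norm \<eta> - norm \<xi>))"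
    using p by simp
  also have "\<dots> < norm \<eta> powr p"
    using powr_gt_tangent[OF p _ _ False] by (simp add: mult.assoc)
  finally show ?thesis .
next
  case True
  have "0 < (norm (\<eta> - \<xi>))\<^sup>2" using \<open>\<xi> \<noteq> \<eta>\<close> by simp
  also have "\<dots> = - 2 * (\<xi> \<bullet> (\<eta> - \<xi>))"
    using True by (simp add: power2_norm_eq_inner norm_eq inner_diff inner_commute)
  finally have "\<xi> \<bullet> (\<eta> - \<xi>) < 0" by simp
  moreover have "\<xi> \<noteq> 0" using True \<open>\<xi> \<noteq> \<eta>\<close> by auto
  ultimately have "power_flux p \<xi> \<bullet> (\<eta> - \<xi>) < 0"
    by (simp add: power_flux_def mult_pos_neg)
  with True p show ?thesis by (simp add: mult_pos_neg)
qed

lemma norm_powr_ge_tangent: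
  "1 < p \<Longrightarrow> norm \<xi> powr p + p * (power_flux p \<xi> \<bullet> (\<eta> - \<xi>)) \<le> norm \<eta> powr p"
  using norm_powr_gt_tangent[of p \<xi> \<eta>] by (cases "\<xi> = \<eta>") auto

lemma power_flux_strict_mono:
  fixes \<xi> \<eta> :: "'a::real_inner"
  assumes p: "1 < p" and "\<xi> \<noteq> \<eta>"
  shows "0 < power_flux p \<xi> \<bullet> (\<xi> - \<eta>) - power_flux p \<eta> \<bullet> (\<xi> - \<eta>)"
proof -
  have "p * (power_flux p \<xi> \<bullet> (\<eta> - \<xi>) + power_flux p \<eta> \<bullet> (\<xi> - \<eta>)) < 0"
    using norm_powr_gt_tangent[OF p \<open>\<xi> \<noteq> \<eta>\<close>] norm_powr_gt_tangent[OF p \<open>\<xi> \<noteq> \<eta>\<close>[symmetric]]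
    by (simp add: distrib_left)
  then have "power_flux p \<xi> \<bullet> (\<eta> - \<xi>) + power_flux p \<eta> \<bullet> (\<xi> - \<eta>) < 0"
    using p by (simp add: mult_less_0_iff)
  then show ?thesis by (simp add: inner_diff_right)
qed

lemma power_flux_inner_le:
  assumes "1 < p"
  shows "\<bar>power_flux p \<xi> \<bullet> \<eta>\<bar> \<le> norm \<xi> powr p + norm \<eta> powr p"
proof -
  define c where "c = max (norm \<xi>) (norm \<eta>)"
  have "\<bar>power_flux p \<xi> \<bullet> \<eta>\<bar> \<le> norm \<xi> powr (p - 1) * norm \<eta>"
    using Cauchy_Schwarz_ineq2[of "power_flux p \<xi>" \<eta>] by (simp add: norm_power_flux)
  also have "\<dots> \<le> c powr (p - 1) * c"
    using assms by (intro mult_mono powr_mono2) (auto simp: c_def)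
  also have "\<dots> = c powr p" by (simp add: powr_minus_1_mult_self c_def le_max_iff_disj)
  also have "\<dots> \<le> norm \<xi> powr p + norm \<eta> powr p" by (auto simp: c_def max_def)
  finally show ?thesis .
qed

lemma power_flux_perturbed_inner_le:
  assumes p: "1 < p" and t: "0 \<le> t" "t \<le> 1"
  shows "\<bar>power_flux p (\<xi> + t *\<^sub>R \<eta>) \<bullet> \<eta>\<bar>
    \<le> 2 powr p * (norm \<xi> powr p + norm \<eta> powr p) + norm \<eta> powr p"
proof -
  have "norm (t *\<^sub>R \<eta>) \<le> norm \<eta>" using t by (simp add: mult_left_le_one_le)
  then have "norm (\<xi> + t *\<^sub>R \<eta>) powr p \<le> (norm \<xi> + norm \<eta>) powr p"
    using p norm_triangle_ineq[of \<xi> "t *\<^sub>R \<eta>"] by (intro powr_mono2) auto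
  also have "\<dots> \<le> 2 powr p * (norm \<xi> powr p + norm \<eta> powr p)"
    using p by (intro powr_add_le) auto
  finally show ?thesis
    using power_flux_inner_le[OF p, of "\<xi> + t *\<^sub>R \<eta>" \<eta>] by linarith
qed

lemma isCont_power_flux:
  fixes \<xi> :: "'a::real_inner"
  assumes "1 < p"
  shows "isCont (power_flux p) \<xi>"
proof (cases "\<xi> = 0")
  case False
  then show ?thesis unfolding power_flux_def[abs_def] by (intro continuous_intros) auto
next
  case True
  have "((\<lambda>\<eta>::'a. norm \<eta> powr (p - 1)) \<longlongrightarrow> norm (0::'a) powr (p - 1)) (at 0)"
    using assms by (intro tendsto_powr2 tendsto_intros) auto
  then have norm_tendsto: "((\<lambda>\<eta>::'a. norm \<eta> powr (p - 1)) \<longlongrightarrow> 0) (at 0)" by simp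
  have "(power_flux p \<longlongrightarrow> (0::'a)) (at 0)"
    by (rule Lim_null_comparison[OF _ norm_tendsto]) (simp add: norm_power_flux)
  then show ?thesis using True by (simp add: isCont_def power_flux_def)
qed

lemma power_flux_measurable [measurable (raw)]:
  fixes g :: "'a \<Rightarrow> 'b::euclidean_space"
  assumes [measurable]: "p \<in> borel_measurable M" "g \<in> borel_measurable M"
  shows "(\<lambda>x. power_flux (p x) (g x)) \<in> borel_measurable M"
  unfolding power_flux_def by measurable

definition convexity_gap :: "real \<Rightarrow> 'a::real_inner \<Rightarrow> 'a \<Rightarrow> real" where
  "convexity_gap p \<xi> \<eta> =
    (norm \<xi> powr p + norm \<eta> powr p) / 2 - norm ((1/2) *\<^sub>R \<xi> + (1/2) *\<^sub>R \<eta>) powr p"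

lemma convexity_gap_pos:
  fixes \<xi> \<eta> :: "'a::real_inner"
  assumes p: "1 < p" and "\<xi> \<noteq> \<eta>"
  shows "0 < convexity_gap p \<xi> \<eta>"
proof -
  define \<zeta> where "\<zeta> = (1/2) *\<^sub>R \<xi> + (1/2) *\<^sub>R \<eta>"
  have differences: "\<xi> - \<zeta> = (1/2) *\<^sub>R (\<xi> - \<eta>)" "\<eta> - \<zeta> = - (1/2) *\<^sub>R (\<xi> - \<eta>)"
    by (simp_all add: \<zeta>_def algebra_simps flip: scaleR_left_distrib)
  then have "\<zeta> \<noteq> \<xi>" "\<zeta> \<noteq> \<eta>" using \<open>\<xi> \<noteq> \<eta>\<close> by auto
  then have "norm \<zeta> powr p + p * (power_flux p \<zeta> \<bullet> (\<xi> - \<zeta>)) < norm \<xi> powr p"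
    "norm \<zeta> powr p + p * (power_flux p \<zeta> \<bullet> (\<eta> - \<zeta>)) < norm \<eta> powr p"
    using norm_powr_gt_tangent[OF p] by blast+
  then show ?thesis
    unfolding differences convexity_gap_def \<zeta>_def[symmetric]
    by (simp add: inner_diff_right field_simps)
qed

lemma convexity_gap_refl [simp]: "convexity_gap p \<xi> \<xi> = 0"
  by (simp add: convexity_gap_def flip: scaleR_left_distrib)

lemma convexity_gap_nonneg: "1 < p \<Longrightarrow> 0 \<le> convexity_gap p \<xi> \<eta>"
  using convexity_gap_pos[of p \<xi> \<eta>] by (cases "\<xi> = \<eta>") auto

lemma convexity_gap_scale:
  assumes "0 \<le> r"
  shows "convexity_gap p (r *\<^sub>R \<xi>) (r *\<^sub>R \<eta>) = r powr p * convexity_gap p \<xi> \<eta>"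
proof -
  have "(1/2) *\<^sub>R (r *\<^sub>R \<xi>) + (1/2) *\<^sub>R (r *\<^sub>R \<eta>) = r *\<^sub>R ((1/2) *\<^sub>R \<xi> + (1/2) *\<^sub>R \<eta>)"
    by (simp add: algebra_simps)
  with assms show ?thesis
    unfolding convexity_gap_def
    by (simp only: norm_scaleR powr_mult) (simp add: powr_mult algebra_simps)
qed

lemma continuous_on_norm_powr:
  fixes f :: "'b::topological_space \<Rightarrow> 'a::real_normed_vector"
  assumes "continuous_on S f" "continuous_on S p" "\<And>x. x \<in> S \<Longrightarrow> 0 < (p x :: real)"
  shows "continuous_on S (\<lambda>x. norm (f x) powr p x)"
  using assms by (intro continuous_on_powr' continuous_intros) auto

section \<open>Uniform convexity\<close>

lemma compact_penalty:
  fixes A B :: "'a::metric_space \<Rightarrow> real"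
  assumes K: "compact K" and A: "continuous_on K A" and B: "continuous_on K B"
    and nonneg: "\<And>z. z \<in> K \<Longrightarrow> 0 \<le> B z"
    and pos: "\<And>z. z \<in> K \<Longrightarrow> B z = 0 \<Longrightarrow> 0 < A z"
  obtains C where "0 \<le> C" "\<And>z. z \<in> K \<Longrightarrow> 0 \<le> A z + C * B z"
proof (cases "\<exists>z\<in>K. A z \<le> 0")
  case False
  then show ?thesis by (intro that[of 0]) (auto simp: not_le less_imp_le)
next
  case True
  define L where "L = {z \<in> K. A z \<le> 0}"
  have "closed (K \<inter> A -` {..0})"
    using A K by (intro continuous_closed_preimage) (auto simp: compact_imp_closed)
  then have "compact (K \<inter> (K \<inter> A -` {..0}))" using K by (rule compact_Int_closed[rotated])
  moreover have "K \<inter> (K \<inter> A -` {..0}) = L" by (auto simp: L_def)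
  ultimately have L: "compact L" "L \<noteq> {}" using True by (auto simp: L_def)
  have L_continuous: "continuous_on L A" "continuous_on L B"
    using A B by (auto simp: L_def intro: continuous_on_subset)
  obtain y where y: "y \<in> L" "\<And>z. z \<in> L \<Longrightarrow> A y \<le> A z"
    using continuous_attains_inf[OF L L_continuous(1)] by blast
  obtain w where w: "w \<in> L" "\<And>z. z \<in> L \<Longrightarrow> B w \<le> B z"
    using continuous_attains_inf[OF L L_continuous(2)] by blast
  have "0 < B w" using nonneg[of w] pos[of w] w(1) by (force simp: L_def)
  define C where "C = - A y / B w"
  have C: "0 \<le> C" using \<open>0 < B w\<close> y(1) by (simp add: C_def L_def divide_le_0_iff)
  show ?thesis
  proof (rule that[OF C])
    fix z assume z: "z \<in> K"
    show "0 \<le> A z + C * B z"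
    proof (cases "z \<in> L")
      case True
      have "- A y = C * B w" using \<open>0 < B w\<close> by (simp add: C_def)
      also have "\<dots> \<le> C * B z" using w(2)[OF True] C by (intro mult_left_mono)
      finally show ?thesis using y(2)[OF True] by linarith
    qed (use z C nonneg[OF z] in \<open>auto simp: L_def\<close>)
  qed
qed

lemma uniform_convexity_unit:
  fixes e l m :: real
  assumes e: "0 < e" and l: "1 < l"
  obtains C where "0 \<le> C" "\<And>p (\<xi>::'a::euclidean_space) \<eta>. l \<le> p \<Longrightarrow> p \<le> m \<Longrightarrow> norm (\<xi>, \<eta>) = 1 \<Longrightarrow>
    norm (\<xi> - \<eta>) powr p \<le> e * (norm \<xi> powr p + norm \<eta> powr p) + C * convexity_gap p \<xi> \<eta>"
proof -
  define K where "K = {l..m} \<times> sphere (0::'a \<times> 'a) 1"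
  define A where "A = (\<lambda>z :: real \<times> 'a \<times> 'a. e * (norm (fst (snd z)) powr fst z
    + norm (snd (snd z)) powr fst z) - norm (fst (snd z) - snd (snd z)) powr fst z)"
  define B where "B = (\<lambda>z :: real \<times> 'a \<times> 'a. convexity_gap (fst z) (fst (snd z)) (snd (snd z)))"
  have exponent_pos: "0 < fst z" "1 < fst z" if "z \<in> K" for z using that l by (auto simp: K_def)
  have "compact K" unfolding K_def by (intro compact_Times compact_sphere) auto
  moreover have "continuous_on K A" "continuous_on K B"
    unfolding A_def B_def convexity_gap_def
    by (intro continuous_intros continuous_on_norm_powr exponent_pos; simp)+
  moreover have "0 \<le> B z" if "z \<in> K" for z
    unfolding B_def by (intro convexity_gap_nonneg exponent_pos that)
  moreover have "0 < A z" if z: "z \<in> K" and "B z = 0" for z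
  proof -
    have equal: "fst (snd z) = snd (snd z)"
      using convexity_gap_pos[OF exponent_pos(2)[OF z]] \<open>B z = 0\<close> unfolding B_def by force
    have "norm (snd z) = 1" using z by (auto simp: K_def)
    then have "snd (snd z) \<noteq> 0"
      using equal by (metis norm_zero prod.collapse zero_neq_one zero_prod_def)
    then show ?thesis using e equal unfolding A_def by simp
  qed
  ultimately obtain C where C: "0 \<le> C" "\<And>z. z \<in> K \<Longrightarrow> 0 \<le> A z + C * B z"
    using compact_penalty[of K A B] by metis
  show ?thesis
    by (rule that[OF C(1)]) (use C(2)[of "(_, _, _)"] in \<open>force simp: K_def A_def B_def\<close>)
qed

lemma uniform_convexity:
  fixes e l m :: real
  assumes e: "0 < e" and l: "1 < l"
  obtains C where "0 \<le> C" "\<And>p (\<xi>::'a::euclidean_space) \<eta>. l \<le> p \<Longrightarrow> p \<le> m \<Longrightarrow>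
    norm (\<xi> - \<eta>) powr p \<le> e * (norm \<xi> powr p + norm \<eta> powr p) + C * convexity_gap p \<xi> \<eta>"
proof -
  obtain C where C: "0 \<le> C" "\<And>p (\<xi>::'a) \<eta>. l \<le> p \<Longrightarrow> p \<le> m \<Longrightarrow> norm (\<xi>, \<eta>) = 1 \<Longrightarrow>
      norm (\<xi> - \<eta>) powr p \<le> e * (norm \<xi> powr p + norm \<eta> powr p) + C * convexity_gap p \<xi> \<eta>"
    using uniform_convexity_unit[OF e l] by blast
  show ?thesis
  proof (rule that[OF C(1)])
    fix p :: real and \<xi> \<eta> :: 'a
    assume p: "l \<le> p" "p \<le> m"
    show "norm (\<xi> - \<eta>) powr p \<le> e * (norm \<xi> powr p + norm \<eta> powr p) + C * convexity_gap p \<xi> \<eta>"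
    proof (cases "norm (\<xi>, \<eta>) = 0")
      case True
      then have "\<xi> = 0" "\<eta> = 0" by (auto simp: zero_prod_def)
      then show ?thesis by simp
    next
      case False
      define r where "r = norm (\<xi>, \<eta>)"
      have r: "0 < r" using False by (simp add: r_def)
      define \<xi>' \<eta>' where "\<xi>' = (1/r) *\<^sub>R \<xi>" and "\<eta>' = (1/r) *\<^sub>R \<eta>"
      have scaled: "\<xi> = r *\<^sub>R \<xi>'" "\<eta> = r *\<^sub>R \<eta>'" using r by (auto simp: \<xi>'_def \<eta>'_def)
      have "norm (\<xi>', \<eta>') = norm ((1/r) *\<^sub>R (\<xi>, \<eta>))" by (simp add: \<xi>'_def \<eta>'_def)
      also have "\<dots> = 1" using r unfolding norm_scaleR by (simp add: r_def)
      finally have "r powr p * norm (\<xi>' - \<eta>') powr p \<le> r powr p *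
          (e * (norm \<xi>' powr p + norm \<eta>' powr p) + C * convexity_gap p \<xi>' \<eta>')"
        using C(2)[OF p] by (intro mult_left_mono) auto
      then show ?thesis
        using r unfolding scaled
        by (simp add: convexity_gap_scale powr_mult algebra_simps flip: scaleR_diff_right)
    qed
  qed
qed

section \<open>The Dirichlet energy of a single phase\<close>

context bounded_domain
begin

definition real_modular :: "('a \<Rightarrow> real) \<Rightarrow> ('a \<Rightarrow> 'b::euclidean_space) \<Rightarrow> real" where
  "real_modular p g = (\<integral>x. norm (g x) powr p x \<partial>M)"

definition dirichlet_energy :: "('a \<Rightarrow> real) \<Rightarrow> ('a \<Rightarrow> 'b::euclidean_space) \<Rightarrow> real" where
  "dirichlet_energy p g = (\<integral>x. norm (g x) powr p x / p x \<partial>M)"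

definition flux_pairing ::
  "('a \<Rightarrow> real) \<Rightarrow> ('a \<Rightarrow> 'b::euclidean_space) \<Rightarrow> ('a \<Rightarrow> 'b) \<Rightarrow> real" where
  "flux_pairing p g h = (\<integral>x. power_flux (p x) (g x) \<bullet> h x \<partial>M)"

definition energy_gap ::
  "('a \<Rightarrow> real) \<Rightarrow> ('a \<Rightarrow> 'b::euclidean_space) \<Rightarrow> ('a \<Rightarrow> 'b) \<Rightarrow> real" where
  "energy_gap p g h = (\<integral>x. convexity_gap (p x) (g x) (h x) / p x \<partial>M)"

lemma real_modular_nonneg: "0 \<le> real_modular p g"
  by (simp add: real_modular_def)

lemma flux_pairing_scaleR: "flux_pairing p g (\<lambda>x. c *\<^sub>R h x) = c * flux_pairing p g h"
  by (simp add: flux_pairing_def)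

end

context exponent_on_domain
begin

lemma integrable_norm_powr: "g \<in> Lp_field \<Omega> p \<Longrightarrow> integrable M (\<lambda>x. norm (g x) powr p x)"
  by (intro integrableI_bounded) (auto simp: Lp_field_def modular_def)

lemma norm_modular_eq_real_modular:
  "g \<in> Lp_field \<Omega> p \<Longrightarrow> norm_modular \<Omega> p g = ennreal (real_modular p g)"
  unfolding modular_def real_modular_def abs_norm_cancel
  by (intro nn_integral_eq_integral integrable_norm_powr) auto

lemma real_modular_scaleR_le_upper:
  assumes g: "g \<in> Lp_field \<Omega> p"
  shows "real_modular p (\<lambda>x. c *\<^sub>R g x) \<le> max 1 \<bar>c\<bar> powr m * real_modular p g"
proof -
  have "g \<in> borel_measurable M" using g by (simp add: Lp_field_def)
  from norm_modular_scaleR_le_upper[OF this, of c] show ?thesis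
    unfolding norm_modular_eq_real_modular[OF g]
      norm_modular_eq_real_modular[OF Lp_field_scaleR[OF g]]
    by (simp add: real_modular_nonneg flip: ennreal_mult)
qed

lemma real_modular_scaleR_le_lower:
  assumes g: "g \<in> Lp_field \<Omega> p" and "\<bar>c\<bar> \<le> 1"
  shows "real_modular p (\<lambda>x. c *\<^sub>R g x) \<le> \<bar>c\<bar> powr l * real_modular p g"
proof -
  have "g \<in> borel_measurable M" using g by (simp add: Lp_field_def)
  from norm_modular_scaleR_le_lower[OF this \<open>\<bar>c\<bar> \<le> 1\<close>] show ?thesis
    unfolding norm_modular_eq_real_modular[OF g]
      norm_modular_eq_real_modular[OF Lp_field_scaleR[OF g]]
    by (simp add: real_modular_nonneg flip: ennreal_mult)
qed

lemma integrable_div_exponent: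
  assumes w: "integrable M (w :: 'a \<Rightarrow> real)"
  shows "integrable M (\<lambda>x. w x / p x)"
proof (rule Bochner_Integration.integrable_bound[OF w])
  show "(\<lambda>x. w x / p x) \<in> borel_measurable M"
    using borel_measurable_integrable[OF w] by measurable
  show "AE x in M. norm (w x / p x) \<le> norm (w x)"
  proof (rule AE_I2)
    fix x assume "x \<in> space M"
    then have "1 < p x" by (intro p_gt_1) simp
    then show "norm (w x / p x) \<le> norm (w x)" by (simp add: divide_le_eq mult_le_cancel_left1)
  qed
qed

lemma integral_le_upper_mult_div_exponent:
  fixes w :: "'a \<Rightarrow> real"
  assumes w: "integrable M w" and nonneg: "\<And>x. x \<in> \<Omega> \<Longrightarrow> 0 \<le> w x"
  shows "(\<integral>x. w x \<partial>M) \<le> m * (\<integral>x. w x / p x \<partial>M)"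
proof -
  have "w x \<le> m * (w x / p x)" if x: "x \<in> \<Omega>" for x
    using p_gt_1[OF x] mult_right_mono[OF p_le_m[OF x] nonneg[OF x]]
    by (simp add: pos_le_divide_eq mult.commute)
  then have "(\<integral>x. w x \<partial>M) \<le> (\<integral>x. m * (w x / p x) \<partial>M)"
    by (intro integral_mono w integrable_mult_right integrable_div_exponent) auto
  then show ?thesis by (simp del: times_divide_eq_right)
qed

lemma integral_div_exponent_nonneg:
  fixes w :: "'a \<Rightarrow> real"
  assumes "\<And>x. x \<in> \<Omega> \<Longrightarrow> 0 \<le> w x"
  shows "0 \<le> (\<integral>x. w x / p x \<partial>M)"
proof (rule Bochner_Integration.integral_nonneg)
  fix x assume "x \<in> space M"
  then show "0 \<le> w x / p x" using assms[of x] p_gt_1[of x] by simp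
qed

lemma dirichlet_energy_nonneg: "0 \<le> dirichlet_energy p g"
  unfolding dirichlet_energy_def by (intro integral_div_exponent_nonneg) auto

lemma real_modular_le_dirichlet_energy:
  "g \<in> Lp_field \<Omega> p \<Longrightarrow> real_modular p g \<le> m * dirichlet_energy p g"
  unfolding real_modular_def dirichlet_energy_def
  by (intro integral_le_upper_mult_div_exponent integrable_norm_powr) auto

lemma integrable_convexity_gap:
  fixes g h :: "'a \<Rightarrow> 'b::euclidean_space"
  assumes "g \<in> Lp_field \<Omega> p" "h \<in> Lp_field \<Omega> p"
  shows "integrable M (\<lambda>x. convexity_gap (p x) (g x) (h x))"
  unfolding convexity_gap_def
  by (intro Bochner_Integration.integrable_diff Bochner_Integration.integrable_add
      integrable_divide_zero integrable_norm_powr Lp_field_add Lp_field_scaleR assms)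

lemma energy_gap_nonneg: "0 \<le> energy_gap p g h"
  unfolding energy_gap_def
  by (intro integral_div_exponent_nonneg convexity_gap_nonneg p_gt_1)

lemma dirichlet_energy_midpoint:
  fixes g h :: "'a \<Rightarrow> 'b::euclidean_space"
  assumes g: "g \<in> Lp_field \<Omega> p" and h: "h \<in> Lp_field \<Omega> p"
  shows "dirichlet_energy p (\<lambda>x. (1/2) *\<^sub>R g x + (1/2) *\<^sub>R h x) =
    (dirichlet_energy p g + dirichlet_energy p h) / 2 - energy_gap p g h"
proof -
  let ?mid = "\<lambda>x. (1/2) *\<^sub>R g x + (1/2) *\<^sub>R h x"
  define density where "density v x = norm (v x) powr p x / p x" for v :: "'a \<Rightarrow> 'b" and x
  have integrable: "integrable M (density v)" if "v \<in> Lp_field \<Omega> p" for v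
    unfolding density_def[abs_def] by (intro integrable_div_exponent integrable_norm_powr that)
  have dirichlet_energy_eq: "dirichlet_energy p v = (\<integral>x. density v x \<partial>M)" for v
    by (simp add: dirichlet_energy_def density_def)
  have mid: "?mid \<in> Lp_field \<Omega> p" by (intro Lp_field_add Lp_field_scaleR g h)
  have "energy_gap p g h = (\<integral>x. (1/2) * density g x + (1/2) * density h x - density ?mid x \<partial>M)"
    unfolding energy_gap_def
    by (rule Bochner_Integration.integral_cong)
      (simp_all add: density_def convexity_gap_def diff_divide_distrib add_divide_distrib)
  also have "\<dots> = (1/2) * dirichlet_energy p g + (1/2) * dirichlet_energy p h
      - dirichlet_energy p ?mid"
    unfolding dirichlet_energy_eq
    using integrable[OF g] integrable[OF h] integrable[OF mid] by simp
  finally show ?thesis by argo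
qed

lemma real_modular_diff_le_energy_gap:
  assumes "0 < e"
  obtains C where "0 \<le> C"
    "\<And>g h :: 'a \<Rightarrow> 'b::euclidean_space. g \<in> Lp_field \<Omega> p \<Longrightarrow> h \<in> Lp_field \<Omega> p \<Longrightarrow>
      real_modular p (\<lambda>x. g x - h x)
        \<le> e * (real_modular p g + real_modular p h) + C * energy_gap p g h"
proof -
  obtain C where C: "0 \<le> C" "\<And>q (\<xi>::'b) \<eta>. l \<le> q \<Longrightarrow> q \<le> m \<Longrightarrow>
      norm (\<xi> - \<eta>) powr q \<le> e * (norm \<xi> powr q + norm \<eta> powr q) + C * convexity_gap q \<xi> \<eta>"
    using uniform_convexity[OF assms l_gt_1] by blast
  show ?thesis
  proof (rule that)
    show "0 \<le> C * m" using C(1) l_gt_1 l_le_m by simp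
    fix g h :: "'a \<Rightarrow> 'b" assume g: "g \<in> Lp_field \<Omega> p" and h: "h \<in> Lp_field \<Omega> p"
    note integrable = integrable_norm_powr[OF g] integrable_norm_powr[OF h]
      integrable_norm_powr[OF Lp_field_diff[OF g h]] integrable_convexity_gap[OF g h]
    have "real_modular p (\<lambda>x. g x - h x) \<le> (\<integral>x. e * (norm (g x) powr p x + norm (h x) powr p x)
        + C * convexity_gap (p x) (g x) (h x) \<partial>M)"
      unfolding real_modular_def
      by (rule integral_mono) (use integrable l_le_p p_le_m in \<open>auto intro!: C(2)\<close>)
    also have "\<dots> = e * (real_modular p g + real_modular p h)
        + C * (\<integral>x. convexity_gap (p x) (g x) (h x) \<partial>M)"
      unfolding real_modular_def using integrable by simp
    also have "(\<integral>x. convexity_gap (p x) (g x) (h x) \<partial>M) \<le> m * energy_gap p g h"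
      unfolding energy_gap_def
      by (intro integral_le_upper_mult_div_exponent integrable convexity_gap_nonneg p_gt_1)
    finally show "real_modular p (\<lambda>x. g x - h x)
        \<le> e * (real_modular p g + real_modular p h) + C * m * energy_gap p g h"
      using C(1) by (simp add: mult_left_mono mult.assoc)
  qed
qed

lemma integrable_flux:
  fixes g h :: "'a \<Rightarrow> 'b::euclidean_space"
  assumes g: "g \<in> Lp_field \<Omega> p" and h: "h \<in> Lp_field \<Omega> p"
  shows "integrable M (\<lambda>x. power_flux (p x) (g x) \<bullet> h x)"
proof (rule Bochner_Integration.integrable_bound)
  have [measurable]: "g \<in> borel_measurable M" "h \<in> borel_measurable M"
    using g h by (simp_all add: Lp_field_def)
  show "(\<lambda>x. power_flux (p x) (g x) \<bullet> h x) \<in> borel_measurable M" by measurable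
  show "integrable M (\<lambda>x. norm (g x) powr p x + norm (h x) powr p x)"
    by (intro Bochner_Integration.integrable_add integrable_norm_powr g h)
  show "AE x in M. norm (power_flux (p x) (g x) \<bullet> h x)
      \<le> norm (norm (g x) powr p x + norm (h x) powr p x)"
    using power_flux_inner_le p_gt_1 by (intro AE_I2) auto
qed

lemma abs_flux_pairing_le:
  assumes g: "g \<in> Lp_field \<Omega> p" and h: "h \<in> Lp_field \<Omega> p"
  shows "\<bar>flux_pairing p g h\<bar> \<le> real_modular p g + real_modular p h"
proof -
  have "\<bar>flux_pairing p g h\<bar> \<le> (\<integral>x. norm (power_flux (p x) (g x) \<bullet> h x) \<partial>M)"
    unfolding flux_pairing_def real_norm_def[symmetric] by (rule integral_norm_bound)
  also have "\<dots> \<le> (\<integral>x. norm (g x) powr p x + norm (h x) powr p x \<partial>M)"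
    using power_flux_inner_le p_gt_1
    by (intro integral_mono integrable_norm integrable_flux g h Bochner_Integration.integrable_add
        integrable_norm_powr) auto
  also have "\<dots> = real_modular p g + real_modular p h"
    unfolding real_modular_def
    by (intro Bochner_Integration.integral_add integrable_norm_powr g h)
  finally show ?thesis .
qed

lemma dirichlet_energy_ge_tangent:
  assumes g: "g \<in> Lp_field \<Omega> p" and h: "h \<in> Lp_field \<Omega> p"
  shows "dirichlet_energy p g + flux_pairing p g (\<lambda>x. h x - g x) \<le> dirichlet_energy p h"
proof -
  note integrable = integrable_div_exponent[OF integrable_norm_powr[OF g]]
    integrable_div_exponent[OF integrable_norm_powr[OF h]]
    integrable_flux[OF g Lp_field_diff[OF h g]]
  have "norm (g x) powr p x / p x + power_flux (p x) (g x) \<bullet> (h x - g x)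
      \<le> norm (h x) powr p x / p x"
    if x: "x \<in> \<Omega>" for x
  proof -
    have "(norm (g x) powr p x + p x * (power_flux (p x) (g x) \<bullet> (h x - g x))) / p x
        \<le> norm (h x) powr p x / p x"
      using p_gt_1[OF x] by (intro divide_right_mono norm_powr_ge_tangent) auto
    then show ?thesis using p_gt_1[OF x] by (simp add: add_divide_distrib)
  qed
  then have "(\<integral>x. norm (g x) powr p x / p x + power_flux (p x) (g x) \<bullet> (h x - g x) \<partial>M)
      \<le> dirichlet_energy p h"
    unfolding dirichlet_energy_def using integrable by (intro integral_mono) auto
  then show ?thesis
    unfolding dirichlet_energy_def flux_pairing_def using integrable by simp
qed

lemma flux_pairing_perturbed_tendsto:
  fixes g h :: "'a \<Rightarrow> 'b::euclidean_space"
  assumes g: "g \<in> Lp_field \<Omega> p" and h: "h \<in> Lp_field \<Omega> p"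
  shows "(\<lambda>n. flux_pairing p (\<lambda>x. g x + inverse (real (Suc n)) *\<^sub>R h x) h) \<longlonglongrightarrow> flux_pairing p g h"
  unfolding flux_pairing_def
proof (rule integral_dominated_convergence)
  have [measurable]: "g \<in> borel_measurable M" "h \<in> borel_measurable M"
    using g h by (simp_all add: Lp_field_def)
  let ?t = "\<lambda>n. inverse (real (Suc n))"
  let ?w = "\<lambda>x. 2 powr m * (norm (g x) powr p x + norm (h x) powr p x) + norm (h x) powr p x"
  show "integrable M ?w"
    using integrable_norm_powr[OF g] integrable_norm_powr[OF h] by simp
  show "(\<lambda>x. power_flux (p x) (g x) \<bullet> h x) \<in> borel_measurable M"
    "(\<lambda>x. power_flux (p x) (g x + ?t n *\<^sub>R h x) \<bullet> h x) \<in> borel_measurable M" for n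
    by measurable
  show "AE x in M. (\<lambda>n. power_flux (p x) (g x + ?t n *\<^sub>R h x) \<bullet> h x) \<longlonglongrightarrow> power_flux (p x) (g x) \<bullet> h x"
  proof (rule AE_I2)
    fix x assume "x \<in> space M"
    then have "isCont (power_flux (p x)) (g x)" by (intro isCont_power_flux p_gt_1) simp
    moreover have "(\<lambda>n. g x + ?t n *\<^sub>R h x) \<longlonglongrightarrow> g x + 0 *\<^sub>R h x"
      by (intro tendsto_intros LIMSEQ_inverse_real_of_nat)
    ultimately have "(\<lambda>n. power_flux (p x) (g x + ?t n *\<^sub>R h x)) \<longlonglongrightarrow> power_flux (p x) (g x)"
      using isCont_tendsto_compose[of "g x" "power_flux (p x)"] by simp
    then show "(\<lambda>n. power_flux (p x) (g x + ?t n *\<^sub>R h x) \<bullet> h x) \<longlonglongrightarrow> power_flux (p x) (g x) \<bullet> h x"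
      by (intro tendsto_inner tendsto_const)
  qed
  show "AE x in M. norm (power_flux (p x) (g x + ?t n *\<^sub>R h x) \<bullet> h x) \<le> ?w x" for n
  proof (rule AE_I2)
    fix x assume "x \<in> space M"
    then have x: "x \<in> \<Omega>" by simp
    have "\<bar>power_flux (p x) (g x + ?t n *\<^sub>R h x) \<bullet> h x\<bar>
        \<le> 2 powr p x * (norm (g x) powr p x + norm (h x) powr p x) + norm (h x) powr p x"
      by (intro power_flux_perturbed_inner_le p_gt_1 x) (auto simp: inverse_le_1_iff)
    also have "\<dots> \<le> ?w x"
      using p_le_m[OF x] by (intro add_right_mono mult_right_mono powr_mono) auto
    finally show "norm (power_flux (p x) (g x + ?t n *\<^sub>R h x) \<bullet> h x) \<le> ?w x" by simp
  qed
qed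

lemma flux_pairing_monotone:
  assumes g: "g \<in> Lp_field \<Omega> p" and h: "h \<in> Lp_field \<Omega> p"
  defines "D \<equiv> flux_pairing p g (\<lambda>x. g x - h x) - flux_pairing p h (\<lambda>x. g x - h x)"
  shows "0 \<le> D" "D = 0 \<Longrightarrow> AE x in M. g x = h x"
proof -
  let ?I = "\<lambda>x. power_flux (p x) (g x) \<bullet> (g x - h x) - power_flux (p x) (h x) \<bullet> (g x - h x)"
  note integrable = integrable_flux[OF g Lp_field_diff[OF g h]]
    integrable_flux[OF h Lp_field_diff[OF g h]]
  have D: "D = (\<integral>x. ?I x \<partial>M)"
    unfolding D_def flux_pairing_def using integrable by simp
  have pos: "0 < ?I x" if "x \<in> \<Omega>" "g x \<noteq> h x" for x
    using that by (intro power_flux_strict_mono p_gt_1)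
  then have nonneg: "AE x in M. 0 \<le> ?I x"
    by (intro AE_I2) (metis diff_self inner_zero_right less_imp_le order_refl space_lebesgue_on)
  then show "0 \<le> D" unfolding D by (rule Bochner_Integration.integral_nonneg_AE)
  assume "D = 0"
  then have "AE x in M. ?I x = 0"
    using integral_nonneg_eq_0_iff_AE[OF Bochner_Integration.integrable_diff[OF integrable] nonneg]
    unfolding D by simp
  then show "AE x in M. g x = h x"
    using AE_space by eventually_elim (use pos in force)
qed

end

section \<open>The multi-phase problem\<close>

lemma continuous_on_Max_family:
  fixes f :: "'i \<Rightarrow> 'a::topological_space \<Rightarrow> 'b::linorder_topology"
  assumes "finite I" "I \<noteq> {}" "\<And>i. i \<in> I \<Longrightarrow> continuous_on S (f i)"
  shows "continuous_on S (\<lambda>x. Max ((\<lambda>i. f i x) ` I))"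
  using assms
proof (induction I rule: finite_ne_induct)
  case (insert j J)
  then have "continuous_on S (\<lambda>x. max (f j x) (Max ((\<lambda>i. f i x) ` J)))"
    by (intro continuous_on_max) auto
  with insert.hyps show ?case by simp
qed simp

locale multi_phase_problem = bounded_domain \<Omega> for \<Omega> :: "'a::euclidean_space set" +
  fixes p :: "'i::finite \<Rightarrow> 'a \<Rightarrow> real" and \<alpha> f :: "'a \<Rightarrow> real" and l m :: real
  assumes C_plus_p: "C_plus \<Omega> (p i)" and C_plus_\<alpha>: "C_plus \<Omega> \<alpha>"
    and bounded_exponent_p: "bounded_exponent \<Omega> (p i) l m"
    and subcritical: "x \<in> closure \<Omega> \<Longrightarrow>
      1 / \<alpha> x + 1 / Max (range (\<lambda>i. p i x)) < 1 + 1 / real DIM('a)"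
    and f_Lp_var: "f \<in> Lp_var \<Omega> \<alpha>"
begin

sublocale phase: exponent_on_domain \<Omega> "p i" l m for i
  by (intro exponent_on_domain.intro bounded_exponent_p) unfold_locales

definition W0_grad_all :: "('a \<Rightarrow> real) \<Rightarrow> ('a \<Rightarrow> 'a) \<Rightarrow> bool" where
  "W0_grad_all u g \<longleftrightarrow> (\<forall>i. W0_grad \<Omega> (p i) u g)"

definition total_modular :: "('a \<Rightarrow> 'a) \<Rightarrow> real" where
  "total_modular g = (\<Sum>i\<in>UNIV. real_modular (p i) g)"

definition total_energy :: "('a \<Rightarrow> 'a) \<Rightarrow> real" where
  "total_energy g = (\<Sum>i\<in>UNIV. dirichlet_energy (p i) g)"

definition total_flux :: "('a \<Rightarrow> 'a) \<Rightarrow> ('a \<Rightarrow> 'a) \<Rightarrow> real" where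
  "total_flux g h = (\<Sum>i\<in>UNIV. flux_pairing (p i) g h)"

definition load :: "('a \<Rightarrow> real) \<Rightarrow> real" where
  "load u = (\<integral>x. f x * u x \<partial>M)"

definition functional :: "('a \<Rightarrow> real) \<Rightarrow> ('a \<Rightarrow> 'a) \<Rightarrow> real" where
  "functional u g = total_energy g - load u"

lemma W0_grad_all_iff:
  "W0_grad_all u g \<longleftrightarrow> (\<forall>i. u \<in> W0 \<Omega> (p i)) \<and> weak_grad \<Omega> u g"
  using phase.W0_grad_any_weak_grad phase.W0_gradD(1)
  unfolding W0_grad_all_def W0_def by blast

lemma W0_grad_all_lincomb:
  "W0_grad_all u g \<Longrightarrow> W0_grad_all v h \<Longrightarrow>
    W0_grad_all (\<lambda>x. c * u x + d * v x) (\<lambda>x. c *\<^sub>R g x + d *\<^sub>R h x)"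
  by (simp add: W0_grad_all_def phase.W0_grad_lincomb)

lemma W0_grad_all_0: "W0_grad_all (\<lambda>_. 0) (\<lambda>_. 0)"
  by (simp add: W0_grad_all_def phase.W0_grad_0)

lemma W0_grad_all_scale: "W0_grad_all u g \<Longrightarrow> W0_grad_all (\<lambda>x. c * u x) (\<lambda>x. c *\<^sub>R g x)"
  by (simp add: W0_grad_all_def phase.W0_grad_scale)

lemma W0_grad_all_diff:
  "W0_grad_all u g \<Longrightarrow> W0_grad_all v h \<Longrightarrow> W0_grad_all (\<lambda>x. u x - v x) (\<lambda>x. g x - h x)"
  using W0_grad_all_lincomb[of u g v h 1 "- 1"] by simp

lemma W0_grad_all_Lp_field:
  assumes "W0_grad_all u g"
  shows "u \<in> Lp_field \<Omega> (p i)" "g \<in> Lp_field \<Omega> (p i)"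
  using assms phase.W0_gradD(2,3) unfolding W0_grad_all_def by blast+

lemma W0_grad_all_measurable:
  assumes "W0_grad_all u g"
  shows "u \<in> borel_measurable M" "g \<in> borel_measurable M"
  using assms phase.W0_gradD(4,5) unfolding W0_grad_all_def by blast+

lemma W0_grad_all_eq_0:
  assumes u: "W0_grad_all u g" and g: "AE x in M. g x = 0"
  shows "AE x in M. u x = 0"
proof -
  have "W0_grad \<Omega> (p undefined) u g" using u by (simp add: W0_grad_all_def)
  then have "AE x in M. ennreal (half_annulus_vol TYPE('a)) * ennreal \<bar>u x\<bar> \<le> 0"
    using phase.W0_grad_le_potential potential_eq_0[OF g] by fastforce
  then show ?thesis
  proof eventually_elim
    case (elim x)
    then show ?case using half_annulus_vol_pos[where 'a='a] by (auto simp: ennreal_eq_0_iff)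
  qed
qed

lemma total_modular_nonneg: "0 \<le> total_modular g"
  by (simp add: total_modular_def sum_nonneg real_modular_nonneg)

lemma real_modular_le_total_modular: "real_modular (p i) g \<le> total_modular g"
  unfolding total_modular_def by (intro member_le_sum) (auto simp: real_modular_nonneg)

lemma total_modular_scaleR_le_upper:
  assumes "W0_grad_all u g"
  shows "total_modular (\<lambda>x. c *\<^sub>R g x) \<le> max 1 \<bar>c\<bar> powr m * total_modular g"
  unfolding total_modular_def sum_distrib_left
  by (intro sum_mono phase.real_modular_scaleR_le_upper W0_grad_all_Lp_field(2)[OF assms])

lemma total_modular_scaleR_le_lower:
  assumes "W0_grad_all u g" "\<bar>c\<bar> \<le> 1"
  shows "total_modular (\<lambda>x. c *\<^sub>R g x) \<le> \<bar>c\<bar> powr l * total_modular g"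
  unfolding total_modular_def sum_distrib_left
  by (intro sum_mono phase.real_modular_scaleR_le_lower assms(2)
      W0_grad_all_Lp_field(2)[OF assms(1)])

lemma total_energy_nonneg: "0 \<le> total_energy g"
  by (simp add: total_energy_def sum_nonneg phase.dirichlet_energy_nonneg)

lemma total_modular_le_total_energy:
  assumes "W0_grad_all u g"
  shows "total_modular g \<le> m * total_energy g"
  unfolding total_modular_def total_energy_def sum_distrib_left
  by (intro sum_mono phase.real_modular_le_dirichlet_energy W0_grad_all_Lp_field(2)[OF assms])

lemma total_energy_ge_tangent:
  assumes "W0_grad_all u g" "W0_grad_all v h"
  shows "total_energy g + total_flux g (\<lambda>x. h x - g x) \<le> total_energy h"
  unfolding total_energy_def total_flux_def sum.distrib[symmetric]
  by (intro sum_mono phase.dirichlet_energy_ge_tangent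
      W0_grad_all_Lp_field(2)[OF assms(1)] W0_grad_all_Lp_field(2)[OF assms(2)])

lemma abs_total_flux_le:
  assumes "W0_grad_all u g" "W0_grad_all v h"
  shows "\<bar>total_flux g h\<bar> \<le> total_modular g + total_modular h"
  unfolding total_flux_def total_modular_def sum.distrib[symmetric]
  by (intro order_trans[OF sum_abs] sum_mono phase.abs_flux_pairing_le
      W0_grad_all_Lp_field(2)[OF assms(1)] W0_grad_all_Lp_field(2)[OF assms(2)])

lemma total_flux_scaleR: "total_flux g (\<lambda>x. c *\<^sub>R h x) = c * total_flux g h"
  by (simp add: total_flux_def flux_pairing_scaleR sum_distrib_left)

lemma f_measurable: "f \<in> borel_measurable M"
  using f_Lp_var by (simp add: Lp_var_def)

lemma load_scale: "load (\<lambda>x. c * u x) = c * load u"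
  by (simp add: load_def mult.left_commute)

section \<open>Boundedness of the load\<close>

definition max_exponent :: "'a \<Rightarrow> real" where
  "max_exponent x = Max (range (\<lambda>i. p i x))"

lemma max_exponent_attained: "\<exists>i. max_exponent x = p i x"
proof -
  have "max_exponent x \<in> range (\<lambda>i. p i x)"
    unfolding max_exponent_def by (intro Max_in) auto
  then show ?thesis by blast
qed

lemma C_plus_max_exponent: "C_plus \<Omega> max_exponent"
proof -
  have "continuous_on (closure \<Omega>) max_exponent"
    unfolding max_exponent_def
    using C_plus_p by (intro continuous_on_Max_family) (auto simp: C_plus_def)
  moreover have "1 < max_exponent x" if "x \<in> closure \<Omega>" for x
    using max_exponent_attained[of x] C_plus_p that by (auto simp: C_plus_def)
  ultimately show ?thesis by (simp add: C_plus_def)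
qed

lemma norm_modular_max_exponent_le:
  assumes "W0_grad_all u g"
  shows "norm_modular \<Omega> max_exponent g \<le> ennreal (total_modular g)"
proof -
  note [measurable] = W0_grad_all_measurable[OF assms]
  have "norm_modular \<Omega> max_exponent g \<le> (\<integral>\<^sup>+x. (\<Sum>i\<in>UNIV. ennreal (norm (g x) powr p i x)) \<partial>M)"
    unfolding modular_def
  proof (rule nn_integral_mono)
    fix x
    obtain j where "max_exponent x = p j x" using max_exponent_attained by blast
    then show "ennreal (\<bar>norm (g x)\<bar> powr max_exponent x)
        \<le> (\<Sum>i\<in>UNIV. ennreal (norm (g x) powr p i x))"
      using member_le_sum[of j UNIV "\<lambda>i. ennreal (norm (g x) powr p i x)"] by simp
  qed
  also have "\<dots> = (\<Sum>i\<in>UNIV. norm_modular \<Omega> (p i) g)"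
    unfolding modular_def abs_norm_cancel by (rule nn_integral_sum) measurable
  also have "\<dots> = ennreal (total_modular g)"
    unfolding total_modular_def
    by (simp add: phase.norm_modular_eq_real_modular W0_grad_all_Lp_field(2)[OF assms]
        real_modular_nonneg sum_ennreal)
  finally show ?thesis .
qed

lemma nn_integral_load_bounded:
  obtains C where "0 \<le> C"
    "\<And>u g. W0_grad_all u g \<Longrightarrow> (\<integral>\<^sup>+x. ennreal \<bar>f x * u x\<bar> \<partial>M) \<le> ennreal (C * (1 + total_modular g))"
proof -
  obtain c where c: "0 \<le> c"
    "\<And>(h :: 'a \<Rightarrow> real) u g. h \<in> borel_measurable M \<Longrightarrow> W0_grad \<Omega> (p undefined) u g \<Longrightarrow>
      (\<integral>\<^sup>+x. ennreal \<bar>h x * u x\<bar> \<partial>M)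
        \<le> ennreal c * ((1 + modular \<Omega> \<alpha> h) * (1 + norm_modular \<Omega> max_exponent g))"
    using phase.W0_pairing_bounded[OF C_plus_\<alpha> C_plus_max_exponent
        subcritical[folded max_exponent_def]] by blast
  obtain \<mu> where \<mu>: "0 \<le> \<mu>" "modular \<Omega> \<alpha> f = ennreal \<mu>"
    using f_Lp_var by (cases "modular \<Omega> \<alpha> f") (auto simp: Lp_var_def)
  show ?thesis
  proof (rule that)
    show "0 \<le> c * (1 + \<mu>)" using c(1) \<mu>(1) by simp
    fix u g assume u: "W0_grad_all u g"
    have "(\<integral>\<^sup>+x. ennreal \<bar>f x * u x\<bar> \<partial>M)
        \<le> ennreal c * ((1 + ennreal \<mu>) * (1 + norm_modular \<Omega> max_exponent g))"
      unfolding \<mu>(2)[symmetric] using u by (intro c(2) f_measurable) (simp add: W0_grad_all_def)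
    also have "\<dots> \<le> ennreal c * ((1 + ennreal \<mu>) * (1 + ennreal (total_modular g)))"
      by (intro mult_left_mono add_left_mono norm_modular_max_exponent_le[OF u]) auto
    also have "\<dots> = ennreal c * (ennreal (1 + \<mu>) * ennreal (1 + total_modular g))"
      using \<mu>(1) by (simp add: total_modular_nonneg)
    also have "\<dots> = ennreal (c * (1 + \<mu>) * (1 + total_modular g))"
      using c(1) \<mu>(1) total_modular_nonneg[of g]
      by (simp only: ennreal_mult[symmetric] mult.assoc add_nonneg_nonneg mult_nonneg_nonneg
          zero_le_one)
    finally show "(\<integral>\<^sup>+x. ennreal \<bar>f x * u x\<bar> \<partial>M) \<le> ennreal (c * (1 + \<mu>) * (1 + total_modular g))" .
  qed
qed

lemma load_integrable:
  assumes u: "W0_grad_all u g"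
  shows "integrable M (\<lambda>x. f x * u x)"
proof -
  note [measurable] = f_measurable W0_grad_all_measurable[OF u]
  obtain C where "(\<integral>\<^sup>+x. ennreal \<bar>f x * u x\<bar> \<partial>M) \<le> ennreal (C * (1 + total_modular g))"
    using nn_integral_load_bounded u by blast
  then have "(\<integral>\<^sup>+x. ennreal (norm (f x * u x)) \<partial>M) < \<infinity>"
    unfolding real_norm_def by (rule le_less_trans) simp
  then show ?thesis by (intro integrableI_bounded) measurable
qed

lemma load_bounded:
  obtains C where "0 \<le> C" "\<And>u g. W0_grad_all u g \<Longrightarrow> \<bar>load u\<bar> \<le> C * (1 + total_modular g)"
proof -
  obtain C where C: "0 \<le> C"
    "\<And>u g. W0_grad_all u g \<Longrightarrow> (\<integral>\<^sup>+x. ennreal \<bar>f x * u x\<bar> \<partial>M) \<le> ennreal (C * (1 + total_modular g))"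
    using nn_integral_load_bounded by blast
  have "\<bar>load u\<bar> \<le> C * (1 + total_modular g)" if u: "W0_grad_all u g" for u g
  proof -
    have "ennreal \<bar>load u\<bar> \<le> ennreal (C * (1 + total_modular g))"
      unfolding load_def
      using integral_norm_bound_ennreal[OF load_integrable[OF u]] C(2)[OF u]
      by (auto intro: order_trans)
    then show ?thesis
      using C(1) total_modular_nonneg[of g] by (subst (asm) ennreal_le_iff) auto
  qed
  with C(1) show ?thesis by (rule that)
qed

lemma load_lincomb:
  assumes "W0_grad_all u g" "W0_grad_all v h"
  shows "load (\<lambda>x. c * u x + d * v x) = c * load u + d * load v"
proof -
  have "load (\<lambda>x. c * u x + d * v x) = (\<integral>x. c * (f x * u x) + d * (f x * v x) \<partial>M)"
    unfolding load_def by (simp add: algebra_simps)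
  also have "\<dots> = c * load u + d * load v"
    unfolding load_def using load_integrable[OF assms(1)] load_integrable[OF assms(2)] by simp
  finally show ?thesis .
qed

section \<open>Homogeneous functionals bounded by the modular\<close>

lemma homogeneous_functional_bound_by_scaling:
  assumes homogeneous: "\<And>c u g. \<Lambda> (\<lambda>x. c * u x) (\<lambda>x. c *\<^sub>R g x) = c * \<Lambda> u g"
    and bound: "\<And>u g. W0_grad_all u g \<Longrightarrow> \<bar>\<Lambda> u g\<bar> \<le> C * (1 + total_modular g)"
    and u: "W0_grad_all u g" and c: "0 < c"
  shows "\<bar>\<Lambda> u g\<bar> \<le> C / c * (1 + total_modular (\<lambda>x. c *\<^sub>R g x))"
proof -
  have "c * \<bar>\<Lambda> u g\<bar> = \<bar>\<Lambda> (\<lambda>x. c * u x) (\<lambda>x. c *\<^sub>R g x)\<bar>"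
    using c by (simp add: homogeneous abs_mult)
  also have "\<dots> \<le> C * (1 + total_modular (\<lambda>x. c *\<^sub>R g x))"
    by (rule bound[OF W0_grad_all_scale[OF u]])
  finally show ?thesis using c by (simp add: field_simps)
qed

lemma homogeneous_functional_tendsto_0:
  assumes homogeneous: "\<And>c u g. \<Lambda> (\<lambda>x. c * u x) (\<lambda>x. c *\<^sub>R g x) = c * \<Lambda> u g"
    and "0 \<le> C" and bound: "\<And>u g. W0_grad_all u g \<Longrightarrow> \<bar>\<Lambda> u g\<bar> \<le> C * (1 + total_modular g)"
    and UG: "\<And>n. W0_grad_all (U n) (G n)" and lim: "(\<lambda>n. total_modular (G n)) \<longlonglongrightarrow> 0"
  shows "(\<lambda>n. \<Lambda> (U n) (G n)) \<longlonglongrightarrow> 0"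
proof (rule tendstoI)
  fix e :: real assume e: "0 < e"
  define t where "t = 1 + 2 * C / e"
  have t: "1 \<le> t" "2 * C / t < e"
    using e \<open>0 \<le> C\<close> by (simp_all add: t_def field_simps add_pos_nonneg)
  have "\<forall>\<^sub>F n in sequentially. total_modular (G n) < t powr (- m)"
    using lim by (rule order_tendstoD(2)) (use t in simp)
  then show "\<forall>\<^sub>F n in sequentially. dist (\<Lambda> (U n) (G n)) 0 < e"
  proof eventually_elim
    case (elim n)
    have "total_modular (\<lambda>x. t *\<^sub>R G n x) \<le> t powr m * total_modular (G n)"
      using total_modular_scaleR_le_upper[OF UG[of n], of t] t(1) by simp
    also have "\<dots> \<le> t powr m * t powr (- m)" using elim by (intro mult_left_mono) auto
    also have "\<dots> = 1" using t(1) by (simp flip: powr_add)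
    finally have "C / t * (1 + total_modular (\<lambda>x. t *\<^sub>R G n x)) \<le> C / t * (1 + 1)"
      using \<open>0 \<le> C\<close> t(1) by (intro mult_left_mono add_left_mono) auto
    moreover have "\<bar>\<Lambda> (U n) (G n)\<bar> \<le> C / t * (1 + total_modular (\<lambda>x. t *\<^sub>R G n x))"
      using t(1) by (intro homogeneous_functional_bound_by_scaling homogeneous bound UG) auto
    ultimately show ?case using t(2) by simp
  qed
qed

lemma load_coercive:
  obtains K where "\<And>u g. W0_grad_all u g \<Longrightarrow> \<bar>load u\<bar> \<le> total_energy g / 2 + K"
proof -
  obtain C where C: "0 \<le> C" "\<And>u g. W0_grad_all u g \<Longrightarrow> \<bar>load u\<bar> \<le> C * (1 + total_modular g)"
    using load_bounded by blast
  have lm: "1 < l" "1 < m" using phase.l_gt_1 phase.l_le_m by auto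
  define s where "s = max 1 (2 * C * m) powr (1 / (l - 1))"
  have s: "1 \<le> s" unfolding s_def using lm by (intro ge_one_powr_ge_zero) auto
  have "s powr (l - 1) = max 1 (2 * C * m)" unfolding s_def powr_powr using lm by simp
  then have s_large: "2 * C * m \<le> s powr (l - 1)" by simp
  have "\<bar>load u\<bar> \<le> total_energy g / 2 + C * s" if u: "W0_grad_all u g" for u g
  proof -
    have "\<bar>load u\<bar> \<le> C / (1/s) * (1 + total_modular (\<lambda>x. (1/s) *\<^sub>R g x))"
      using s
      by (intro homogeneous_functional_bound_by_scaling[of "\<lambda>u g. load u"] load_scale C(2) u) auto
    also have "\<dots> = C * s * (1 + total_modular (\<lambda>x. (1/s) *\<^sub>R g x))" by simp
    also have "\<dots> \<le> C * s * (1 + (1/s) powr l * (m * total_energy g))"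
    proof (intro mult_left_mono add_left_mono)
      have "total_modular (\<lambda>x. (1/s) *\<^sub>R g x) \<le> (1/s) powr l * total_modular g"
        using total_modular_scaleR_le_lower[OF u, of "1/s"] s by simp
      also have "\<dots> \<le> (1/s) powr l * (m * total_energy g)"
        by (intro mult_left_mono total_modular_le_total_energy[OF u]) simp
      finally show "total_modular (\<lambda>x. (1/s) *\<^sub>R g x) \<le> (1/s) powr l * (m * total_energy g)" .
    qed (use C s in simp)
    also have "\<dots> = C * s + (C * m * (s * (1/s) powr l)) * total_energy g"
      by (simp add: algebra_simps)
    also have "s * (1/s) powr l = 1 / s powr (l - 1)" using s by (simp add: powr_divide powr_diff)
    also have "(C * m * (1 / s powr (l - 1))) * total_energy g \<le> (1 / 2) * total_energy g"
      using s_large s total_energy_nonneg[of g] by (intro mult_right_mono) (auto simp: field_simps)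
    finally show ?thesis by simp
  qed
  then show ?thesis by (rule that)
qed

section \<open>Existence of a minimizer\<close>

lemma total_energy_le_functional:
  obtains K where "\<And>u g. W0_grad_all u g \<Longrightarrow> total_energy g \<le> 2 * functional u g + K"
proof -
  obtain K where K: "\<And>u g. W0_grad_all u g \<Longrightarrow> \<bar>load u\<bar> \<le> total_energy g / 2 + K"
    using load_coercive by blast
  have "total_energy g \<le> 2 * functional u g + 2 * K" if "W0_grad_all u g" for u g
    using K[OF that] unfolding functional_def by argo
  then show ?thesis by (rule that)
qed

lemma functional_midpoint:
  assumes u: "W0_grad_all u g" and v: "W0_grad_all v h"
  shows "functional (\<lambda>x. (1/2) * u x + (1/2) * v x) (\<lambda>x. (1/2) *\<^sub>R g x + (1/2) *\<^sub>R h x)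
    = (functional u g + functional v h) / 2 - (\<Sum>i\<in>UNIV. energy_gap (p i) g h)"
proof -
  have "total_energy (\<lambda>x. (1/2) *\<^sub>R g x + (1/2) *\<^sub>R h x)
      = (total_energy g + total_energy h) / 2 - (\<Sum>i\<in>UNIV. energy_gap (p i) g h)"
    by (simp add: total_energy_def phase.dirichlet_energy_midpoint[OF
          W0_grad_all_Lp_field(2)[OF u] W0_grad_all_Lp_field(2)[OF v], simplified]
        sum_subtractf sum.distrib flip: sum_divide_distrib)
  then show ?thesis
    unfolding functional_def load_lincomb[OF u v] by argo
qed

lemma energy_gap_le:
  assumes u: "W0_grad_all u g" and v: "W0_grad_all v h"
    and lower: "\<And>u g. W0_grad_all u g \<Longrightarrow> \<mu> \<le> functional u g"
  shows "energy_gap (p i) g h \<le> (functional u g + functional v h) / 2 - \<mu>"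
proof -
  have "energy_gap (p i) g h \<le> (\<Sum>i\<in>UNIV. energy_gap (p i) g h)"
    by (rule member_le_sum) (auto simp: phase.energy_gap_nonneg)
  with lower[OF W0_grad_all_lincomb[OF u v, of "1/2" "1/2"]] show ?thesis
    unfolding functional_midpoint[OF u v] by linarith
qed

lemma sublevel_total_modular_bounded:
  obtains R where "0 < R"
    "\<And>u g. W0_grad_all u g \<Longrightarrow> functional u g \<le> c \<Longrightarrow> total_modular g \<le> R"
proof -
  obtain K where K: "\<And>u g. W0_grad_all u g \<Longrightarrow> total_energy g \<le> 2 * functional u g + K"
    using total_energy_le_functional by blast
  have "1 < m" using phase.l_gt_1 phase.l_le_m by force
  show ?thesis
  proof (rule that)
    show "0 < m * max 1 (2 * c + K)" using \<open>1 < m\<close> by simp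
    fix u g assume u: "W0_grad_all u g" and "functional u g \<le> c"
    then have "total_energy g \<le> max 1 (2 * c + K)" using K[OF u] by simp
    then have "m * total_energy g \<le> m * max 1 (2 * c + K)"
      using \<open>1 < m\<close> by (intro mult_left_mono) auto
    with total_modular_le_total_energy[OF u]
    show "total_modular g \<le> m * max 1 (2 * c + K)" by (rule order_trans)
  qed
qed

lemma real_modular_diff_le_functional_excess:
  assumes lower: "\<And>u g. W0_grad_all u g \<Longrightarrow> \<mu> \<le> functional u g" and e: "0 < e"
  obtains C where "0 \<le> C"
    "\<And>u g v h. W0_grad_all u g \<Longrightarrow> W0_grad_all v h \<Longrightarrow> functional u g \<le> c \<Longrightarrow> functional v h \<le> c \<Longrightarrow>
      real_modular (p i) (\<lambda>x. g x - h x) \<le> e + C * ((functional u g + functional v h) / 2 - \<mu>)"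
proof -
  obtain R where R: "0 < R"
    "\<And>u g. W0_grad_all u g \<Longrightarrow> functional u g \<le> c \<Longrightarrow> total_modular g \<le> R"
    using sublevel_total_modular_bounded[of c] by blast
  have "0 < e / (2 * R)" using e R(1) by simp
  then obtain C where C: "0 \<le> C" "\<And>g h :: 'a \<Rightarrow> 'a. g \<in> Lp_field \<Omega> (p i) \<Longrightarrow> h \<in> Lp_field \<Omega> (p i) \<Longrightarrow>
      real_modular (p i) (\<lambda>x. g x - h x)
        \<le> e / (2 * R) * (real_modular (p i) g + real_modular (p i) h) + C * energy_gap (p i) g h"
    using phase.real_modular_diff_le_energy_gap[where 'b='a] by blast
  show ?thesis
  proof (rule that[OF C(1)])
    fix u g v h
    assume u: "W0_grad_all u g" and v: "W0_grad_all v h"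
      and sublevel: "functional u g \<le> c" "functional v h \<le> c"
    note C(2)[OF W0_grad_all_Lp_field(2)[OF u] W0_grad_all_Lp_field(2)[OF v]]
    also have "e / (2 * R) * (real_modular (p i) g + real_modular (p i) h) \<le> e / (2 * R) * (R + R)"
      using e R(1) order_trans[OF real_modular_le_total_modular R(2)[OF u sublevel(1)]]
        order_trans[OF real_modular_le_total_modular R(2)[OF v sublevel(2)]]
      by (intro mult_left_mono add_mono) auto
    also have "\<dots> = e" using R(1) by (simp add: field_simps)
    also have "C * energy_gap (p i) g h \<le> C * ((functional u g + functional v h) / 2 - \<mu>)"
      by (intro mult_left_mono energy_gap_le[OF u v lower] C(1))
    finally show "real_modular (p i) (\<lambda>x. g x - h x)
        \<le> e + C * ((functional u g + functional v h) / 2 - \<mu>)"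
      by simp
  qed
qed

lemma minimizing_sequence_modular_Cauchy:
  assumes UG: "\<And>n. W0_grad_all (U n) (G n)"
    and lower: "\<And>u g. W0_grad_all u g \<Longrightarrow> \<mu> \<le> functional u g"
    and minimizing: "\<And>n. functional (U n) (G n) < \<mu> + 1 / real (Suc n)"
  shows "modular_Cauchy \<Omega> (p i) G"
  unfolding modular_Cauchy_def
proof (intro allI impI)
  fix e :: real assume e: "0 < e"
  then have half: "0 < e / 2" by simp
  obtain C where C: "0 \<le> C" "\<And>u g v h. W0_grad_all u g \<Longrightarrow> W0_grad_all v h \<Longrightarrow>
      functional u g \<le> \<mu> + 1 \<Longrightarrow> functional v h \<le> \<mu> + 1 \<Longrightarrow>
      real_modular (p i) (\<lambda>x. g x - h x) \<le> e / 2 + C * ((functional u g + functional v h) / 2 - \<mu>)"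
    using real_modular_diff_le_functional_excess[where c="\<mu> + 1" and i=i, OF lower half] by blast
  obtain N where N: "2 * C / e < real N" using reals_Archimedean2 by blast
  have functional_le: "functional (U n) (G n) \<le> \<mu> + 1 / real (Suc k)" if "k \<le> n" for n k
  proof -
    have "1 / real (Suc n) \<le> 1 / real (Suc k)" using that by (intro divide_left_mono) auto
    then show ?thesis using minimizing[of n] by linarith
  qed
  then have functional_le_1: "functional (U n) (G n) \<le> \<mu> + 1" for n
    using functional_le[of 0 n] by simp
  have "norm_modular \<Omega> (p i) (\<lambda>x. G j x - G k x) \<le> ennreal e" if "j \<ge> N" "k \<ge> N" for j k
  proof -
    note C(2)[OF UG UG functional_le_1 functional_le_1, of j k]
    also have "(functional (U j) (G j) + functional (U k) (G k)) / 2 - \<mu> \<le> 1 / real (Suc N)"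
      using functional_le[OF that(1)] functional_le[OF that(2)] by argo
    also have "C * (1 / real (Suc N)) \<le> e / 2" using N e by (simp add: field_simps)
    finally have "real_modular (p i) (\<lambda>x. G j x - G k x) \<le> e"
      using C(1) by (simp add: mult_left_mono)
    then show ?thesis
      using W0_grad_all_Lp_field(2)[OF W0_grad_all_diff[OF UG[of j] UG[of k]]]
      by (simp add: phase.norm_modular_eq_real_modular ennreal_leI)
  qed
  then show "\<exists>N. \<forall>j\<ge>N. \<forall>k\<ge>N. norm_modular \<Omega> (p i) (\<lambda>x. G j x - G k x) \<le> ennreal e"
    by blast
qed

lemma modular_Cauchy_all_imp_modular_tendsto:
  fixes s :: "nat \<Rightarrow> 'a \<Rightarrow> 'b::{banach, second_countable_topology}"
  assumes s: "\<And>n i. s n \<in> Lp_field \<Omega> (p i)" and Cauchy: "\<And>i. modular_Cauchy \<Omega> (p i) s"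
  obtains t where "t \<in> borel_measurable M" "\<And>i. modular_tendsto \<Omega> (p i) s t"
proof -
  obtain t r where t: "t \<in> borel_measurable M" "strict_mono r" "AE x in M. (\<lambda>k. s (r k) x) \<longlonglongrightarrow> t x"
    using phase.modular_Cauchy_AE_convergent_subseq[OF s Cauchy] by blast
  have "s n \<in> borel_measurable M" for n using s by (simp add: Lp_field_def)
  then have "modular_tendsto \<Omega> (p i) s t" for i
    using phase.modular_Cauchy_imp_modular_tendsto[OF _ Cauchy t(2,3)] by blast
  with t(1) show ?thesis by (rule that)
qed

lemma W0_grad_all_complete:
  assumes UG: "\<And>n. W0_grad_all (U n) (G n)" and Cauchy: "\<And>i. modular_Cauchy \<Omega> (p i) G"
  obtains u g where "W0_grad_all u g" "\<And>i. modular_tendsto \<Omega> (p i) G g"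
proof -
  have "modular_Cauchy \<Omega> (p i) U" for i
    using W0_grad_all_diff[OF UG UG]
    by (intro phase.W0_grad_Cauchy[OF C_plus_p Cauchy]) (simp add: W0_grad_all_def)
  then obtain u where u: "u \<in> borel_measurable M" "\<And>i. modular_tendsto \<Omega> (p i) U u"
    using modular_Cauchy_all_imp_modular_tendsto[of U] W0_grad_all_Lp_field(1)[OF UG] by blast
  obtain g where g: "g \<in> borel_measurable M" "\<And>i. modular_tendsto \<Omega> (p i) G g"
    using modular_Cauchy_all_imp_modular_tendsto[of G] W0_grad_all_Lp_field(2)[OF UG] Cauchy
    by blast
  have "W0_grad_all u g"
    unfolding W0_grad_all_def
    using UG by (intro allI phase.W0_grad_modular_limit[OF _ u(1) g(1) u(2) g(2)])
      (simp add: W0_grad_all_def)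
  then show ?thesis using g(2) by (rule that)
qed

lemma total_modular_diff_tendsto_0:
  assumes UG: "\<And>n. W0_grad_all (U n) (G n)" and u: "W0_grad_all u g"
    and G: "\<And>i. modular_tendsto \<Omega> (p i) G g"
  shows "(\<lambda>n. total_modular (\<lambda>x. G n x - g x)) \<longlonglongrightarrow> 0"
proof -
  have "(\<lambda>n. real_modular (p i) (\<lambda>x. G n x - g x)) \<longlonglongrightarrow> 0" for i
    using G[of i] unfolding modular_tendsto_def
      phase.norm_modular_eq_real_modular[OF W0_grad_all_Lp_field(2)[OF W0_grad_all_diff[OF UG u]]]
    by (simp add: ennreal_tendsto_0_iff real_modular_nonneg)
  then show ?thesis unfolding total_modular_def by (rule tendsto_null_sum)
qed

lemma functional_le_limit:
  assumes UG: "\<And>n. W0_grad_all (U n) (G n)" and u: "W0_grad_all u g"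
    and G: "\<And>i. modular_tendsto \<Omega> (p i) G g"
    and lim: "(\<lambda>n. functional (U n) (G n)) \<longlonglongrightarrow> \<mu>"
  shows "functional u g \<le> \<mu>"
proof -
  define \<Lambda> where "\<Lambda> v h = total_flux g h - load v" for v h
  obtain C where C: "0 \<le> C" "\<And>v h. W0_grad_all v h \<Longrightarrow> \<bar>load v\<bar> \<le> C * (1 + total_modular h)"
    using load_bounded by blast
  have bound: "\<bar>\<Lambda> v h\<bar> \<le> (1 + total_modular g + C) * (1 + total_modular h)"
    if v: "W0_grad_all v h" for v h
  proof -
    have "\<bar>\<Lambda> v h\<bar> \<le> (total_modular g + total_modular h) + C * (1 + total_modular h)"
      unfolding \<Lambda>_def using abs_total_flux_le[OF u v] C(2)[OF v] by linarith
    also have "\<dots> \<le> (1 + total_modular g) * (1 + total_modular h) + C * (1 + total_modular h)"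
      using total_modular_nonneg by (simp add: algebra_simps)
    finally show ?thesis by (simp add: distrib_right)
  qed
  have homogeneous: "\<Lambda> (\<lambda>x. c * v x) (\<lambda>x. c *\<^sub>R h x) = c * \<Lambda> v h" for c v h
    by (simp add: \<Lambda>_def total_flux_scaleR load_scale right_diff_distrib)
  have "(\<lambda>n. \<Lambda> (\<lambda>x. U n x - u x) (\<lambda>x. G n x - g x)) \<longlonglongrightarrow> 0"
    using C(1) total_modular_nonneg[of g]
    by (intro homogeneous_functional_tendsto_0[OF homogeneous _ bound] W0_grad_all_diff UG u
        total_modular_diff_tendsto_0[OF UG u G]) auto
  then have "(\<lambda>n. functional u g + \<Lambda> (\<lambda>x. U n x - u x) (\<lambda>x. G n x - g x)) \<longlonglongrightarrow> functional u g + 0"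
    by (intro tendsto_intros)
  moreover have "functional u g + \<Lambda> (\<lambda>x. U n x - u x) (\<lambda>x. G n x - g x) \<le> functional (U n) (G n)"
    for n
    using total_energy_ge_tangent[OF u UG[of n]] load_lincomb[OF UG u, of 1 n "- 1"]
    by (simp add: \<Lambda>_def functional_def)
  ultimately show ?thesis
    using LIMSEQ_le[OF _ lim] by auto
qed

lemma minimizer_exists:
  obtains u g where "W0_grad_all u g" "\<And>v h. W0_grad_all v h \<Longrightarrow> functional u g \<le> functional v h"
proof -
  define S where "S = {functional u g | u g. W0_grad_all u g}"
  obtain K where K: "\<And>u g. W0_grad_all u g \<Longrightarrow> total_energy g \<le> 2 * functional u g + K"
    using total_energy_le_functional by blast
  have "- K / 2 \<le> functional u g" if "W0_grad_all u g" for u g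
    using K[OF that] total_energy_nonneg[of g] by simp
  then have S: "bdd_below S" "S \<noteq> {}"
    using W0_grad_all_0 by (auto simp: S_def intro!: bdd_belowI[of _ "- K / 2"])
  have lower: "Inf S \<le> functional u g" if "W0_grad_all u g" for u g
    using that by (intro cInf_lower S) (auto simp: S_def)
  have "\<exists>u g. W0_grad_all u g \<and> functional u g < Inf S + 1 / real (Suc n)" for n
    using cInf_lessD[OF S(2), of "Inf S + 1 / real (Suc n)"] by (auto simp: S_def)
  then obtain U G where UG: "\<And>n. W0_grad_all (U n) (G n)"
    and minimizing: "\<And>n. functional (U n) (G n) < Inf S + 1 / real (Suc n)" by metis
  obtain u g where u: "W0_grad_all u g" "\<And>i. modular_tendsto \<Omega> (p i) G g"
    using W0_grad_all_complete[OF UG minimizing_sequence_modular_Cauchy[OF UG lower minimizing]]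
    by blast
  have "(\<lambda>n. functional (U n) (G n)) \<longlonglongrightarrow> Inf S"
  proof (rule tendsto_sandwich[of "\<lambda>_. Inf S" _ _ "\<lambda>n. Inf S + 1 / real (Suc n)"])
    show "(\<lambda>n. Inf S + 1 / real (Suc n)) \<longlonglongrightarrow> Inf S"
      using tendsto_add[OF tendsto_const LIMSEQ_inverse_real_of_nat, of "Inf S"]
      by (simp add: inverse_eq_divide)
  qed (use lower[OF UG] less_imp_le[OF minimizing] in \<open>auto intro!: always_eventually\<close>)
  then have "functional u g \<le> Inf S" by (rule functional_le_limit[OF UG u])
  then have "functional u g \<le> functional v h" if "W0_grad_all v h" for v h
    using lower[OF that] by linarith
  with u(1) show ?thesis by (rule that)
qed

section \<open>Weak solutions\<close>

definition weak_solution_grad :: "('a \<Rightarrow> real) \<Rightarrow> ('a \<Rightarrow> 'a) \<Rightarrow> bool" where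
  "weak_solution_grad u g \<longleftrightarrow>
    W0_grad_all u g \<and> (\<forall>v h. W0_grad_all v h \<longrightarrow> total_flux g h = load v)"

text \<open>Minimality along \<open>u + t v\<close> and the tangent inequality at \<open>u + t v\<close> give
  \<open>load v \<le> total_flux (g + t h) h\<close>; let \<open>t\<close> tend to \<open>0\<close>.\<close>

lemma minimizer_imp_load_le_total_flux:
  assumes u: "W0_grad_all u g" and v: "W0_grad_all v h"
    and minimal: "\<And>v h. W0_grad_all v h \<Longrightarrow> functional u g \<le> functional v h"
  shows "load v \<le> total_flux g h"
proof (rule LIMSEQ_le_const)
  let ?t = "\<lambda>n. inverse (real (Suc n))"
  let ?g = "\<lambda>n x. g x + ?t n *\<^sub>R h x"
  show "(\<lambda>n. total_flux (?g n) h) \<longlonglongrightarrow> total_flux g h"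
    unfolding total_flux_def
    by (intro tendsto_sum phase.flux_pairing_perturbed_tendsto
        W0_grad_all_Lp_field(2)[OF u] W0_grad_all_Lp_field(2)[OF v])
  have "load v \<le> total_flux (?g n) h" for n
  proof -
    have perturbed: "W0_grad_all (\<lambda>x. u x + ?t n * v x) (?g n)"
      using W0_grad_all_lincomb[OF u v, of 1 "?t n"] by simp
    have "?t n * load v \<le> total_energy (?g n) - total_energy g"
      using minimal[OF perturbed] load_lincomb[OF u v, of 1 "?t n"] by (simp add: functional_def)
    moreover have "total_energy (?g n) + total_flux (?g n) (\<lambda>x. (- ?t n) *\<^sub>R h x) \<le> total_energy g"
      using total_energy_ge_tangent[OF perturbed u] by simp
    ultimately have "?t n * load v \<le> ?t n * total_flux (?g n) h"
      unfolding total_flux_scaleR by linarith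
    then show ?thesis by (rule mult_left_le_imp_le) simp
  qed
  then show "\<exists>N. \<forall>n\<ge>N. load v \<le> total_flux (?g n) h" by blast
qed

lemma minimizer_imp_weak_solution_grad:
  assumes u: "W0_grad_all u g"
    and minimal: "\<And>v h. W0_grad_all v h \<Longrightarrow> functional u g \<le> functional v h"
  shows "weak_solution_grad u g"
proof -
  have "total_flux g h = load v" if v: "W0_grad_all v h" for v h
  proof (rule antisym)
    have "load (\<lambda>x. (- 1) * v x) \<le> total_flux g (\<lambda>x. (- 1) *\<^sub>R h x)"
      by (rule minimizer_imp_load_le_total_flux[OF u W0_grad_all_scale[OF v] minimal])
    then show "total_flux g h \<le> load v" unfolding load_scale total_flux_scaleR by simp
    show "load v \<le> total_flux g h" by (rule minimizer_imp_load_le_total_flux[OF u v minimal])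
  qed
  with u show ?thesis by (simp add: weak_solution_grad_def)
qed

lemma weak_solution_grad_exists: "\<exists>u g. weak_solution_grad u g"
  using minimizer_exists minimizer_imp_weak_solution_grad by metis

lemma weak_solution_grad_unique:
  assumes u: "weak_solution_grad u g" and w: "weak_solution_grad w h"
  shows "AE x in M. u x = w x"
proof -
  have W0: "W0_grad_all u g" "W0_grad_all w h"
    using u w by (auto simp: weak_solution_grad_def)
  note diff = W0_grad_all_diff[OF W0]
  define D where
    "D i = flux_pairing (p i) g (\<lambda>x. g x - h x) - flux_pairing (p i) h (\<lambda>x. g x - h x)" for i
  note monotone = phase.flux_pairing_monotone[OF W0_grad_all_Lp_field(2)[OF W0(1)]
      W0_grad_all_Lp_field(2)[OF W0(2)], folded D_def]
  have "(\<Sum>i\<in>UNIV. D i) = total_flux g (\<lambda>x. g x - h x) - total_flux h (\<lambda>x. g x - h x)"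
    by (simp add: D_def total_flux_def sum_subtractf)
  also have "\<dots> = 0" using u w diff by (simp add: weak_solution_grad_def)
  finally have "D i = 0" for i
    using monotone(1) by (simp add: sum_nonneg_eq_0_iff)
  then have "AE x in M. g x - h x = 0" using monotone(2) by simp
  from W0_grad_all_eq_0[OF diff this] show ?thesis by simp
qed

end

lemma (in bounded_domain) C_plus_imp_bounded_exponent:
  assumes "C_plus \<Omega> q"
  obtains l m where "bounded_exponent \<Omega> q l m"
proof -
  have q: "continuous_on (closure \<Omega>) q" "\<And>x. x \<in> closure \<Omega> \<Longrightarrow> 1 < q x"
    using assms by (auto simp: C_plus_def)
  obtain y where y: "y \<in> closure \<Omega>" "\<And>x. x \<in> closure \<Omega> \<Longrightarrow> q y \<le> q x"
    using continuous_attains_inf[OF compact_closure_\<Omega> q(1)] by blast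
  obtain z where "\<And>x. x \<in> closure \<Omega> \<Longrightarrow> q x \<le> q z"
    using continuous_attains_sup[OF compact_closure_\<Omega> q(1)] by blast
  then have "bounded_exponent \<Omega> q (q y) (q z)"
    using y q C_plus_measurable[OF assms] closure_subset[of \<Omega>]
    by unfold_locales auto
  then show ?thesis by (rule that)
qed

lemma (in bounded_domain) C_plus_family_imp_bounded_exponent:
  fixes p :: "'i::finite \<Rightarrow> 'a \<Rightarrow> real"
  assumes "\<And>i. C_plus \<Omega> (p i)"
  obtains l m where "\<And>i. bounded_exponent \<Omega> (p i) l m"
proof -
  have "\<exists>l m. bounded_exponent \<Omega> (p i) l m" for i
    using C_plus_imp_bounded_exponent[OF assms] by blast
  then obtain l m where lm: "\<And>i. bounded_exponent \<Omega> (p i) (l i) (m i)" by metis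
  have "bounded_exponent \<Omega> (p i) (Min (range l)) (Max (range m))" for i
  proof
    show "1 < Min (range l)" using lm by (auto simp: bounded_exponent_def)
    fix x assume "x \<in> \<Omega>"
    then have "l i \<le> p i x" "p i x \<le> m i"
      using lm by (auto simp: bounded_exponent_def)
    moreover have "Min (range l) \<le> l i" "m i \<le> Max (range m)" by simp_all
    ultimately show "Min (range l) \<le> p i x" "p i x \<le> Max (range m)" by linarith+
  qed (use lm in \<open>simp add: bounded_exponent_def\<close>)
  then show ?thesis by (rule that)
qed

lemma crit_exp_imp_subcritical:
  fixes q :: "'a::euclidean_space \<Rightarrow> real"
  assumes less: "1 / ereal a + 1 / crit_exp q x < 1" and a: "1 < a" and q: "1 < q x"
  shows "1 / a + 1 / q x < 1 + 1 / real DIM('a)"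
proof (cases "q x < real DIM('a)")
  case True
  let ?N = "real DIM('a)"
  have "ereal (1 / a) + ereal (1 / (?N * q x / (?N - q x))) < 1"
    using less a q True by (simp add: crit_exp_def one_ereal_def)
  then have "1 / a + 1 / (?N * q x / (?N - q x)) < 1" by (simp add: one_ereal_def)
  moreover have "1 / (?N * q x / (?N - q x)) = 1 / q x - 1 / ?N"
    using True q by (simp add: field_simps)
  ultimately show ?thesis by linarith
next
  case False
  then have "1 / q x \<le> 1 / real DIM('a)" by (intro frac_le) auto
  moreover have "1 / a < 1" using a by simp
  ultimately show ?thesis by linarith
qed

locale two_phase_problem = multi_phase_problem \<Omega> "\<lambda>b. if b then p2 else p1" \<alpha> f l m
  for \<Omega> :: "'a::euclidean_space set" and p1 p2 \<alpha> f l m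
begin

lemma weak_solution_iff: "weak_solution \<Omega> p1 p2 f u \<longleftrightarrow> (\<exists>g. weak_solution_grad u g)"
  unfolding weak_solution_def weak_solution_grad_def W0_grad_all_iff total_flux_def flux_pairing_def
    load_def power_flux_def
  by (auto simp: UNIV_bool all_bool_eq)

end

theorem theorem3p2:
  fixes \<Omega> :: "'a::euclidean_space set" and p1 p2 \<alpha> f :: "'a \<Rightarrow> real"
  assumes "smooth_bounded_domain \<Omega>"
    and "C_plus \<Omega> p1" and "C_plus \<Omega> p2"
    and "C_plus \<Omega> \<alpha>"
    and "\<forall>x\<in>closure \<Omega>. 1 / ereal (\<alpha> x) + 1 / crit_exp (\<lambda>y. max (p1 y) (p2 y)) x < 1"
    and "f \<in> Lp_var \<Omega> \<alpha>"
  shows "\<exists>u. weak_solution \<Omega> p1 p2 f u \<and>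
           (\<forall>w. weak_solution \<Omega> p1 p2 f w \<longrightarrow> (AE x in lebesgue_on \<Omega>. w x = u x))"
proof -
  interpret bounded_domain \<Omega>
    using assms(1) by unfold_locales (auto simp: smooth_bounded_domain_def)
  let ?p = "\<lambda>b. if b then p2 else p1"
  have C_plus: "C_plus \<Omega> (?p b)" for b using assms(2,3) by simp
  then obtain l m where "bounded_exponent \<Omega> (?p b) l m" for b
    using C_plus_family_imp_bounded_exponent[of ?p] by blast
  moreover have "1 / \<alpha> x + 1 / Max (range (\<lambda>b. ?p b x)) < 1 + 1 / real DIM('a)"
    if "x \<in> closure \<Omega>" for x
  proof -
    have "1 / \<alpha> x + 1 / max (p1 x) (p2 x) < 1 + 1 / real DIM('a)"
      using assms(2-5) that
      by (intro crit_exp_imp_subcritical[of _ "\<lambda>y. max (p1 y) (p2 y)"]) (auto simp: C_plus_def)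
    then show ?thesis by (simp add: UNIV_bool)
  qed
  ultimately interpret two_phase_problem \<Omega> p1 p2 \<alpha> f l m
    using C_plus assms(4,6)
    by (intro two_phase_problem.intro multi_phase_problem.intro multi_phase_problem_axioms.intro
        bounded_domain_axioms) blast+
  show ?thesis
    unfolding weak_solution_iff using weak_solution_grad_exists weak_solution_grad_unique by blast
qed

end
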